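(* Suppose Assumptions 1, 2 and 3 hold. Let $\eta>0$ be a constant independent of $N$, and for each $N$ let $\epsilon^{\mathrm{fe}}_N\ge 0$ and $\epsilon^{\mathrm{rd}}_N\ge 0$ satisfy $\epsilon^{\mathrm{fe}}_N\le K_1/N$ and $\epsilon^{\mathrm{rd}}_N\le K_1/N$ for some constant $K_1$ independent of $N$, where $(\eta,\epsilon^{\mathrm{fe}}_N)$ is a feasibility-ensuring pair for every $N$. Let $\pi$ be the two-set policy with parameters $(\eta,\epsilon^{\mathrm{fe}}_N,\epsilon^{\mathrm{rd}}_N)$. Then there exist constants $C>0$ and $K>0$, independent of $N$, such that for every $N$ (with $\alpha N$ an integer) and every initial state vector $\mathbf S_0$, $$R^{\mathrm{rel}}-R(\pi,\mathbf S_0)\le K e^{-CN}.$$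
   Context: Restless bandit (RB) setup. A single-armed MDP $(\mathbb S,\mathbb A,P,r)$ has finite state space $\mathbb S$, action set $\mathbb A=\{0,1\}$, transition kernel $P:\mathbb S\times\mathbb A\times\mathbb S\to[0,1]$ and reward $r:\mathbb S\times\mathbb A\to\mathbb R$; $\alpha\in(0,1)$ is the budget fraction. The $N$-armed problem ($\alpha N$ an integer) has $N$ arms indexed by $[N]$; given their states and actions, arms transition independently according to $P$. At each time $t$ a policy chooses actions $A_t(i)\in\{0,1\}$ with $\sum_{i\in[N]}A_t(i)=\alpha N$. $S_t(i)$ is the state of arm $i$ at time $t$ and $\mathbf S_t$ the state vector. For $D\subseteq[N]$, $m(D)=|D|/N$ and $X_t(D)=(X_t(D,s))_{s\in\mathbb S}$ (a row vector) with $X_t(D,s)=\frac1N\#\{i\in D:S_t(i)=s\}$; the map $D\mapsto X_t(D)$ is the system state, a generic system state being written $x$. The long-run average reward of a policy $\pi$ from $\mathbf S_0$ is $R(\pi,\mathbf S_0)=\lim_{T\to\infty}\frac1T\sum_{t=0}^{T-1}\frac1N\sum_{i}\mathbb E[r(S_t(i),A_t(i))]$. LP relaxation: maximize $\sum_{s,a}r(s,a)y(s,a)$ over $y\ge0$ subject to $\sum_s y(s,1)=\alpha$, $\sum_{s',a}y(s',a)P(s',a,s)=\sum_a y(s,a)$ for all $s$, and $\sum_{s,a}y(s,a)=1$. $R^{\mathrm{rel}}$ is its optimal value and $y^*$ a fixed optimal solution. Define $\bar\pi^*(a|s)=y^*(s,a)/(y^*(s,0)+y^*(s,1))$ if $y^*(s,0)+y^*(s,1)>0$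 and $\bar\pi^*(a|s)=1/2$ otherwise, and $P_{\bar\pi^*}(s,s')=\sum_a\bar\pi^*(a|s)P(s,a,s')$. Assumption 1 (aperiodic unichain): $1$ is a simple eigenvalue of $P_{\bar\pi^*}$ and all other eigenvalues have modulus $<1$. Then $\mu^*(s)=y^*(s,0)+y^*(s,1)$ is its unique stationary distribution (row vector). Assumption 2 (non-degeneracy): there is a unique state $\tilde s$ with $y^*(\tilde s,0)>0$ and $y^*(\tilde s,1)>0$. Under Assumption 2 let $\Phi=P_{\bar\pi^*}-\mathbf 1^\top\mu^*-(c-\alpha\mathbf 1)^\top(P_1(\tilde s)-P_0(\tilde s))$, where $c=(\bar\pi^*(1|s))_{s}$, $P_a(\tilde s)=(P(\tilde s,a,s))_s$ are row vectors and $\mathbf 1$ is the all-ones row vector. Assumption 3 (local stability): all eigenvalues of $\Phi$ have modulus $<1$. Let $S^+=\{s:y^*(s,1)>0,y^*(s,0)=0\}$, $S^-=\{s:y^*(s,1)=0,y^*(s,0)>0\}$, $S^\emptyset=\{s:y^*(s,1)=y^*(s,0)=0\}$. Randomized rounding of a real $c\ge0$: the random integer equal to $\lceil c\rceil$ with probability $c-\lfloor c\rfloor$ and to $\lfloor c\rfloor$ otherwise (so its mean is $c$). Unconstrained Optimal Control (UOC) applied to a set of arms with $z(s)$ arms in state $s$: for each $s$, activate a randomized rounding of $\bar\pi^*(1|s)z(s)$ of the arms in state $s$. Optimal Local Control (OLC) applied to a set of $n$ arms with $z(s)$ arms in state $s$, defined when the OLC condition $\sum_{s\neq\tilde s}\bar\pi^*(1|s)z(s)\le\alpha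 n-|S^\emptyset|-1$ and $\sum_{s\neq\tilde s}\bar\pi^*(0|s)z(s)\le(1-\alpha)n-|S^\emptyset|-1$ holds: let the target budget $B$ be a randomized rounding of $\alpha n$; activate all arms in states of $S^+$, none in states of $S^-$, a randomized rounding of $z(s)/2$ arms in each state $s\in S^\emptyset$, and activate arms in state $\tilde s$ so that exactly $B$ arms of the set are active. Weighted norm: $U=\sum_{k\ge0}\Phi^k(\Phi^\top)^k$ and $\|v\|_U=\sqrt{vUv^\top}$. Slack: for a pair $(\eta,\epsilon^{\mathrm{fe}})$, $\delta(x,D)=\eta\,m(D)-\|x(D)-m(D)\mu^*\|_U-\epsilon^{\mathrm{fe}}$. The pair is feasibility-ensuring if for every system state $x$ and $D\subseteq[N]$ with $\delta(x,D)\ge0$ the OLC condition holds with $z(s)=Nx(D,s)$, $n=|D|$. For $\epsilon^{\mathrm{rd}}\ge0$, $D$ is $\epsilon^{\mathrm{rd}}$-maximal feasible for $x$ if (i) $\delta(x,D)\ge0$ or $D=\emptyset$, and (ii) every $D'\supseteq D$ with $\delta(x,D')\ge\epsilon^{\mathrm{rd}}$ satisfies $m(D')\le m(D)+\epsilon^{\mathrm{rd}}$. Two-set policy with parameters $(\eta,\epsilon^{\mathrm{fe}},\epsilon^{\mathrm{rd}})$, $\beta=\min(\alpha,1-\alpha)$: set $D^{\mathrm{OL}}_{-1}=D^{\pi}_{-1}=\emptyset$. At each $t\ge0$: (1) if $\delta(X_t,[N])\ge0$ let $D^{\mathrm{OL}}_t=[N]$; else if $\delta(X_t,D^{\mathrm{OL}}_{t-1})\ge0$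 let $D^{\mathrm{OL}}_t$ be an $\epsilon^{\mathrm{rd}}$-maximal feasible set for $X_t$ containing $D^{\mathrm{OL}}_{t-1}$; else let $D^{\mathrm{OL}}_t$ be any $\epsilon^{\mathrm{rd}}$-maximal feasible set for $X_t$. (2) Choose $D^\pi_t$ with $D^\pi_{t-1}\setminus D^{\mathrm{OL}}_t\subseteq D^\pi_t\subseteq[N]\setminus D^{\mathrm{OL}}_t$ and $|D^\pi_t|=\lfloor\beta(N-|D^{\mathrm{OL}}_t|)\rfloor$. (3) Arms in $D^{\mathrm{OL}}_t$ act by OLC applied to $D^{\mathrm{OL}}_t$, arms in $D^\pi_t$ by UOC applied to $D^\pi_t$, and the remaining arms receive actions making $\sum_iA_t(i)=\alpha N$ (always possible). All choices in (1)–(3) are made by a fixed rule depending only on $(X_t,D^{\mathrm{OL}}_{t-1},D^\pi_{t-1})$ and independent randomization, so that $(X_t,D^{\mathrm{OL}}_t,D^\pi_t)$ is a finite-state Markov chain and $R(\pi,\mathbf S_0)$ is well defined. *)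

theory Defs
  imports "HOL-Probability.Probability" "Jordan_Normal_Form.Char_Poly"
begin

text \<open>Conventions. The finite state space is identified with the set of naturals below nS.
Actions 0 and 1 are represented by False and True. The transition kernel P s a is a pmf
on states, i.e. P(s,a,s') = pmf (P s a) s'. Arms are the naturals below N.
A state vector is a function from arms to states (values at arms outside {..<N} are ignored).\<close>

definition lp_obj :: "nat \<Rightarrow> (nat \<Rightarrow> bool \<Rightarrow> real) \<Rightarrow> (nat \<Rightarrow> bool \<Rightarrow> real) \<Rightarrow> real" where
  "lp_obj nS r y = (\<Sum>s<nS. \<Sum>a\<in>UNIV. r s a * y s a)"

definition lp_feasible :: "nat \<Rightarrow> (nat \<Rightarrow> bool \<Rightarrow> nat pmf) \<Rightarrow> real \<Rightarrow> (nat \<Rightarrow> bool \<Rightarrow> real) \<Rightarrow> bool" where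
  "lp_feasible nS P \<alpha> y \<longleftrightarrow>
     (\<forall>s<nS. \<forall>a. y s a \<ge> 0) \<and>
     (\<Sum>s<nS. y s True) = \<alpha> \<and>
     (\<forall>s<nS. (\<Sum>s'<nS. \<Sum>a\<in>UNIV. y s' a * pmf (P s' a) s) = (\<Sum>a\<in>UNIV. y s a)) \<and>
     (\<Sum>s<nS. \<Sum>a\<in>UNIV. y s a) = 1"

definition R_rel :: "nat \<Rightarrow> (nat \<Rightarrow> bool \<Rightarrow> nat pmf) \<Rightarrow> (nat \<Rightarrow> bool \<Rightarrow> real) \<Rightarrow> real \<Rightarrow> real" where
  "R_rel nS P r \<alpha> = Sup (lp_obj nS r ` {y. lp_feasible nS P \<alpha> y})"

definition lp_optimal :: "nat \<Rightarrow> (nat \<Rightarrow> bool \<Rightarrow> nat pmf) \<Rightarrow> (nat \<Rightarrow> bool \<Rightarrow> real) \<Rightarrow> real \<Rightarrow> (nat \<Rightarrow> bool \<Rightarrow> real) \<Rightarrow> bool" where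
  "lp_optimal nS P r \<alpha> y \<longleftrightarrow> lp_feasible nS P \<alpha> y \<and>
     (\<forall>y'. lp_feasible nS P \<alpha> y' \<longrightarrow> lp_obj nS r y' \<le> lp_obj nS r y)"

definition pibar :: "(nat \<Rightarrow> bool \<Rightarrow> real) \<Rightarrow> bool \<Rightarrow> nat \<Rightarrow> real" where
  "pibar y a s = (if y s False + y s True > 0 then y s a / (y s False + y s True) else 1/2)"

definition mu :: "(nat \<Rightarrow> bool \<Rightarrow> real) \<Rightarrow> nat \<Rightarrow> real" where
  "mu y s = y s False + y s True"

definition P_pibar :: "nat \<Rightarrow> (nat \<Rightarrow> bool \<Rightarrow> nat pmf) \<Rightarrow> (nat \<Rightarrow> bool \<Rightarrow> real) \<Rightarrow> real mat" where
  "P_pibar nS P y = mat nS nS (\<lambda>(s, s'). \<Sum>a\<in>UNIV. pibar y a s * pmf (P s a) s')"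

definition assumption1 :: "nat \<Rightarrow> (nat \<Rightarrow> bool \<Rightarrow> nat pmf) \<Rightarrow> (nat \<Rightarrow> bool \<Rightarrow> real) \<Rightarrow> bool" where
  "assumption1 nS P y \<longleftrightarrow>
     (let A = map_mat complex_of_real (P_pibar nS P y) in
       order 1 (char_poly A) = 1 \<and> (\<forall>k. eigenvalue A k \<and> k \<noteq> 1 \<longrightarrow> cmod k < 1))"

definition assumption2 :: "nat \<Rightarrow> (nat \<Rightarrow> bool \<Rightarrow> real) \<Rightarrow> nat \<Rightarrow> bool" where
  "assumption2 nS y st \<longleftrightarrow> st < nS \<and> y st False > 0 \<and> y st True > 0 \<and>
     (\<forall>s<nS. y s False > 0 \<and> y s True > 0 \<longrightarrow> s = st)"

definition Phi :: "nat \<Rightarrow> (nat \<Rightarrow> bool \<Rightarrow> nat pmf) \<Rightarrow> real \<Rightarrow> (nat \<Rightarrow> bool \<Rightarrow> real) \<Rightarrow> nat \<Rightarrow> real mat" where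
  "Phi nS P \<alpha> y st = mat nS nS (\<lambda>(i, j).
      (\<Sum>a\<in>UNIV. pibar y a i * pmf (P i a) j) - mu y j
      - (pibar y True i - \<alpha>) * (pmf (P st True) j - pmf (P st False) j))"

definition assumption3 :: "nat \<Rightarrow> (nat \<Rightarrow> bool \<Rightarrow> nat pmf) \<Rightarrow> real \<Rightarrow> (nat \<Rightarrow> bool \<Rightarrow> real) \<Rightarrow> nat \<Rightarrow> bool" where
  "assumption3 nS P \<alpha> y st \<longleftrightarrow>
     (\<forall>k. eigenvalue (map_mat complex_of_real (Phi nS P \<alpha> y st)) k \<longrightarrow> cmod k < 1)"

definition Umat :: "nat \<Rightarrow> (nat \<Rightarrow> bool \<Rightarrow> nat pmf) \<Rightarrow> real \<Rightarrow> (nat \<Rightarrow> bool \<Rightarrow> real) \<Rightarrow> nat \<Rightarrow> nat \<Rightarrow> nat \<Rightarrow> real" where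
  "Umat nS P \<alpha> y st i j = (\<Sum>k. ((Phi nS P \<alpha> y st ^\<^sub>m k) * (transpose_mat (Phi nS P \<alpha> y st) ^\<^sub>m k)) $$ (i, j))"

definition normU :: "nat \<Rightarrow> (nat \<Rightarrow> bool \<Rightarrow> nat pmf) \<Rightarrow> real \<Rightarrow> (nat \<Rightarrow> bool \<Rightarrow> real) \<Rightarrow> nat \<Rightarrow> (nat \<Rightarrow> real) \<Rightarrow> real" where
  "normU nS P \<alpha> y st v = sqrt (\<Sum>i<nS. \<Sum>j<nS. v i * Umat nS P \<alpha> y st i j * v j)"

definition S_plus :: "nat \<Rightarrow> (nat \<Rightarrow> bool \<Rightarrow> real) \<Rightarrow> nat set" where
  "S_plus nS y = {s. s < nS \<and> y s True > 0 \<and> y s False = 0}"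
definition S_minus :: "nat \<Rightarrow> (nat \<Rightarrow> bool \<Rightarrow> real) \<Rightarrow> nat set" where
  "S_minus nS y = {s. s < nS \<and> y s True = 0 \<and> y s False > 0}"
definition S_empty :: "nat \<Rightarrow> (nat \<Rightarrow> bool \<Rightarrow> real) \<Rightarrow> nat set" where
  "S_empty nS y = {s. s < nS \<and> y s True = 0 \<and> y s False = 0}"

definition Xs :: "nat \<Rightarrow> (nat \<Rightarrow> nat) \<Rightarrow> nat set \<Rightarrow> nat \<Rightarrow> real" where
  "Xs N S D s = real (card {i\<in>D. S i = s}) / real N"

definition mD :: "nat \<Rightarrow> nat set \<Rightarrow> real" where
  "mD N D = real (card D) / real N"

definition slack :: "nat \<Rightarrow> (nat \<Rightarrow> bool \<Rightarrow> nat pmf) \<Rightarrow> real \<Rightarrow> (nat \<Rightarrow> bool \<Rightarrow> real) \<Rightarrow> nat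
     \<Rightarrow> real \<Rightarrow> real \<Rightarrow> nat \<Rightarrow> (nat \<Rightarrow> nat) \<Rightarrow> nat set \<Rightarrow> real" where
  "slack nS P \<alpha> y st \<eta> efe N S D =
     \<eta> * mD N D - normU nS P \<alpha> y st (\<lambda>s. Xs N S D s - mD N D * mu y s) - efe"

text \<open>OLC condition for a set of n arms with z s arms in state s.\<close>
definition olc_cond :: "nat \<Rightarrow> real \<Rightarrow> (nat \<Rightarrow> bool \<Rightarrow> real) \<Rightarrow> nat \<Rightarrow> (nat \<Rightarrow> real) \<Rightarrow> nat \<Rightarrow> bool" where
  "olc_cond nS \<alpha> y st z n \<longleftrightarrow>
     (\<Sum>s\<in>{..<nS} - {st}. pibar y True s * z s) \<le> \<alpha> * real n - real (card (S_empty nS y)) - 1 \<and>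
     (\<Sum>s\<in>{..<nS} - {st}. pibar y False s * z s) \<le> (1 - \<alpha>) * real n - real (card (S_empty nS y)) - 1"

definition feasibility_ensuring :: "nat \<Rightarrow> (nat \<Rightarrow> bool \<Rightarrow> nat pmf) \<Rightarrow> real \<Rightarrow> (nat \<Rightarrow> bool \<Rightarrow> real) \<Rightarrow> nat
     \<Rightarrow> nat \<Rightarrow> real \<Rightarrow> real \<Rightarrow> bool" where
  "feasibility_ensuring nS P \<alpha> y st N \<eta> efe \<longleftrightarrow>
     (\<forall>S D. (\<forall>i<N. S i < nS) \<longrightarrow> D \<subseteq> {..<N} \<longrightarrow> slack nS P \<alpha> y st \<eta> efe N S D \<ge> 0 \<longrightarrow>
        olc_cond nS \<alpha> y st (\<lambda>s. real (card {i\<in>D. S i = s})) (card D))"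

definition eps_max_feasible :: "nat \<Rightarrow> (nat \<Rightarrow> bool \<Rightarrow> nat pmf) \<Rightarrow> real \<Rightarrow> (nat \<Rightarrow> bool \<Rightarrow> real) \<Rightarrow> nat
     \<Rightarrow> real \<Rightarrow> real \<Rightarrow> real \<Rightarrow> nat \<Rightarrow> (nat \<Rightarrow> nat) \<Rightarrow> nat set \<Rightarrow> bool" where
  "eps_max_feasible nS P \<alpha> y st \<eta> efe erd N S D \<longleftrightarrow>
     D \<subseteq> {..<N} \<and>
     (slack nS P \<alpha> y st \<eta> efe N S D \<ge> 0 \<or> D = {}) \<and>
     (\<forall>D'. D \<subseteq> D' \<longrightarrow> D' \<subseteq> {..<N} \<longrightarrow> slack nS P \<alpha> y st \<eta> efe N S D' \<ge> erd \<longrightarrow>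
        mD N D' \<le> mD N D + erd)"

definition rround :: "real \<Rightarrow> nat pmf" where
  "rround c = map_pmf (\<lambda>b. if b then nat \<lceil>c\<rceil> else nat \<lfloor>c\<rfloor>) (bernoulli_pmf (c - of_int \<lfloor>c\<rfloor>))"

text \<open>Step (1)-(2) of the two-set policy: validity of the chosen pair (D_OL_t, D_pi_t) given
the state vector S = S_t and the previous sets Dop = D_OL_{t-1}, Dpp = D_pi_{t-1}.\<close>
definition sel_valid :: "nat \<Rightarrow> (nat \<Rightarrow> bool \<Rightarrow> nat pmf) \<Rightarrow> real \<Rightarrow> (nat \<Rightarrow> bool \<Rightarrow> real) \<Rightarrow> nat
     \<Rightarrow> real \<Rightarrow> real \<Rightarrow> real \<Rightarrow> nat \<Rightarrow> (nat \<Rightarrow> nat) \<Rightarrow> nat set \<Rightarrow> nat set \<Rightarrow> nat set \<Rightarrow> nat set \<Rightarrow> bool" where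
  "sel_valid nS P \<alpha> y st \<eta> efe erd N S Dop Dpp Do Dp \<longleftrightarrow>
     (if slack nS P \<alpha> y st \<eta> efe N S {..<N} \<ge> 0 then Do = {..<N}
      else if slack nS P \<alpha> y st \<eta> efe N S Dop \<ge> 0
        then Dop \<subseteq> Do \<and> eps_max_feasible nS P \<alpha> y st \<eta> efe erd N S Do
      else eps_max_feasible nS P \<alpha> y st \<eta> efe erd N S Do) \<and>
     Dpp - Do \<subseteq> Dp \<and> Dp \<subseteq> {..<N} - Do \<and>
     card Dp = nat \<lfloor>min \<alpha> (1 - \<alpha>) * (real N - real (card Do))\<rfloor>"

text \<open>Step (3): the action distribution (an action profile is a function from arms to bool)
given S, D_OL = Do and D_pi = Dp: OLC on Do, UOC on Dp, total budget alpha N.\<close>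
definition act_valid :: "nat \<Rightarrow> real \<Rightarrow> (nat \<Rightarrow> bool \<Rightarrow> real) \<Rightarrow> nat
     \<Rightarrow> (nat \<Rightarrow> nat) \<Rightarrow> nat set \<Rightarrow> nat set \<Rightarrow> (nat \<Rightarrow> bool) pmf \<Rightarrow> bool" where
  "act_valid nS \<alpha> y N S Do Dp q \<longleftrightarrow>
     (\<forall>A\<in>set_pmf q. real (card {i\<in>{..<N}. A i}) = \<alpha> * real N \<and>
        (\<forall>i\<in>Do. S i \<in> S_plus nS y \<longrightarrow> A i) \<and>
        (\<forall>i\<in>Do. S i \<in> S_minus nS y \<longrightarrow> \<not> A i)) \<and>
     map_pmf (\<lambda>A. card {i\<in>Do. A i}) q = rround (\<alpha> * real (card Do)) \<and>
     (\<forall>s\<in>S_empty nS y. map_pmf (\<lambda>A. card {i\<in>Do. S i = s \<and> A i}) q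
          = rround (real (card {i\<in>Do. S i = s}) / 2)) \<and>
     (\<forall>s<nS. map_pmf (\<lambda>A. card {i\<in>Dp. S i = s \<and> A i}) q
          = rround (pibar y True s * real (card {i\<in>Dp. S i = s})))"

type_synonym cstate = "(nat \<Rightarrow> nat) \<times> nat set \<times> nat set"

text \<open>The policy is given by a selection kernel dsel (steps 1-2) and an action kernel act
(step 3); the Markov chain (S_t, D_OL_t, D_pi_t) evolves by step_pmf.\<close>
definition step_pmf :: "nat \<Rightarrow> (nat \<Rightarrow> bool \<Rightarrow> nat pmf) \<Rightarrow> (cstate \<Rightarrow> (nat set \<times> nat set) pmf)
     \<Rightarrow> ((nat \<Rightarrow> nat) \<Rightarrow> nat set \<Rightarrow> nat set \<Rightarrow> (nat \<Rightarrow> bool) pmf) \<Rightarrow> cstate \<Rightarrow> cstate pmf" where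
  "step_pmf N P dsel act x =
     bind_pmf (dsel x) (\<lambda>(Do, Dp). bind_pmf (act (fst x) Do Dp) (\<lambda>A.
       map_pmf (\<lambda>S'. (S', Do, Dp)) (Pi_pmf {..<N} 0 (\<lambda>i. P (fst x i) (A i)))))"

definition action_pmf :: "(cstate \<Rightarrow> (nat set \<times> nat set) pmf)
     \<Rightarrow> ((nat \<Rightarrow> nat) \<Rightarrow> nat set \<Rightarrow> nat set \<Rightarrow> (nat \<Rightarrow> bool) pmf) \<Rightarrow> cstate \<Rightarrow> (nat \<Rightarrow> bool) pmf" where
  "action_pmf dsel act x = bind_pmf (dsel x) (\<lambda>(Do, Dp). act (fst x) Do Dp)"

definition stage_reward :: "nat \<Rightarrow> (nat \<Rightarrow> bool \<Rightarrow> real) \<Rightarrow> (cstate \<Rightarrow> (nat set \<times> nat set) pmf)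
     \<Rightarrow> ((nat \<Rightarrow> nat) \<Rightarrow> nat set \<Rightarrow> nat set \<Rightarrow> (nat \<Rightarrow> bool) pmf) \<Rightarrow> cstate \<Rightarrow> real" where
  "stage_reward N r dsel act x =
     measure_pmf.expectation (action_pmf dsel act x) (\<lambda>A. (\<Sum>i<N. r (fst x i) (A i)) / real N)"

definition state_dist :: "nat \<Rightarrow> (nat \<Rightarrow> bool \<Rightarrow> nat pmf) \<Rightarrow> (cstate \<Rightarrow> (nat set \<times> nat set) pmf)
     \<Rightarrow> ((nat \<Rightarrow> nat) \<Rightarrow> nat set \<Rightarrow> nat set \<Rightarrow> (nat \<Rightarrow> bool) pmf) \<Rightarrow> (nat \<Rightarrow> nat) \<Rightarrow> nat \<Rightarrow> cstate pmf" where
  "state_dist N P dsel act S0 t =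
     ((\<lambda>d. bind_pmf d (step_pmf N P dsel act)) ^^ t) (return_pmf (S0, {}, {}))"

definition avg_reward :: "nat \<Rightarrow> (nat \<Rightarrow> bool \<Rightarrow> nat pmf) \<Rightarrow> (nat \<Rightarrow> bool \<Rightarrow> real) \<Rightarrow> (cstate \<Rightarrow> (nat set \<times> nat set) pmf)
     \<Rightarrow> ((nat \<Rightarrow> nat) \<Rightarrow> nat set \<Rightarrow> nat set \<Rightarrow> (nat \<Rightarrow> bool) pmf) \<Rightarrow> (nat \<Rightarrow> nat) \<Rightarrow> real" where
  "avg_reward N P r dsel act S0 =
     lim (\<lambda>T. (\<Sum>t<T. measure_pmf.expectation (state_dist N P dsel act S0 t)
                           (stage_reward N r dsel act)) / real T)"

inductive_set reachable :: "nat \<Rightarrow> (nat \<Rightarrow> bool \<Rightarrow> nat pmf) \<Rightarrow> (cstate \<Rightarrow> (nat set \<times> nat set) pmf)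
     \<Rightarrow> ((nat \<Rightarrow> nat) \<Rightarrow> nat set \<Rightarrow> nat set \<Rightarrow> (nat \<Rightarrow> bool) pmf) \<Rightarrow> (nat \<Rightarrow> nat) \<Rightarrow> cstate set"
  for N P dsel act S0 where
  init: "(S0, {}, {}) \<in> reachable N P dsel act S0"
| step: "x \<in> reachable N P dsel act S0 \<Longrightarrow> x' \<in> set_pmf (step_pmf N P dsel act x)
          \<Longrightarrow> x' \<in> reachable N P dsel act S0"

definition two_set_policy :: "nat \<Rightarrow> (nat \<Rightarrow> bool \<Rightarrow> nat pmf) \<Rightarrow> real \<Rightarrow> (nat \<Rightarrow> bool \<Rightarrow> real) \<Rightarrow> nat
     \<Rightarrow> real \<Rightarrow> real \<Rightarrow> real \<Rightarrow> nat \<Rightarrow> (cstate \<Rightarrow> (nat set \<times> nat set) pmf)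
     \<Rightarrow> ((nat \<Rightarrow> nat) \<Rightarrow> nat set \<Rightarrow> nat set \<Rightarrow> (nat \<Rightarrow> bool) pmf) \<Rightarrow> bool" where
  "two_set_policy nS P \<alpha> y st \<eta> efe erd N dsel act \<longleftrightarrow>
     (\<forall>S0. (\<forall>i<N. S0 i < nS) \<longrightarrow>
       (\<forall>(S, Dop, Dpp) \<in> reachable N P dsel act S0.
          \<forall>(Do, Dp) \<in> set_pmf (dsel (S, Dop, Dpp)).
             sel_valid nS P \<alpha> y st \<eta> efe erd N S Dop Dpp Do Dp \<and>
             act_valid nS \<alpha> y N S Do Dp (act S Do Dp)))"

end

theory Submission
  imports Defs "HOL-Probability.Hoeffding" "Jordan_Normal_Form.Spectral_Radius"
    "Jordan_Normal_Form.Jordan_Normal_Form_Uniqueness"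
begin

text \<open>On the OLC set the state counts follow, up to sampling noise and rounding, the affine map
  \<open>X \<mapsto> X \<Phi> + m \<mu>\<close>, and on the UOC set they follow the Markov kernel \<open>Q = P_pibar\<close>. By Hoeffding's
  inequality all errors made in one step are below a fixed \<open>e\<close> except with probability
  exponentially small in \<open>N\<close>. Hence it is enough to analyse trajectories with errors at most \<open>e\<close>:
  the contraction of the weighted norm under \<open>\<Phi>\<close> keeps an OLC set of non-negligible mass feasible,
  mixing of the UOC set together with maximality makes the uncovered mass decay geometrically, and
  once almost all arms are covered the whole population contracts towards \<open>\<mu>\<close>. So after a number of
  steps independent of \<open>N\<close> and of the starting point, the full set of arms is feasible.
  When the full set is feasible, reward and expected next state are exactly affine in the
  current state, and the solution of the Poisson equation of this affine system turns the reward
  into \<open>R_rel\<close> plus a telescoping term. The gap is therefore at most a constant times the long-run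
  frequency of the remaining states.\<close>

section \<open>Exponential decay of matrix powers and the Lyapunov norm\<close>

text \<open>Fluctuations of order 1/sqrt(N) never disappear, but they cost nothing: while all arms
  follow OLC, the expected reward and the expected next counts are exactly affine in the current
  counts, so zero-mean noise leaves no second-order term. Only leaving the region where this holds
  is paid for, and that takes an error of fixed size. The obstacle is that an OLC set stays feasible
  only if its mass outweighs the error of one step. A set lighter than \<open>M0 * e\<close> may be
  dropped by the next selection, so growth of the sets themselves cannot be asserted. The argument
  therefore counts mass and grants a loss of \<open>M0 * e\<close> per step; the numbers of steps
  are fixed before \<open>e\<close> is chosen, so the total loss is as small as desired. No
  stationary law of the chain is constructed: attraction holds from every start, so the probability
  of a bad state at a late time is bounded by looking back a fixed number of steps.\<close>

lemma smult_pow_mat: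
  fixes A :: "'a :: comm_ring_1 mat"
  assumes A: "A \<in> carrier_mat n n"
  shows "(c \<cdot>\<^sub>m A) ^\<^sub>m k = c ^ k \<cdot>\<^sub>m (A ^\<^sub>m k)"
proof (induction k)
  case 0
  then show ?case using A by (intro eq_matI) auto
next
  case (Suc k)
  have Ak: "A ^\<^sub>m k \<in> carrier_mat n n" using A by (rule pow_carrier_mat)
  have "(c \<cdot>\<^sub>m A) ^\<^sub>m Suc k = (c ^ k \<cdot>\<^sub>m (A ^\<^sub>m k)) * (c \<cdot>\<^sub>m A)" using Suc by simp
  also have "\<dots> = c ^ k \<cdot>\<^sub>m (c \<cdot>\<^sub>m (A ^\<^sub>m k * A))"
    using A by (simp add: mult_smult_assoc_mat[OF Ak smult_carrier_mat[OF A]] mult_smult_distrib[OF Ak A])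
  also have "\<dots> = c ^ Suc k \<cdot>\<^sub>m (A ^\<^sub>m Suc k)"
    by (intro eq_matI) (auto simp: mult_ac)
  finally show ?case .
qed

text \<open>Pick \<open>\<theta>\<close> strictly between the spectral radius and 1. Dividing the
  matrix by \<open>\<theta>\<close> leaves a spectral radius below 1, so the Jordan normal form
  bounds its powers by a constant; scaling back multiplies that constant by the powers of
  \<open>\<theta>\<close>.\<close>

lemma mat_pow_exponential_decay:
  fixes M :: "real mat"
  assumes M: "M \<in> carrier_mat n n"
    and ev: "\<And>k. eigenvalue (map_mat complex_of_real M) k \<Longrightarrow> cmod k < 1"
  obtains C \<theta> where "0 < C" "0 < \<theta>" "\<theta> < 1"
    "\<And>k i j. i < n \<Longrightarrow> j < n \<Longrightarrow> \<bar>(M ^\<^sub>m k) $$ (i, j)\<bar> \<le> C * \<theta> ^ k"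
proof (cases "n = 0")
  case True
  then show ?thesis using that[of 1 "1/2"] by auto
next
  case False
  then have n: "n > 0" by simp
  define A where "A = map_mat complex_of_real M"
  have A: "A \<in> carrier_mat n n" using M by (simp add: A_def)
  have fin: "finite (spectrum A)" by (rule card_finite_spectrum(1)[OF A])
  define s where "s = spectral_radius A"
  have s1: "s < 1" "0 \<le> s"
    using spectral_radius_mem_max(1)[OF A n] ev
    by (auto simp: s_def A_def spectrum_def)
  define \<theta> where "\<theta> = (s + 1) / 2"
  have \<theta>: "0 < \<theta>" "\<theta> < 1" "s < \<theta>" using s1 by (auto simp: \<theta>_def)
  define c where "c = complex_of_real (1 / \<theta>)"
  define B where "B = c \<cdot>\<^sub>m A"
  have B: "B \<in> carrier_mat n n" using A by (simp add: B_def)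
  have c0: "c \<noteq> 0" using \<theta> by (simp add: c_def)
  have "cmod k < 1" if k: "eigenvalue B k" for k
  proof -
    obtain v where v: "v \<in> carrier_vec n" "v \<noteq> 0\<^sub>v n" "B *\<^sub>v v = k \<cdot>\<^sub>v v"
      using k B unfolding eigenvalue_def eigenvector_def by auto
    have "A *\<^sub>v v = (k * complex_of_real \<theta>) \<cdot>\<^sub>v v"
    proof -
      have "A = complex_of_real \<theta> \<cdot>\<^sub>m B" using \<theta> by (intro eq_matI) (auto simp: B_def c_def)
      then have "A *\<^sub>v v = complex_of_real \<theta> \<cdot>\<^sub>v (B *\<^sub>v v)"
        using B v(1) by (intro eq_vecI) (auto simp: scalar_prod_def sum_distrib_left mult_ac)
      then show ?thesis using v by (simp add: smult_smult_assoc mult.commute)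
    qed
    then have "eigenvalue A (k * complex_of_real \<theta>)"
      using v A unfolding eigenvalue_def eigenvector_def by auto
    then have "cmod (k * complex_of_real \<theta>) \<le> s"
      using spectral_radius_mem_max(2)[OF A n] unfolding s_def spectrum_def by auto
    then have "cmod k * \<theta> \<le> s" using \<theta> by (simp add: norm_mult)
    then have "cmod k * \<theta> < 1 * \<theta>" using \<theta> by linarith
    then show ?thesis using \<theta> by (simp only: mult_less_cancel_right_pos)
  qed
  then have "spectral_radius B < 1"
    using spectral_radius_mem_max(1)[OF B n] by (auto simp: spectrum_def)
  from spectral_radius_jnf_norm_bound_less_1_upper_triangular[OF B this]
  obtain C where C: "\<And>k. norm_bound (B ^\<^sub>m k) C" by blast
  have "\<bar>(M ^\<^sub>m k) $$ (i, j)\<bar> \<le> (\<bar>C\<bar> + 1) * \<theta> ^ k" if ij: "i < n" "j < n" for k i j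
  proof -
    have Ak: "A ^\<^sub>m k \<in> carrier_mat n n" "M ^\<^sub>m k \<in> carrier_mat n n"
      using A M by (auto intro: pow_carrier_mat)
    have "cmod ((B ^\<^sub>m k) $$ (i, j)) \<le> C"
      using C[of k] ij pow_carrier_mat[OF B, of k] B unfolding norm_bound_def by auto
    moreover have "(B ^\<^sub>m k) $$ (i, j) = c ^ k * (A ^\<^sub>m k) $$ (i, j)"
      unfolding B_def smult_pow_mat[OF A] using Ak ij A by simp
    moreover have "(A ^\<^sub>m k) $$ (i, j) = complex_of_real ((M ^\<^sub>m k) $$ (i, j))"
      unfolding A_def of_real_hom.mat_hom_pow[OF M, symmetric] using Ak ij M by simp
    ultimately have "(1 / \<theta>) ^ k * \<bar>(M ^\<^sub>m k) $$ (i, j)\<bar> \<le> C"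
      using \<theta> by (simp add: norm_mult norm_power c_def norm_divide)
    then have "\<bar>(M ^\<^sub>m k) $$ (i, j)\<bar> \<le> C * \<theta> ^ k"
      using \<theta> by (simp add: field_simps power_divide)
    also have "\<dots> \<le> (\<bar>C\<bar> + 1) * \<theta> ^ k"
      using \<theta> by (intro mult_right_mono) auto
    finally show ?thesis .
  qed
  then show ?thesis using that[of "\<bar>C\<bar> + 1" \<theta>] \<theta> by auto
qed

text \<open>Geometric multiplicity is at most algebraic multiplicity: each Jordan block for
  \<open>e\<close> adds one to the dimension of the eigenspace and at least one to the order of the
  root. This translates the simplicity in \<open>assumption1\<close>, stated through the
  characteristic polynomial, into a statement about eigenvectors.\<close>

lemma order_ge_2_if_two_eigenvectors:
  fixes A :: "complex mat"
  assumes A: "A \<in> carrier_mat n n"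
    and u: "u \<in> carrier_vec n" "A *\<^sub>v u = e \<cdot>\<^sub>v u"
    and v: "v \<in> carrier_vec n" "A *\<^sub>v v = e \<cdot>\<^sub>v v"
    and ind: "\<And>a b. a \<cdot>\<^sub>v u + b \<cdot>\<^sub>v v = 0\<^sub>v n \<Longrightarrow> a = 0 \<and> b = 0"
  shows "Polynomial.order e (char_poly A) \<ge> 2"
proof -
  obtain as where cA: "char_poly A = (\<Prod>a\<leftarrow>as. [:- a, 1:])"
    using char_poly_factorized[OF A] by auto
  from jordan_nf_exists[OF A cA] obtain n_as where jnf: "jordan_nf A n_as" by blast
  let ?K = "char_matrix A e"
  have K: "?K \<in> carrier_mat n n" using A by simp
  have ker: "w \<in> mat_kernel ?K" if "w \<in> carrier_vec n" "A *\<^sub>v w = e \<cdot>\<^sub>v w" for w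
  proof (rule Matrix_Kernel.mat_kernelI[OF K that(1)])
    have "?K *\<^sub>v w = A *\<^sub>v w + ((-e) \<cdot>\<^sub>m 1\<^sub>m n) *\<^sub>v w"
      unfolding char_matrix_def using A that by (subst add_mult_distrib_mat_vec) auto
    also have "\<dots> = 0\<^sub>v n" unfolding that(2) using that(1) by auto
    finally show "?K *\<^sub>v w = 0\<^sub>v n" .
  qed
  interpret K: kernel n n ?K by unfold_locales (rule K)
  have uv: "u \<noteq> v"
  proof
    assume "u = v"
    then have "1 \<cdot>\<^sub>v u + (-1) \<cdot>\<^sub>v v = 0\<^sub>v n" using u by auto
    from ind[OF this] show False by simp
  qed
  have sub: "{u, v} \<subseteq> mat_kernel ?K" using ker u v by auto
  have fin: "finite {u, v}" by simp
  have "\<not> K.lin_dep {u, v}"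
  proof (intro K.Ker.finite_lin_indpt2[OF fin])
    show "{u, v} \<subseteq> mat_kernel (char_matrix A e)" by (rule sub)
    fix a
    assume lc: "K.lincomb a {u, v} = 0\<^sub>v n"
    have "a u \<cdot>\<^sub>v u + a v \<cdot>\<^sub>v v = 0\<^sub>v n"
    proof (rule eq_vecI)
      fix i assume i: "i < dim_vec (0\<^sub>v n :: complex vec)"
      then have i': "i < n" by simp
      have "0 = K.lincomb a {u, v} $ i" using i' lc by simp
      also have "\<dots> = (\<Sum>w\<in>{u, v}. a w * w $ i)"
        by (rule K.lincomb_index[OF i' sub])
      also have "\<dots> = a u * u $ i + a v * v $ i" using uv by simp
      finally show "(a u \<cdot>\<^sub>v u + a v \<cdot>\<^sub>v v) $ i = 0\<^sub>v n $ i"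
        using i' u(1) v(1) by simp
    qed (use u v in auto)
    from ind[OF this] show "\<forall>w\<in>{u, v}. a w = 0" by simp
  qed
  obtain B where "finite B" "K.basis B" using kernel_basis_exists[OF K] by blast
  then have "K.Ker.fin_dim" unfolding K.Ker.fin_dim_def K.Ker.basis_def by blast
  then have "card {u, v} \<le> K.dim"
    using K.Ker.li_le_dim(2)[OF _ _ \<open>\<not> K.lin_dep {u, v}\<close>] sub by simp
  then have "2 \<le> K.dim" using uv by simp
  moreover have "K.dim = dim_gen_eigenspace A e 1"
    unfolding dim_gen_eigenspace_def using K K.kernel_dim by simp
  moreover have "dim_gen_eigenspace A e 1 \<le> Polynomial.order e (char_poly A)"
    unfolding dim_gen_eigenspace[OF jnf] jordan_nf_order[OF jnf]
    by (induction n_as) auto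
  ultimately show ?thesis by simp
qed

section \<open>Row vectors, as functions on indices, multiplied by powers of a matrix\<close>

definition vmul :: "nat \<Rightarrow> real mat \<Rightarrow> (nat \<Rightarrow> real) \<Rightarrow> nat \<Rightarrow> real" where
  "vmul n M v j = (\<Sum>i<n. v i * M $$ (i, j))"

lemma vmul_cong: "(\<And>i. i < n \<Longrightarrow> v i = w i) \<Longrightarrow> vmul n M v j = vmul n M w j"
  by (simp add: vmul_def)

lemma vmul_add: "vmul n M (\<lambda>i. v i + w i) j = vmul n M v j + vmul n M w j"
  by (simp add: vmul_def distrib_right sum.distrib)

lemma vmul_diff: "vmul n M (\<lambda>i. v i - w i) j = vmul n M v j - vmul n M w j"
  by (simp add: vmul_def left_diff_distrib sum_subtractf)

lemma vmul_cmult: "vmul n M (\<lambda>i. c * v i) j = c * vmul n M v j"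
  by (simp add: vmul_def sum_distrib_left mult_ac)

lemma vmul_mult_mat:
  assumes "A \<in> carrier_mat n n" "B \<in> carrier_mat n n" "j < n"
  shows "vmul n (A * B) v j = vmul n B (vmul n A v) j"
proof -
  have "vmul n (A * B) v j = (\<Sum>i<n. \<Sum>l<n. v i * (A $$ (i, l) * B $$ (l, j)))"
    using assms by (simp add: vmul_def scalar_prod_def sum_distrib_left atLeast0LessThan)
  also have "\<dots> = (\<Sum>l<n. \<Sum>i<n. v i * (A $$ (i, l) * B $$ (l, j)))"
    by (rule sum.swap)
  also have "\<dots> = vmul n B (vmul n A v) j"
    by (simp add: vmul_def sum_distrib_right mult.assoc)
  finally show ?thesis .
qed

lemma vmul_pow_0: "j < n \<Longrightarrow> M \<in> carrier_mat n n \<Longrightarrow> vmul n (M ^\<^sub>m 0) v j = v j"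
  by (simp add: vmul_def if_distrib[of "\<lambda>x. _ * x"] cong: if_cong)

lemma vmul_pow_Suc:
  "M \<in> carrier_mat n n \<Longrightarrow> j < n \<Longrightarrow> vmul n (M ^\<^sub>m Suc k) v j = vmul n M (vmul n (M ^\<^sub>m k) v) j"
  by (simp add: vmul_mult_mat pow_carrier_mat)

lemma vmul_pow_Suc2:
  assumes M: "M \<in> carrier_mat n n" and j: "j < n"
  shows "vmul n (M ^\<^sub>m Suc k) v j = vmul n (M ^\<^sub>m k) (vmul n M v) j"
  using j
proof (induction k arbitrary: j)
  case 0
  then show ?case using M by (simp add: vmul_pow_Suc[OF M 0] vmul_pow_0 del: pow_mat.simps)
     (simp add: vmul_def if_distrib[of "\<lambda>x. _ * x"] cong: if_cong)
next
  case (Suc k)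
  have "vmul n (M ^\<^sub>m Suc (Suc k)) v j = vmul n M (vmul n (M ^\<^sub>m Suc k) v) j"
    by (rule vmul_pow_Suc[OF M Suc.prems])
  also have "\<dots> = vmul n M (vmul n (M ^\<^sub>m k) (vmul n M v)) j"
    by (rule vmul_cong) (rule Suc.IH)
  also have "\<dots> = vmul n (M ^\<^sub>m Suc k) (vmul n M v) j"
    by (rule vmul_pow_Suc[OF M Suc.prems, symmetric])
  finally show ?case .
qed

lemma pow_mat_Suc_left:
  assumes M: "M \<in> carrier_mat n n"
  shows "M ^\<^sub>m Suc k = M * M ^\<^sub>m k"
proof (induction k)
  case 0
  then show ?case using M by simp
next
  case (Suc k)
  have "M ^\<^sub>m Suc (Suc k) = (M * M ^\<^sub>m k) * M" using Suc by simp
  also have "\<dots> = M * (M ^\<^sub>m k * M)" by (rule assoc_mult_mat[OF M pow_carrier_mat[OF M] M])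
  finally show ?case by simp
qed

lemma transpose_pow_mat:
  fixes M :: "real mat"
  assumes M: "M \<in> carrier_mat n n"
  shows "transpose_mat M ^\<^sub>m k = transpose_mat (M ^\<^sub>m k)"
proof (induction k)
  case 0
  then show ?case using M by simp
next
  case (Suc k)
  have Mk: "M ^\<^sub>m k \<in> carrier_mat n n" using M by (rule pow_carrier_mat)
  have "transpose_mat (M ^\<^sub>m Suc k) = transpose_mat (M * M ^\<^sub>m k)"
    by (simp only: pow_mat_Suc_left[OF M])
  also have "\<dots> = transpose_mat (M ^\<^sub>m k) * transpose_mat M"
    by (rule transpose_mult[OF M Mk])
  finally show ?case using Suc by simp
qed

section \<open>The Lyapunov norm of a matrix with decaying powers\<close>

locale stable_matrix =
  fixes n :: nat and M :: "real mat" and C \<theta> :: real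
  assumes M: "M \<in> carrier_mat n n" and C: "0 < C" and \<theta>: "0 < \<theta>" "\<theta> < 1"
    and decay: "\<And>k i j. i < n \<Longrightarrow> j < n \<Longrightarrow> \<bar>(M ^\<^sub>m k) $$ (i, j)\<bar> \<le> C * \<theta> ^ k"
begin

definition energy :: "(nat \<Rightarrow> real) \<Rightarrow> nat \<Rightarrow> real" where
  "energy v k = (\<Sum>l<n. (vmul n (M ^\<^sub>m k) v l)\<^sup>2)"

text \<open>This is the norm sqrt(v U v^T) with the quadratic form expanded into squared Euclidean
  norms of v M^k. In this form contraction is an index shift and the triangle inequality is
  Minkowski's.\<close>

definition lyap :: "(nat \<Rightarrow> real) \<Rightarrow> real" where
  "lyap v = sqrt (\<Sum>k. energy v k)"

lemma abs_vmul_pow_le: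
  assumes "l < n" shows "\<bar>vmul n (M ^\<^sub>m k) v l\<bar> \<le> C * \<theta> ^ k * (\<Sum>i<n. \<bar>v i\<bar>)"
proof -
  have "\<bar>vmul n (M ^\<^sub>m k) v l\<bar> \<le> (\<Sum>i<n. \<bar>v i\<bar> * \<bar>(M ^\<^sub>m k) $$ (i, l)\<bar>)"
    unfolding vmul_def by (rule order_trans[OF sum_abs]) (simp add: abs_mult)
  also have "\<dots> \<le> (\<Sum>i<n. \<bar>v i\<bar> * (C * \<theta> ^ k))"
    using assms by (intro sum_mono mult_left_mono decay) auto
  finally show ?thesis by (simp add: sum_distrib_left mult_ac)
qed

lemma energy_nonneg: "0 \<le> energy v k"
  by (simp add: energy_def sum_nonneg)

lemma energy_le: "energy v k \<le> real n * C\<^sup>2 * (\<Sum>i<n. \<bar>v i\<bar>)\<^sup>2 * (\<theta>\<^sup>2) ^ k"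
proof -
  have "energy v k \<le> (\<Sum>l<n. (C * \<theta> ^ k * (\<Sum>i<n. \<bar>v i\<bar>))\<^sup>2)"
    unfolding energy_def
  proof (rule sum_mono)
    fix l assume "l \<in> {..<n}"
    then have "\<bar>vmul n (M ^\<^sub>m k) v l\<bar>\<^sup>2 \<le> (C * \<theta> ^ k * (\<Sum>i<n. \<bar>v i\<bar>))\<^sup>2"
      by (intro power_mono abs_vmul_pow_le) auto
    then show "(vmul n (M ^\<^sub>m k) v l)\<^sup>2 \<le> (C * \<theta> ^ k * (\<Sum>i<n. \<bar>v i\<bar>))\<^sup>2" by simp
  qed
  also have "\<dots> = real n * C\<^sup>2 * (\<Sum>i<n. \<bar>v i\<bar>)\<^sup>2 * (\<theta>\<^sup>2) ^ k"
    by (simp add: power_mult_distrib power_mult[symmetric] mult_ac)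
  finally show ?thesis .
qed

lemma theta_sq: "0 \<le> \<theta>\<^sup>2" "\<theta>\<^sup>2 < 1" "norm (\<theta>\<^sup>2) < 1"
  using \<theta> power_strict_mono[of \<theta> 1 2] by auto

lemma summable_energy: "summable (energy v)"
proof (rule summable_comparison_test')
  show "summable (\<lambda>k. real n * C\<^sup>2 * (\<Sum>i<n. \<bar>v i\<bar>)\<^sup>2 * (\<theta>\<^sup>2) ^ k)"
    using theta_sq by (intro summable_mult summable_geometric)
  show "norm (energy v k) \<le> real n * C\<^sup>2 * (\<Sum>i<n. \<bar>v i\<bar>)\<^sup>2 * (\<theta>\<^sup>2) ^ k" if "k \<ge> 0" for k
    using energy_le energy_nonneg by simp
qed

definition lyap_const :: real where
  "lyap_const = sqrt (real n * C\<^sup>2 / (1 - \<theta>\<^sup>2)) + 1"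

lemma lyap_const_pos: "lyap_const > 0"
  using theta_sq by (simp add: lyap_const_def add_nonneg_pos)

lemma lyap_nonneg: "0 \<le> lyap v"
  by (simp add: lyap_def suminf_nonneg summable_energy energy_nonneg)

lemma lyap_sq: "(lyap v)\<^sup>2 = (\<Sum>k. energy v k)"
  by (simp add: lyap_def suminf_nonneg summable_energy energy_nonneg)

lemma lyap_le: "lyap v \<le> lyap_const * (\<Sum>i<n. \<bar>v i\<bar>)"
proof -
  let ?S = "\<Sum>i<n. \<bar>v i\<bar>"
  have S: "?S \<ge> 0" by (simp add: sum_nonneg)
  have "(\<Sum>k. energy v k) \<le> (\<Sum>k. real n * C\<^sup>2 * ?S\<^sup>2 * (\<theta>\<^sup>2) ^ k)"
    using theta_sq by (intro suminf_le energy_le summable_energy summable_mult summable_geometric)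
  also have "\<dots> = real n * C\<^sup>2 * ?S\<^sup>2 * (1 / (1 - \<theta>\<^sup>2))"
    using theta_sq by (subst suminf_mult) (auto simp: suminf_geometric summable_geometric)
  also have "\<dots> = (real n * C\<^sup>2 / (1 - \<theta>\<^sup>2)) * ?S\<^sup>2" by simp
  finally have "lyap v \<le> sqrt ((real n * C\<^sup>2 / (1 - \<theta>\<^sup>2)) * ?S\<^sup>2)"
    unfolding lyap_def by (rule real_sqrt_le_mono)
  also have "\<dots> = sqrt (real n * C\<^sup>2 / (1 - \<theta>\<^sup>2)) * ?S"
    using S by (subst real_sqrt_mult) simp
  also have "\<dots> \<le> lyap_const * ?S"
    using S by (simp add: lyap_const_def mult_right_mono)
  finally show ?thesis .
qed

text \<open>Replacing v by v M shifts the series by one index, so exactly the term of index 0 is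
  lost. This is the Lyapunov equation U = I + M U M^T in scalar form.\<close>

lemma lyap_vmul_sq: "(lyap (vmul n M v))\<^sup>2 = (lyap v)\<^sup>2 - (\<Sum>l<n. (v l)\<^sup>2)"
proof -
  have "energy (vmul n M v) k = energy v (Suc k)" for k
    unfolding energy_def by (intro sum.cong) (simp_all add: vmul_pow_Suc2[OF M] del: pow_mat.simps)
  then have "(lyap (vmul n M v))\<^sup>2 = (\<Sum>k. energy v (Suc k))"
    by (simp add: lyap_sq)
  also have "\<dots> = (\<Sum>k. energy v k) - energy v 0"
    by (rule suminf_split_head[OF summable_energy])
  also have "energy v 0 = (\<Sum>l<n. (v l)\<^sup>2)"
    unfolding energy_def using M by (intro sum.cong) (simp_all add: vmul_pow_0 del: pow_mat.simps)
  finally show ?thesis by (simp add: lyap_sq)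
qed

text \<open>By \<open>lyap_le\<close> and Cauchy-Schwarz the squared norm is at most
  \<open>lyap_const\<^sup>2 * real n\<close> times the squared Euclidean norm, which is what one
  application of \<open>M\<close> removes. The added 1 keeps the denominator at least 1, so that the
  radicand lies in [0, 1).\<close>

definition lyap_rate :: real where
  "lyap_rate = sqrt (1 - 1 / (lyap_const\<^sup>2 * real n + 1))"

lemma lyap_rate: "0 \<le> lyap_rate" "lyap_rate < 1"
proof -
  have "0 \<le> lyap_const\<^sup>2 * real n" by simp
  then have "0 < 1 / (lyap_const\<^sup>2 * real n + 1)" "1 / (lyap_const\<^sup>2 * real n + 1) \<le> 1"
    by (auto simp: add_nonneg_pos)
  then show "0 \<le> lyap_rate" "lyap_rate < 1" by (auto simp: lyap_rate_def)
qed

lemma lyap_contraction: "lyap (vmul n M v) \<le> lyap_rate * lyap v"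
proof -
  let ?L = "lyap_const\<^sup>2 * real n + 1" and ?Q = "\<Sum>l<n. (v l)\<^sup>2"
  have L: "?L > 0" by (simp add: add_nonneg_pos)
  have Q: "?Q \<ge> 0" by (simp add: sum_nonneg)
  have "(lyap v)\<^sup>2 \<le> (lyap_const * (\<Sum>i<n. \<bar>v i\<bar>))\<^sup>2"
    by (intro power_mono lyap_le lyap_nonneg)
  also have "\<dots> \<le> lyap_const\<^sup>2 * (real n * ?Q)"
    using Cauchy_Schwarz_ineq_sum[of "\<lambda>_. 1" "\<lambda>i. \<bar>v i\<bar>" "{..<n}"]
    by (simp add: power_mult_distrib mult_left_mono)
  also have "\<dots> \<le> ?L * ?Q" using Q by (simp add: algebra_simps)
  finally have "(lyap v)\<^sup>2 / ?L \<le> ?Q" using L by (simp add: field_simps)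
  then have "(lyap (vmul n M v))\<^sup>2 \<le> (lyap v)\<^sup>2 - (lyap v)\<^sup>2 / ?L"
    unfolding lyap_vmul_sq by simp
  also have "\<dots> = (1 - 1 / ?L) * (lyap v)\<^sup>2" by (simp add: algebra_simps)
  finally have "sqrt ((lyap (vmul n M v))\<^sup>2) \<le> sqrt ((1 - 1 / ?L) * (lyap v)\<^sup>2)"
    by (rule real_sqrt_le_mono)
  then show ?thesis
    by (simp add: real_sqrt_mult lyap_nonneg lyap_rate_def)
qed

lemma energy_partial_L2:
  "L2_set (\<lambda>(k, l). vmul n (M ^\<^sub>m k) v l) ({..<K} \<times> {..<n}) = sqrt (\<Sum>k<K. energy v k)"
  by (simp add: L2_set_def energy_def sum.cartesian_product case_prod_beta)

text \<open>For finitely many powers this is the triangle inequality of \<open>L2_set\<close> over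
  pairs of a power and a coordinate; the bound is uniform in the number of powers and passes to the
  series.\<close>

lemma lyap_triangle: "lyap (\<lambda>i. v i + w i) \<le> lyap v + lyap w"
proof -
  have part: "sqrt (\<Sum>k<K. energy u k) \<le> lyap u" for u K
    unfolding lyap_def
    by (intro real_sqrt_le_mono sum_le_suminf summable_energy) (auto simp: energy_nonneg)
  have "(\<Sum>k<K. energy (\<lambda>i. v i + w i) k) \<le> (lyap v + lyap w)\<^sup>2" for K
  proof -
    have "sqrt (\<Sum>k<K. energy (\<lambda>i. v i + w i) k)
       = L2_set (\<lambda>x. (\<lambda>(k, l). vmul n (M ^\<^sub>m k) v l) x + (\<lambda>(k, l). vmul n (M ^\<^sub>m k) w l) x) ({..<K} \<times> {..<n})"
      unfolding energy_partial_L2[symmetric] by (simp add: vmul_add case_prod_unfold)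
    also have "\<dots> \<le> sqrt (\<Sum>k<K. energy v k) + sqrt (\<Sum>k<K. energy w k)"
      unfolding energy_partial_L2[symmetric] by (rule L2_set_triangle_ineq)
    also have "\<dots> \<le> lyap v + lyap w" by (intro add_mono part)
    finally show ?thesis
      by (rule sqrt_le_D)
  qed
  then have "(\<Sum>k. energy (\<lambda>i. v i + w i) k) \<le> (lyap v + lyap w)\<^sup>2"
    by (intro suminf_le_const summable_energy)
  then show ?thesis
    unfolding lyap_def[of "\<lambda>i. v i + w i"] by (intro real_le_lsqrt) (auto simp: lyap_nonneg suminf_nonneg summable_energy energy_nonneg)
qed

lemma lyap_cong: "(\<And>i. i < n \<Longrightarrow> v i = w i) \<Longrightarrow> lyap v = lyap w"
  unfolding lyap_def energy_def by (simp add: vmul_cong[of n v w])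

text \<open>Identifies \<open>lyap\<close> with \<open>normU\<close>. Every entry of M^k (M^T)^k is
  dominated by a geometric series, so the sum over k may be exchanged with the finite sums over
  indices.\<close>

lemma lyap_eq_quadratic_form:
  "lyap v = sqrt (\<Sum>i<n. \<Sum>j<n. v i * (\<Sum>k. (M ^\<^sub>m k * transpose_mat M ^\<^sub>m k) $$ (i, j)) * v j)"
proof -
  define g where "g k i j = (M ^\<^sub>m k * transpose_mat M ^\<^sub>m k) $$ (i, j)" for k i j
  have Mk: "M ^\<^sub>m k \<in> carrier_mat n n" for k using M by (rule pow_carrier_mat)
  have g: "g k i j = (\<Sum>l<n. (M ^\<^sub>m k) $$ (i, l) * (M ^\<^sub>m k) $$ (j, l))"
    if "i < n" "j < n" for k i j
    unfolding g_def transpose_pow_mat[OF M] using that Mk[of k] M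
    by (simp add: scalar_prod_def atLeast0LessThan)
  have summ: "summable (\<lambda>k. g k i j)" if ij: "i < n" "j < n" for i j
  proof (rule summable_comparison_test')
    show "summable (\<lambda>k. real n * C\<^sup>2 * (\<theta>\<^sup>2) ^ k)"
      using theta_sq by (intro summable_mult summable_geometric)
    fix k :: nat
    have "norm (g k i j) \<le> (\<Sum>l<n. \<bar>(M ^\<^sub>m k) $$ (i, l)\<bar> * \<bar>(M ^\<^sub>m k) $$ (j, l)\<bar>)"
      unfolding g[OF ij] real_norm_def by (rule order_trans[OF sum_abs]) (simp add: abs_mult)
    also have "\<dots> \<le> (\<Sum>l<n. (C * \<theta> ^ k) * (C * \<theta> ^ k))"
      using ij C \<theta> by (intro sum_mono mult_mono decay) auto
    also have "\<dots> = real n * C\<^sup>2 * (\<theta>\<^sup>2) ^ k"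
      by (simp add: power2_eq_square power_mult_distrib mult_ac)
    finally show "norm (g k i j) \<le> real n * C\<^sup>2 * (\<theta>\<^sup>2) ^ k" .
  qed
  have en: "energy v k = (\<Sum>i<n. \<Sum>j<n. v i * g k i j * v j)" for k
  proof -
    have "energy v k = (\<Sum>l<n. \<Sum>i<n. \<Sum>j<n. (v i * (M ^\<^sub>m k) $$ (i, l)) * (v j * (M ^\<^sub>m k) $$ (j, l)))"
      by (simp add: energy_def vmul_def power2_eq_square sum_product)
    also have "\<dots> = (\<Sum>i<n. \<Sum>l<n. \<Sum>j<n. (v i * (M ^\<^sub>m k) $$ (i, l)) * (v j * (M ^\<^sub>m k) $$ (j, l)))"
      by (rule sum.swap)
    also have "\<dots> = (\<Sum>i<n. \<Sum>j<n. \<Sum>l<n. (v i * (M ^\<^sub>m k) $$ (i, l)) * (v j * (M ^\<^sub>m k) $$ (j, l)))"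
      by (intro sum.cong refl sum.swap)
    also have "\<dots> = (\<Sum>i<n. \<Sum>j<n. v i * g k i j * v j)"
      by (intro sum.cong refl) (simp add: g sum_distrib_left sum_distrib_right mult_ac)
    finally show ?thesis .
  qed
  have "(\<lambda>k. \<Sum>i<n. \<Sum>j<n. v i * g k i j * v j) sums (\<Sum>i<n. \<Sum>j<n. v i * (\<Sum>k. g k i j) * v j)"
    using summ by (intro sums_sum sums_mult sums_mult2 summable_sums) auto
  then have "(\<Sum>k. energy v k) = (\<Sum>i<n. \<Sum>j<n. v i * (\<Sum>k. g k i j) * v j)"
    unfolding en by (simp add: sums_iff)
  then show ?thesis unfolding lyap_def g_def by simp
qed

text \<open>Neumann series: w is the sum of M^k b over all k.\<close>

lemma ex_resolvent:
  obtains w where "\<And>i. i < n \<Longrightarrow> w i = b i + (\<Sum>j<n. M $$ (i, j) * w j)"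
proof -
  define a where "a k i = (\<Sum>j<n. (M ^\<^sub>m k) $$ (i, j) * b j)" for k i
  have summ: "summable (\<lambda>k. a k i)" if i: "i < n" for i
    unfolding a_def
  proof (intro summable_sum summable_mult2)
    fix j assume "j \<in> {..<n}"
    show "summable (\<lambda>k. (M ^\<^sub>m k) $$ (i, j))"
    proof (rule summable_comparison_test')
      show "summable (\<lambda>k. C * \<theta> ^ k)"
        using \<theta> by (intro summable_mult summable_geometric) simp
      show "norm ((M ^\<^sub>m k) $$ (i, j)) \<le> C * \<theta> ^ k" if "k \<ge> 0" for k
        using decay[OF i, of j k] \<open>j \<in> {..<n}\<close> by simp
    qed
  qed
  have a0: "a 0 i = b i" if "i < n" for i
    using that M by (simp add: a_def if_distrib[of "\<lambda>x. x * _"] cong: if_cong)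
  have aS: "a (Suc k) i = (\<Sum>l<n. M $$ (i, l) * a k l)" if i: "i < n" for k i
  proof -
    have Mk: "M ^\<^sub>m k \<in> carrier_mat n n" using M by (rule pow_carrier_mat)
    have "a (Suc k) i = (\<Sum>j<n. \<Sum>l<n. M $$ (i, l) * (M ^\<^sub>m k) $$ (l, j) * b j)"
      unfolding a_def pow_mat_Suc_left[OF M] using i M Mk
      by (simp add: scalar_prod_def atLeast0LessThan sum_distrib_right del: pow_mat.simps)
    also have "\<dots> = (\<Sum>l<n. \<Sum>j<n. M $$ (i, l) * (M ^\<^sub>m k) $$ (l, j) * b j)" by (rule sum.swap)
    finally show ?thesis by (simp add: a_def sum_distrib_left mult.assoc)
  qed
  show ?thesis
  proof
    fix i assume i: "i < n"
    have "(\<Sum>k. a k i) = a 0 i + (\<Sum>k. a (Suc k) i)"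
      using suminf_split_head[OF summ[OF i]] by simp
    also have "(\<Sum>k. a (Suc k) i) = (\<Sum>l<n. M $$ (i, l) * (\<Sum>k. a k l))"
    proof -
      have "(\<lambda>k. \<Sum>l<n. M $$ (i, l) * a k l) sums (\<Sum>l<n. M $$ (i, l) * (\<Sum>k. a k l))"
        using summ by (intro sums_sum sums_mult summable_sums) auto
      then show ?thesis by (simp add: aS[OF i] sums_iff)
    qed
    finally show "(\<Sum>k. a k i) = b i + (\<Sum>j<n. M $$ (i, j) * (\<Sum>k. a k j))"
      using a0[OF i] by simp
  qed
qed

end

section \<open>The fluid model\<close>

locale restless_bandit =
  fixes nS :: nat and P :: "nat \<Rightarrow> bool \<Rightarrow> nat pmf" and r :: "nat \<Rightarrow> bool \<Rightarrow> real"
    and \<alpha> :: real and y :: "nat \<Rightarrow> bool \<Rightarrow> real" and st :: nat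
  assumes nS: "nS > 0" and P_states: "\<And>s a. s < nS \<Longrightarrow> set_pmf (P s a) \<subseteq> {..<nS}"
    and alpha: "0 < \<alpha>" "\<alpha> < 1"
    and opt: "lp_optimal nS P r \<alpha> y"
    and A1: "assumption1 nS P y"
    and A2: "assumption2 nS y st"
    and A3: "assumption3 nS P \<alpha> y st"
begin

abbreviation "\<Phi> \<equiv> Phi nS P \<alpha> y st"
abbreviation "Q \<equiv> P_pibar nS P y"
abbreviation "\<mu> \<equiv> mu y"
abbreviation "c \<equiv> pibar y True"

lemma feasible: "lp_feasible nS P \<alpha> y"
  using opt by (simp add: lp_optimal_def)

lemma y_nonneg: "s < nS \<Longrightarrow> 0 \<le> y s a"
  using feasible by (simp add: lp_feasible_def)

lemma sum_y_True: "(\<Sum>s<nS. y s True) = \<alpha>"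
  using feasible by (simp add: lp_feasible_def)

lemma sum_mu: "(\<Sum>s<nS. \<mu> s) = 1"
  using feasible by (simp add: lp_feasible_def mu_def UNIV_bool add.commute)

lemma mu_nonneg: "s < nS \<Longrightarrow> 0 \<le> \<mu> s"
  using y_nonneg by (simp add: mu_def)

lemma mu_le_1: "s < nS \<Longrightarrow> \<mu> s \<le> 1"
  using member_le_sum[of s "{..<nS}" \<mu>] mu_nonneg sum_mu by simp

lemma pibar_False: "pibar y False s = 1 - c s"
  by (simp add: pibar_def eq_diff_eq add_divide_distrib[symmetric])

lemma c_bounds: "s < nS \<Longrightarrow> 0 \<le> c s" "s < nS \<Longrightarrow> c s \<le> 1"
  using y_nonneg[of s] by (auto simp: pibar_def field_simps)

lemma mu_c: "s < nS \<Longrightarrow> \<mu> s * c s = y s True"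
  using y_nonneg[of s True] y_nonneg[of s False] by (auto simp: pibar_def mu_def)

lemma mu_pibar: "s < nS \<Longrightarrow> \<mu> s * pibar y a s = y s a"
  using mu_c[of s] by (cases a) (auto simp: pibar_False algebra_simps mu_def)

lemma sum_mu_c: "(\<Sum>s<nS. \<mu> s * c s) = \<alpha>"
  using sum_y_True by (simp add: mu_c)

lemma st: "st < nS"
  using A2 by (simp add: assumption2_def)

lemma st_not_special: "st \<notin> S_plus nS y" "st \<notin> S_minus nS y" "st \<notin> S_empty nS y"
  using A2 by (auto simp: assumption2_def S_plus_def S_minus_def S_empty_def)

text \<open>Nondegeneracy leaves \<open>st\<close> as the only state where \<open>y\<close> puts
  mass on both actions. Elsewhere the LP solution is deterministic, or the state has mass 0 and
  takes the default 1/2 of \<open>pibar\<close>.\<close>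

lemma state_cases [consumes 1, case_names st plus minus empty]:
  assumes "s < nS"
  obtains "s = st" | "s \<noteq> st" "s \<in> S_plus nS y" "c s = 1" | "s \<noteq> st" "s \<in> S_minus nS y" "c s = 0"
    | "s \<noteq> st" "s \<in> S_empty nS y" "c s = 1 / 2"
proof -
  have "0 \<le> y s True" "0 \<le> y s False" using assms y_nonneg by auto
  then consider "0 < y s True" "0 < y s False" | "0 < y s True" "y s False = 0"
    | "y s True = 0" "0 < y s False" | "y s True = 0" "y s False = 0" by fastforce
  then show ?thesis
  proof cases
    case 1
    then have "s = st" using A2 assms by (auto simp: assumption2_def)
    then show ?thesis by (rule that(1))
  next
    case 2
    then have "s \<in> S_plus nS y" "c s = 1" using assms by (auto simp: S_plus_def pibar_def)
    then show ?thesis using that(2) st_not_special by metis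
  next
    case 3
    then have "s \<in> S_minus nS y" "c s = 0" using assms by (auto simp: S_minus_def pibar_def)
    then show ?thesis using that(3) st_not_special by metis
  next
    case 4
    then have "s \<in> S_empty nS y" "c s = 1 / 2" using assms by (auto simp: S_empty_def pibar_def)
    then show ?thesis using that(4) st_not_special by metis
  qed
qed

lemma Q_index: "i < nS \<Longrightarrow> j < nS \<Longrightarrow>
    Q $$ (i, j) = (1 - c i) * pmf (P i False) j + c i * pmf (P i True) j"
  by (simp add: P_pibar_def UNIV_bool pibar_False)

lemma Phi_index: "i < nS \<Longrightarrow> j < nS \<Longrightarrow>
    \<Phi> $$ (i, j) = Q $$ (i, j) - \<mu> j - (c i - \<alpha>) * (pmf (P st True) j - pmf (P st False) j)"
  by (simp add: Phi_def P_pibar_def)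

lemma Q_carrier: "Q \<in> carrier_mat nS nS"
  by (simp add: P_pibar_def)

lemma Phi_carrier: "\<Phi> \<in> carrier_mat nS nS"
  by (simp add: Phi_def)

lemma sum_P: "s < nS \<Longrightarrow> (\<Sum>j<nS. pmf (P s a) j) = 1"
  using P_states by (intro sum_pmf_eq_1) auto

lemma Q_nonneg: "i < nS \<Longrightarrow> j < nS \<Longrightarrow> 0 \<le> Q $$ (i, j)"
  using c_bounds[of i] by (simp add: Q_index)

lemma Q_row: "i < nS \<Longrightarrow> (\<Sum>j<nS. Q $$ (i, j)) = 1"
  by (simp add: Q_index sum.distrib sum_distrib_left[symmetric] sum_P)

lemma mu_Q: "j < nS \<Longrightarrow> vmul nS Q \<mu> j = \<mu> j"
proof -
  assume j: "j < nS"
  have "vmul nS Q \<mu> j = (\<Sum>i<nS. y i False * pmf (P i False) j + y i True * pmf (P i True) j)"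
    unfolding vmul_def
    by (intro sum.cong refl) (simp add: Q_index j distrib_left mult.assoc[symmetric] mu_c mu_pibar[of _ False, unfolded pibar_False])
  also have "\<dots> = \<mu> j"
    using feasible j by (simp add: lp_feasible_def UNIV_bool mu_def add.commute)
  finally show ?thesis .
qed

lemma sum_vmul_Q: "(\<Sum>j<nS. vmul nS Q v j) = (\<Sum>i<nS. v i)"
proof -
  have "(\<Sum>j<nS. vmul nS Q v j) = (\<Sum>i<nS. \<Sum>j<nS. v i * Q $$ (i, j))"
    unfolding vmul_def by (rule sum.swap)
  then show ?thesis by (simp add: sum_distrib_left[symmetric] Q_row)
qed

lemma vmul_Q_nonexpansive: "(\<Sum>j<nS. \<bar>vmul nS Q v j\<bar>) \<le> (\<Sum>i<nS. \<bar>v i\<bar>)"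
proof -
  have "(\<Sum>j<nS. \<bar>vmul nS Q v j\<bar>) \<le> (\<Sum>j<nS. vmul nS Q (\<lambda>i. \<bar>v i\<bar>) j)"
    unfolding vmul_def
    by (intro sum_mono order_trans[OF sum_abs]) (simp add: abs_mult Q_nonneg)
  then show ?thesis by (simp add: sum_vmul_Q)
qed

text \<open>The last term is the budget correction of OLC: the \<open>pibar\<close> shares activate
  the \<open>c\<close>-weighted total instead of the fraction \<open>\<alpha>\<close>, and the
  difference is made up in \<open>st\<close>, where each switched arm moves the next-state mean by
  the difference of the two transition rows.\<close>

lemma vmul_Phi:
  assumes "j < nS"
  shows "vmul nS \<Phi> v j = vmul nS Q v j - (\<Sum>i<nS. v i) * \<mu> j
    + (\<alpha> * (\<Sum>i<nS. v i) - (\<Sum>i<nS. c i * v i)) * (pmf (P st True) j - pmf (P st False) j)"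
proof -
  let ?d = "pmf (P st True) j - pmf (P st False) j"
  have "vmul nS \<Phi> v j = (\<Sum>i<nS. v i * Q $$ (i, j) - v i * \<mu> j + (\<alpha> * v i - c i * v i) * ?d)"
    unfolding vmul_def using assms by (intro sum.cong) (auto simp: Phi_index algebra_simps)
  then show ?thesis
    by (simp add: vmul_def sum.distrib sum_subtractf sum_distrib_left sum_distrib_right
        left_diff_distrib)
qed

text \<open>At \<open>\<mu>\<close> the kernel cancels against the projection, and the shares meet
  the budget exactly, so the correction vanishes. Hence centred counts evolve linearly under
  \<open>\<Phi>\<close>.\<close>

lemma mu_Phi: "j < nS \<Longrightarrow> vmul nS \<Phi> \<mu> j = 0"
  by (simp add: vmul_Phi mu_Q sum_mu) (simp add: mult.commute[of "c _"] sum_mu_c)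

text \<open>Deflation of \<open>Q\<close>: subtracting the projection onto the stationary
  distribution replaces the eigenvalue 1 by 0.\<close>

definition \<Psi> :: "real mat" where
  "\<Psi> = mat nS nS (\<lambda>(i, j). Q $$ (i, j) - \<mu> j)"

text \<open>Left multiplication by \<open>\<mu>\<close> annihilates \<open>\<Psi>\<close>, so an
  eigenvector for a nonzero k is orthogonal to \<open>\<mu>\<close> and is an eigenvector of
  \<open>Q\<close> for the same k. Were k equal to 1, it would be independent of the all-ones
  vector, which is not orthogonal to \<open>\<mu>\<close>, against the simplicity of the eigenvalue
  1 of \<open>Q\<close>.\<close>

lemma Psi_eigenvalue:
  assumes "eigenvalue (map_mat complex_of_real \<Psi>) k"
  shows "cmod k < 1"
proof (cases "k = 0")
  case False
  let ?m = "\<lambda>j. complex_of_real (\<mu> j)"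
  define A where "A = map_mat complex_of_real Q"
  have A: "A \<in> carrier_mat nS nS" using Q_carrier by (simp add: A_def)
  obtain w where w: "w \<in> carrier_vec nS" "w \<noteq> 0\<^sub>v nS"
      "map_mat complex_of_real \<Psi> *\<^sub>v w = k \<cdot>\<^sub>v w"
    using assms unfolding eigenvalue_def eigenvector_def by (auto simp: \<Psi>_def)
  have eq: "k * w $ i = (\<Sum>j<nS. complex_of_real (Q $$ (i, j)) * w $ j) - (\<Sum>j<nS. ?m j * w $ j)"
    if i: "i < nS" for i
  proof -
    have "k * w $ i = (map_mat complex_of_real \<Psi> *\<^sub>v w) $ i" using i w by simp
    also have "\<dots> = (\<Sum>j<nS. (complex_of_real (Q $$ (i, j)) - ?m j) * w $ j)"
      using i w(1) by (simp add: \<Psi>_def scalar_prod_def atLeast0LessThan)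
    finally show ?thesis by (simp add: left_diff_distrib sum_subtractf)
  qed
  have "k * (\<Sum>i<nS. ?m i * w $ i) = (\<Sum>i<nS. ?m i * (k * w $ i))"
    by (simp add: sum_distrib_left mult_ac)
  also have "\<dots> = (\<Sum>i<nS. ?m i * (\<Sum>j<nS. complex_of_real (Q $$ (i, j)) * w $ j)
      - ?m i * (\<Sum>j<nS. ?m j * w $ j))"
    by (simp add: eq right_diff_distrib)
  also have "\<dots> = (\<Sum>i<nS. \<Sum>j<nS. ?m i * complex_of_real (Q $$ (i, j)) * w $ j)
      - (\<Sum>i<nS. ?m i) * (\<Sum>j<nS. ?m j * w $ j)"
  proof -
    have "(\<Sum>i<nS. ?m i * B) = (\<Sum>i<nS. ?m i) * B" for B
      by (simp add: sum_distrib_right)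
    then show ?thesis by (simp only: sum_subtractf) (simp only: sum_distrib_left mult.assoc)
  qed
  also have "(\<Sum>i<nS. \<Sum>j<nS. ?m i * complex_of_real (Q $$ (i, j)) * w $ j)
      = (\<Sum>j<nS. \<Sum>i<nS. ?m i * complex_of_real (Q $$ (i, j)) * w $ j)" by (rule sum.swap)
  also have "\<dots> = (\<Sum>j<nS. ?m j * w $ j)"
  proof (rule sum.cong[OF refl])
    fix j assume "j \<in> {..<nS}"
    then have "complex_of_real (vmul nS Q \<mu> j) = ?m j" by (simp add: mu_Q)
    then show "(\<Sum>i<nS. ?m i * complex_of_real (Q $$ (i, j)) * w $ j) = ?m j * w $ j"
      by (simp add: vmul_def sum_distrib_right[symmetric])
  qed
  also have "(\<Sum>i<nS. ?m i) = 1" using sum_mu by (simp flip: of_real_sum)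
  finally have "(\<Sum>i<nS. ?m i * w $ i) = 0" using False by simp
  note mw = this
  have Aw: "A *\<^sub>v w = k \<cdot>\<^sub>v w"
  proof (rule eq_vecI)
    fix i assume "i < dim_vec (k \<cdot>\<^sub>v w)"
    then have i: "i < nS" using w by simp
    show "(A *\<^sub>v w) $ i = (k \<cdot>\<^sub>v w) $ i"
      using i w(1) eq[OF i] mw Q_carrier by (simp add: A_def scalar_prod_def atLeast0LessThan)
  qed (use A w in simp)
  then have "eigenvalue A k" using w A unfolding eigenvalue_def eigenvector_def by auto
  moreover have "k \<noteq> 1"
  proof
    assume k: "k = 1"
    let ?u = "vec nS (\<lambda>_. 1 :: complex)"
    have "Polynomial.order 1 (char_poly A) \<ge> 2"
    proof (rule order_ge_2_if_two_eigenvectors[OF A])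
      show "A *\<^sub>v ?u = 1 \<cdot>\<^sub>v ?u"
      proof (rule eq_vecI)
        fix i assume "i < dim_vec (1 \<cdot>\<^sub>v ?u)"
        then have i: "i < nS" by simp
        have "complex_of_real (\<Sum>j<nS. Q $$ (i, j)) = 1" using i by (simp add: Q_row)
        then show "(A *\<^sub>v ?u) $ i = (1 \<cdot>\<^sub>v ?u) $ i"
          using i Q_carrier by (simp add: A_def scalar_prod_def atLeast0LessThan)
      qed (use A in simp)
      show "A *\<^sub>v w = 1 \<cdot>\<^sub>v w" using Aw k by simp
    next
      fix a b assume ab: "a \<cdot>\<^sub>v ?u + b \<cdot>\<^sub>v w = 0\<^sub>v nS"
      have e: "a + b * w $ i = 0" if "i < nS" for i
        using arg_cong[OF ab, of "\<lambda>x. x $ i"] that w(1) by simp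
      have "0 = (\<Sum>i<nS. ?m i * (a + b * w $ i))" by (simp add: e)
      also have "\<dots> = a * (\<Sum>i<nS. ?m i) + b * (\<Sum>i<nS. ?m i * w $ i)"
        by (simp add: distrib_left sum.distrib sum_distrib_left mult_ac)
      also have "\<dots> = a" using mw sum_mu by (simp flip: of_real_sum)
      finally have a: "a = 0" by simp
      have "b = 0"
      proof (rule ccontr)
        assume "b \<noteq> 0"
        then have "w $ i = 0" if "i < nS" for i using e[OF that] a by simp
        then have "w = 0\<^sub>v nS" using w(1) by (intro eq_vecI) auto
        then show False using w by simp
      qed
      with a show "a = 0 \<and> b = 0" by simp
    qed (use w in auto)
    then show False using A1 by (simp add: assumption1_def Let_def A_def)
  qed
  ultimately show ?thesis using A1 by (simp add: assumption1_def Let_def A_def)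
qed simp

text \<open>\<open>Q\<close> preserves the total of a vector, and on vectors of total 0 the matrices
  \<open>Q\<close> and \<open>\<Psi>\<close> act alike; subtracting a multiple of the fixed vector
  \<open>\<mu>\<close> reduces every v to this case.\<close>

lemma Q_pow_eq:
  assumes "j < nS"
  shows "vmul nS (Q ^\<^sub>m k) v j - (\<Sum>i<nS. v i) * \<mu> j
    = vmul nS (\<Psi> ^\<^sub>m k) (\<lambda>i. v i - (\<Sum>i<nS. v i) * \<mu> i) j"
  using assms
proof (induction k arbitrary: j)
  case 0
  then show ?case
    using vmul_pow_0[OF 0 Q_carrier] vmul_pow_0[OF 0, of \<Psi>] by (simp add: \<Psi>_def del: pow_mat.simps)
next
  case (Suc k)
  let ?s = "\<Sum>i<nS. v i"
  define u where "u = vmul nS (Q ^\<^sub>m k) v"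
  have su: "(\<Sum>i<nS. u i) = ?s"
    unfolding u_def
  proof (induction k)
    case 0
    show ?case by (intro sum.cong refl) (simp add: vmul_pow_0[OF _ Q_carrier] del: pow_mat.simps)
  next
    case (Suc k)
    then show ?case by (simp add: vmul_pow_Suc[OF Q_carrier] sum_vmul_Q del: pow_mat.simps)
  qed
  have \<Psi>: "\<Psi> \<in> carrier_mat nS nS" by (simp add: \<Psi>_def)
  have "vmul nS (\<Psi> ^\<^sub>m Suc k) (\<lambda>i. v i - ?s * \<mu> i) j
      = vmul nS \<Psi> (\<lambda>i. u i - ?s * \<mu> i) j"
    unfolding vmul_pow_Suc[OF \<Psi> Suc.prems] u_def
    by (rule vmul_cong) (simp add: Suc.IH)
  also have "\<dots> = vmul nS Q (\<lambda>i. u i - ?s * \<mu> i) j - (\<Sum>i<nS. u i - ?s * \<mu> i) * \<mu> j"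
    using Suc.prems by (simp add: vmul_def \<Psi>_def right_diff_distrib sum_subtractf sum_distrib_right
        left_diff_distrib)
  also have "(\<Sum>i<nS. u i - ?s * \<mu> i) = 0"
    by (simp add: sum_subtractf sum_distrib_left[symmetric] sum_mu su)
  also have "vmul nS Q (\<lambda>i. u i - ?s * \<mu> i) j = vmul nS Q u j - ?s * \<mu> j"
    using Suc.prems by (simp add: vmul_diff vmul_cmult mu_Q)
  finally show ?case by (simp add: u_def vmul_pow_Suc[OF Q_carrier Suc.prems] del: pow_mat.simps)
qed

lemma Q_mixing:
  obtains C \<theta> where "0 < C" "0 < \<theta>" "\<theta> < 1"
    "\<And>v k. (\<Sum>j<nS. \<bar>vmul nS (Q ^\<^sub>m k) v j - (\<Sum>i<nS. v i) * \<mu> j\<bar>) \<le> C * \<theta> ^ k * (\<Sum>i<nS. \<bar>v i\<bar>)"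
proof -
  have \<Psi>: "\<Psi> \<in> carrier_mat nS nS" by (simp add: \<Psi>_def)
  obtain C \<theta> where decay_consts: "0 < C" "0 < \<theta>" "\<theta> < 1"
    "\<And>k i j. i < nS \<Longrightarrow> j < nS \<Longrightarrow> \<bar>(\<Psi> ^\<^sub>m k) $$ (i, j)\<bar> \<le> C * \<theta> ^ k"
    using mat_pow_exponential_decay[OF \<Psi> Psi_eigenvalue] by blast
  interpret stable_matrix nS \<Psi> C \<theta> by unfold_locales (use \<Psi> decay_consts in auto)
  \<comment> \<open>The factor \<open>real nS\<close> sums the coordinatewise decay, and 2 is the
    cost of centring v.\<close>
  have "(\<Sum>j<nS. \<bar>vmul nS (Q ^\<^sub>m k) v j - (\<Sum>i<nS. v i) * \<mu> j\<bar>)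
      \<le> (real nS * C * 2) * \<theta> ^ k * (\<Sum>i<nS. \<bar>v i\<bar>)" for v k
  proof -
    let ?s = "\<Sum>i<nS. v i"
    have "(\<Sum>i<nS. \<bar>v i - ?s * \<mu> i\<bar>) \<le> (\<Sum>i<nS. \<bar>v i\<bar> + \<bar>?s\<bar> * \<mu> i)"
      by (intro sum_mono order_trans[OF abs_triangle_ineq4]) (simp add: abs_mult mu_nonneg)
    also have "\<dots> = (\<Sum>i<nS. \<bar>v i\<bar>) + \<bar>?s\<bar>"
      by (simp add: sum.distrib sum_distrib_left[symmetric] sum_mu)
    also have "\<dots> \<le> 2 * (\<Sum>i<nS. \<bar>v i\<bar>)" using sum_abs[of v "{..<nS}"] by simp
    finally have 1: "(\<Sum>i<nS. \<bar>v i - ?s * \<mu> i\<bar>) \<le> 2 * (\<Sum>i<nS. \<bar>v i\<bar>)" .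
    have "(\<Sum>j<nS. \<bar>vmul nS (Q ^\<^sub>m k) v j - ?s * \<mu> j\<bar>)
        \<le> (\<Sum>j<nS. C * \<theta> ^ k * (2 * (\<Sum>i<nS. \<bar>v i\<bar>)))"
    proof (rule sum_mono)
      fix j assume "j \<in> {..<nS}"
      then have j: "j < nS" by simp
      show "\<bar>vmul nS (Q ^\<^sub>m k) v j - ?s * \<mu> j\<bar> \<le> C * \<theta> ^ k * (2 * (\<Sum>i<nS. \<bar>v i\<bar>))"
        unfolding Q_pow_eq[OF j]
        by (intro order_trans[OF abs_vmul_pow_le[OF j]] mult_left_mono[OF 1] mult_nonneg_nonneg)
          (simp_all add: less_imp_le decay_consts(1,2))
    qed
    then show ?thesis by (simp add: mult_ac)
  qed
  then show ?thesis using that[of "real nS * C * 2" \<theta>] decay_consts nS by auto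
qed

lemma ex_poisson_solution:
  obtains w where "\<And>i. i < nS \<Longrightarrow> w i = b i + (\<Sum>j<nS. \<Phi> $$ (i, j) * w j)"
proof -
  obtain C \<theta> where decay_consts: "0 < C" "0 < \<theta>" "\<theta> < 1"
    "\<And>k i j. i < nS \<Longrightarrow> j < nS \<Longrightarrow> \<bar>(\<Phi> ^\<^sub>m k) $$ (i, j)\<bar> \<le> C * \<theta> ^ k"
    using mat_pow_exponential_decay[OF Phi_carrier] A3 unfolding assumption3_def by blast
  interpret stable_matrix nS \<Phi> C \<theta> by unfold_locales (use Phi_carrier decay_consts in auto)
  show ?thesis using ex_resolvent that by blast
qed

end

section \<open>Trajectories with small errors\<close>

lemma linear_recursion_bound:
  fixes a :: "nat \<Rightarrow> real"
  assumes "\<And>k. k < J \<Longrightarrow> a (Suc k) \<le> g * a k + d" "0 \<le> g" "g < 1" "0 \<le> d"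
  shows "a J \<le> g ^ J * a 0 + d / (1 - g)"
  using assms(1)
proof (induction J)
  case 0
  then show ?case using assms by simp
next
  case (Suc J)
  have "a (Suc J) \<le> g * a J + d" by (rule Suc.prems) simp
  also have "\<dots> \<le> g * (g ^ J * a 0 + d / (1 - g)) + d"
    using Suc assms by (intro add_mono mult_left_mono) auto
  also have "\<dots> = g ^ Suc J * a 0 + d / (1 - g)"
    using assms by (simp add: field_simps)
  finally show ?case .
qed

section \<open>Masses and empirical counts of sets of arms\<close>

lemma mD_nonneg: "0 \<le> mD N D"
  by (simp add: mD_def)

lemma mD_le_1: "D \<subseteq> {..<N} \<Longrightarrow> mD N D \<le> 1"
  using card_mono[of "{..<N}" D] by (auto simp: mD_def divide_le_eq_1)

lemma mD_mono: "A \<subseteq> B \<Longrightarrow> B \<subseteq> {..<N} \<Longrightarrow> mD N A \<le> mD N B"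
  by (simp add: mD_def divide_right_mono card_mono finite_subset)

lemma mD_Un:
  assumes "A \<subseteq> {..<N}" "B \<subseteq> {..<N}" "A \<inter> B = {}"
  shows "mD N (A \<union> B) = mD N A + mD N B"
proof -
  have "finite A" "finite B" using assms by (auto intro: finite_subset)
  then show ?thesis using assms by (simp add: mD_def card_Un_disjoint add_divide_distrib)
qed

lemma mD_split: "A \<subseteq> {..<N} \<Longrightarrow> mD N A = mD N (A \<inter> B) + mD N (A - B)"
  using mD_Un[of "A \<inter> B" N "A - B"] by (simp add: Int_Diff_disjoint Int_Diff_Un le_infI1 Diff_subset[THEN subset_trans])

lemma mD_all: "N > 0 \<Longrightarrow> mD N {..<N} = 1"
  by (simp add: mD_def)

lemma Xs_nonneg: "0 \<le> Xs N S D s"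
  by (simp add: Xs_def)

lemma Xs_Un:
  assumes "A \<subseteq> {..<N}" "B \<subseteq> {..<N}" "A \<inter> B = {}"
  shows "Xs N S (A \<union> B) s = Xs N S A s + Xs N S B s"
proof -
  have fin: "finite A" "finite B" using assms by (auto intro: finite_subset)
  have "{i \<in> A \<union> B. S i = s} = {i \<in> A. S i = s} \<union> {i \<in> B. S i = s}" by auto
  then have "card {i \<in> A \<union> B. S i = s} = card {i \<in> A. S i = s} + card {i \<in> B. S i = s}"
    using assms fin by (auto intro!: card_Un_disjoint)
  then show ?thesis by (simp add: Xs_def add_divide_distrib)
qed

lemma Xs_split: "A \<subseteq> {..<N} \<Longrightarrow> Xs N S A s = Xs N S (A \<inter> B) s + Xs N S (A - B) s"
  using Xs_Un[of "A \<inter> B" N "A - B" S s] by (simp add: Int_Diff_disjoint Int_Diff_Un le_infI1 Diff_subset[THEN subset_trans])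

lemma sum_Xs:
  assumes D: "D \<subseteq> {..<N}" and S: "\<And>i. i < N \<Longrightarrow> S i < n"
  shows "(\<Sum>s<n. Xs N S D s) = mD N D"
proof -
  have fin: "finite D" using D by (auto intro: finite_subset)
  have "(\<Sum>s<n. card {i \<in> D. S i = s}) = card D"
  proof -
    have "S ` D \<subseteq> {..<n}" using D S by auto
    then have "(\<Sum>s<n. \<Sum>i\<in>{i \<in> D. S i = s}. 1) = (\<Sum>i\<in>D. 1 :: nat)"
      by (intro sum.group fin) auto
    then show ?thesis by simp
  qed
  then have total: "(\<Sum>s<n. real (card {i \<in> D. S i = s})) = real (card D)"
    by (simp only: of_nat_sum[symmetric])
  show ?thesis by (simp only: Xs_def mD_def sum_divide_distrib[symmetric] total)
qed

lemma Xs_le_mD: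
  assumes "D \<subseteq> {..<N}" shows "Xs N S D s \<le> mD N D"
proof -
  have "finite D" using assms finite_subset by blast
  then have "card {i \<in> D. S i = s} \<le> card D" by (intro card_mono) auto
  then show ?thesis by (simp add: Xs_def mD_def divide_right_mono)
qed

lemma sum_abs_Xs_diff_le:
  assumes A: "A \<subseteq> {..<N}" and B: "B \<subseteq> {..<N}" and S: "\<And>i. i < N \<Longrightarrow> S i < n"
  shows "(\<Sum>s<n. \<bar>Xs N S A s - Xs N S B s\<bar>) \<le> mD N (A - B) + mD N (B - A)"
proof -
  have "Xs N S A s - Xs N S B s = Xs N S (A - B) s - Xs N S (B - A) s" for s
    using Xs_split[OF A, of S s B] Xs_split[OF B, of S s A] by (simp add: Int_commute)
  then have "(\<Sum>s<n. \<bar>Xs N S A s - Xs N S B s\<bar>) \<le> (\<Sum>s<n. Xs N S (A - B) s + Xs N S (B - A) s)"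
    by (intro sum_mono) (simp add: Xs_nonneg abs_le_iff add_increasing add_increasing2)
  also have "\<dots> = mD N (A - B) + mD N (B - A)"
    using A B S by (simp add: sum.distrib sum_Xs Diff_subset[THEN subset_trans])
  finally show ?thesis .
qed

text \<open>What is kept of the weighted norm, besides its invariance under negation.
  \<open>L\<close> and \<open>\<gamma>\<close> come from the model alone, so every constant built
  from them and \<open>\<eta>\<close> is independent of the number of arms.\<close>

locale lyapunov_bandit = restless_bandit +
  fixes L \<gamma> \<eta> :: real
  assumes L: "0 < L" and gamma: "0 \<le> \<gamma>" "\<gamma> < 1" and eta: "0 < \<eta>"
    and norm_nonneg: "\<And>v. 0 \<le> normU nS P \<alpha> y st v"
    and norm_le: "\<And>v. normU nS P \<alpha> y st v \<le> L * (\<Sum>i<nS. \<bar>v i\<bar>)"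
    and norm_contraction: "\<And>v. normU nS P \<alpha> y st (vmul nS \<Phi> v) \<le> \<gamma> * normU nS P \<alpha> y st v"
    and norm_triangle: "\<And>v w. normU nS P \<alpha> y st (\<lambda>i. v i + w i) \<le> normU nS P \<alpha> y st v + normU nS P \<alpha> y st w"
    and norm_cong: "\<And>v w. (\<And>i. i < nS \<Longrightarrow> v i = w i) \<Longrightarrow> normU nS P \<alpha> y st v = normU nS P \<alpha> y st w"

lemma (in restless_bandit) ex_lyapunov_bandit:
  assumes eta: "0 < \<eta>"
  shows "\<exists>L \<gamma>. lyapunov_bandit nS P r \<alpha> y st L \<gamma> \<eta>"
proof -
  obtain C \<theta> where decay_consts: "0 < C" "0 < \<theta>" "\<theta> < 1"
    "\<And>k i j. i < nS \<Longrightarrow> j < nS \<Longrightarrow> \<bar>(\<Phi> ^\<^sub>m k) $$ (i, j)\<bar> \<le> C * \<theta> ^ k"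
    using mat_pow_exponential_decay[OF Phi_carrier] A3 unfolding assumption3_def by blast
  interpret stable_matrix nS \<Phi> C \<theta> by unfold_locales (use Phi_carrier decay_consts in auto)
  have U: "normU nS P \<alpha> y st = lyap"
    by (rule ext) (simp only: normU_def Umat_def lyap_eq_quadratic_form)
  have "lyapunov_bandit nS P r \<alpha> y st lyap_const lyap_rate \<eta>"
  proof (unfold_locales, unfold U)
    fix v w :: "nat \<Rightarrow> real"
    assume "\<And>i. i < nS \<Longrightarrow> v i = w i"
    then show "lyap v = lyap w" by (rule lyap_cong)
  qed (use eta in \<open>simp_all add: lyap_const_pos lyap_rate lyap_nonneg lyap_le lyap_contraction lyap_triangle\<close>)
  then show ?thesis by blast
qed

context lyapunov_bandit
begin

definition dev :: "nat \<Rightarrow> (nat \<Rightarrow> nat) \<Rightarrow> nat set \<Rightarrow> real" where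
  "dev N S D = normU nS P \<alpha> y st (\<lambda>s. Xs N S D s - mD N D * \<mu> s)"

lemma slack_eq: "slack nS P \<alpha> y st \<eta> efe N S D = \<eta> * mD N D - dev N S D - efe"
  by (simp add: slack_def dev_def)

text \<open>The chain state carries the sets chosen one step earlier, so the sets stored in x' are
  those selected for the arm states in x. Each comparison thus follows a fixed set of arms across
  one transition. Randomness is confined to whether a step is good; what is derived from good steps
  is deterministic.\<close>

definition good_step :: "nat \<Rightarrow> real \<Rightarrow> real \<Rightarrow> real \<Rightarrow> cstate \<Rightarrow> cstate \<Rightarrow> bool" where
  "good_step N e efe erd x x' \<longleftrightarrow>
    (\<forall>i<N. fst x i < nS) \<and> (\<forall>i<N. fst x' i < nS) \<and>
    sel_valid nS P \<alpha> y st \<eta> efe erd N (fst x) (fst (snd x)) (snd (snd x)) (fst (snd x')) (snd (snd x')) \<and>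
    (\<forall>j<nS. \<bar>Xs N (fst x') (fst (snd x')) j - mD N (fst (snd x')) * \<mu> j
       - vmul nS \<Phi> (Xs N (fst x) (fst (snd x'))) j\<bar> \<le> e) \<and>
    (\<forall>j<nS. \<bar>Xs N (fst x') (snd (snd x')) j - vmul nS Q (Xs N (fst x) (snd (snd x'))) j\<bar> \<le> e)"

text \<open>Minimum over the support only, since transient states of \<open>Q\<close> have
  stationary mass 0.\<close>

definition mu_min :: real where
  "mu_min = Min (\<mu> ` {s. s < nS \<and> 0 < \<mu> s})"

lemma mu_support: "{s. s < nS \<and> 0 < \<mu> s} \<noteq> {}"
proof
  assume "{s. s < nS \<and> 0 < \<mu> s} = {}"
  then have "\<mu> s = 0" if "s < nS" for s using that mu_nonneg[of s] by fastforce
  then show False using sum_mu by simp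
qed

lemma mu_min: "0 < mu_min" "mu_min \<le> 1" "\<And>s. s < nS \<Longrightarrow> 0 < \<mu> s \<Longrightarrow> mu_min \<le> \<mu> s"
proof -
  have fin: "finite (\<mu> ` {s. s < nS \<and> 0 < \<mu> s})" by simp
  show "0 < mu_min" unfolding mu_min_def using mu_support by (subst Min_gr_iff) auto
  show le: "mu_min \<le> \<mu> s" if "s < nS" "0 < \<mu> s" for s
    unfolding mu_min_def using that by (intro Min_le) auto
  obtain s where "s < nS" "0 < \<mu> s" using mu_support by auto
  then show "mu_min \<le> 1" using le[of s] mu_le_1[of s] by simp
qed

definition beta :: real where "beta = min \<alpha> (1 - \<alpha>)"

lemma beta: "0 < beta" "beta < 1"
  using alpha by (auto simp: beta_def)

text \<open>Break-even mass in units of e. A feasible set of mass m gains slack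
  \<open>(1 - \<gamma>) * \<eta> * m\<close> by contraction; the loss is at most
  \<open>(L * real nS + 1) * e\<close>, for the noise in the norm and for
  \<open>efe\<close>.\<close>

definition M0 :: real where "M0 = (L * real nS + 1) / ((1 - \<gamma>) * \<eta>)"

lemma M0_pos: "0 < M0"
  using L gamma eta by (simp add: M0_def add_nonneg_pos)

text \<open>Size, in units of e, of the patch added in \<open>maximal_absorbs\<close>. The term
  \<open>real nS\<close> pays for rounding the patch to whole arms, the quotient by
  \<open>\<eta>\<close> for its deviation together with \<open>efe\<close> and \<open>erd\<close>,
  and 2 puts its mass above \<open>erd\<close>.\<close>

definition Rc :: real where "Rc = real nS + 2 + (2 * L * real nS + 2) / \<eta>"

lemma Rc_pos: "0 < Rc"
  using L eta by (simp add: Rc_def add_pos_nonneg)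

lemma dev_nonneg: "0 \<le> dev N S D"
  by (simp add: dev_def norm_nonneg)

lemma dev_le_mass:
  assumes D: "D \<subseteq> {..<N}" and S: "\<And>i. i < N \<Longrightarrow> S i < nS"
  shows "dev N S D \<le> 2 * L * mD N D"
proof -
  have "(\<Sum>s<nS. \<bar>Xs N S D s - mD N D * \<mu> s\<bar>) \<le> (\<Sum>s<nS. Xs N S D s + mD N D * \<mu> s)"
    by (intro sum_mono order_trans[OF abs_triangle_ineq4])
      (simp add: abs_mult Xs_nonneg mD_nonneg mu_nonneg)
  also have "\<dots> = 2 * mD N D"
    by (simp add: sum.distrib sum_Xs[OF D S] sum_distrib_left[symmetric] sum_mu)
  finally have "L * (\<Sum>s<nS. \<bar>Xs N S D s - mD N D * \<mu> s\<bar>) \<le> L * (2 * mD N D)"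
    using L by (intro mult_left_mono) auto
  then show ?thesis using norm_le[of "\<lambda>s. Xs N S D s - mD N D * \<mu> s"] by (simp add: dev_def)
qed

lemma dev_Un:
  assumes "A \<subseteq> {..<N}" "B \<subseteq> {..<N}" "A \<inter> B = {}"
  shows "dev N S (A \<union> B) \<le> dev N S A + dev N S B"
proof -
  have "dev N S (A \<union> B) = normU nS P \<alpha> y st (\<lambda>s. (Xs N S A s - mD N A * \<mu> s) + (Xs N S B s - mD N B * \<mu> s))"
    unfolding dev_def by (rule norm_cong) (simp add: Xs_Un[OF assms] mD_Un[OF assms] algebra_simps)
  also have "\<dots> \<le> dev N S A + dev N S B"
    unfolding dev_def by (rule norm_triangle)
  finally show ?thesis .
qed

lemma sel_valid_subsets:
  assumes "sel_valid nS P \<alpha> y st \<eta> efe erd N S Dop Dpp D E"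
  shows "D \<subseteq> {..<N}" "E \<subseteq> {..<N}" "E \<inter> D = {}" "Dpp - D \<subseteq> E"
  using assms unfolding sel_valid_def eps_max_feasible_def by (auto split: if_splits)

section \<open>Deterministic consequences of good steps\<close>

context
  fixes N :: nat and e efe erd :: real
  \<comment> \<open>One tolerance dominates every quantity of order 1/N: the rounding of set sizes
    and both parameters of the policy.\<close>
  assumes N: "0 < N" and e: "1 / real N \<le> e"
    and efe: "0 \<le> efe" "efe \<le> e" and erd: "0 \<le> erd" "erd \<le> e"
begin

lemma e_pos: "0 < e"
  using N e by (meson less_le_trans of_nat_0_less_iff zero_less_divide_1_iff)

lemma sel_valid_dev:
  assumes S: "\<And>i. i < N \<Longrightarrow> S i < nS"
    and sel: "sel_valid nS P \<alpha> y st \<eta> efe erd N S Dop Dpp D E"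
  shows "dev N S D \<le> \<eta> * mD N D"
proof -
  have "D = {} \<or> slack nS P \<alpha> y st \<eta> efe N S D \<ge> 0"
    using sel unfolding sel_valid_def eps_max_feasible_def by (auto split: if_splits)
  then show ?thesis
  proof
    assume "D = {}"
    then show ?thesis using dev_le_mass[of "{}" N S] S by (simp add: mD_def)
  qed (use efe in \<open>simp add: slack_eq\<close>)
qed

lemma sel_valid_card:
  assumes sel: "sel_valid nS P \<alpha> y st \<eta> efe erd N S Dop Dpp D E"
  shows "mD N E \<le> beta * (1 - mD N D)" "beta * (1 - mD N D) - e \<le> mD N E"
proof -
  let ?b = "beta * (real N - real (card D))"
  have D: "D \<subseteq> {..<N}" using sel_valid_subsets[OF sel] by simp
  have "card D \<le> N" using card_mono[OF _ D] by simp
  then have b: "0 \<le> ?b" using beta by simp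
  have cE: "card E = nat \<lfloor>?b\<rfloor>" using sel by (simp add: sel_valid_def beta_def)
  have "real (card E) \<le> ?b" "?b - 1 \<le> real (card E)" using b unfolding cE by linarith+
  then have "real (card E) / real N \<le> ?b / real N" "(?b - 1) / real N \<le> real (card E) / real N"
    using N by (auto intro: divide_right_mono)
  moreover have "?b / real N = beta * (1 - mD N D)" using N by (simp add: mD_def field_simps)
  ultimately show "mD N E \<le> beta * (1 - mD N D)" "beta * (1 - mD N D) - e \<le> mD N E"
    using e by (auto simp: mD_def diff_divide_distrib)
qed

text \<open>By \<open>mu_Phi\<close> the affine prediction is linear in the centred counts, so
  contraction applies to it, and the coordinate errors enter through \<open>norm_le\<close>.\<close>

lemma good_step_dev:
  assumes "good_step N e efe erd x (S', D, E)"
  shows "dev N S' D \<le> \<gamma> * dev N (fst x) D + L * real nS * e"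
proof -
  let ?X = "Xs N (fst x) D" and ?X' = "Xs N S' D"
  let ?u = "\<lambda>s. vmul nS \<Phi> (\<lambda>s. ?X s - mD N D * \<mu> s) s"
  let ?err = "\<lambda>s. ?X' s - mD N D * \<mu> s - vmul nS \<Phi> ?X s"
  have err: "\<bar>?err s\<bar> \<le> e" if "s < nS" for s
    using assms that by (simp add: good_step_def)
  have "dev N S' D = normU nS P \<alpha> y st (\<lambda>s. ?u s + ?err s)"
    unfolding dev_def by (rule norm_cong) (simp add: vmul_diff vmul_cmult mu_Phi)
  also have "\<dots> \<le> normU nS P \<alpha> y st ?u + normU nS P \<alpha> y st ?err" by (rule norm_triangle)
  also have "normU nS P \<alpha> y st ?u \<le> \<gamma> * dev N (fst x) D"
    unfolding dev_def by (rule norm_contraction)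
  also have "normU nS P \<alpha> y st ?err \<le> L * (\<Sum>s<nS. \<bar>?err s\<bar>)" by (rule norm_le)
  also have "\<dots> \<le> L * (\<Sum>s<nS. e)"
    using L err by (intro mult_left_mono sum_mono) auto
  finally show ?thesis by (simp add: mult.assoc)
qed

text \<open>Above the break-even mass contraction outweighs the error, so D is still feasible in the
  new state; the selection rule then keeps it or takes all arms.\<close>

lemma good_step_monotone:
  assumes step: "good_step N e efe erd x (S', D, E)"
    and sel: "sel_valid nS P \<alpha> y st \<eta> efe erd N S' D E D' E'"
    and m: "M0 * e \<le> mD N D"
  shows "D \<subseteq> D'"
proof -
  have S: "\<And>i. i < N \<Longrightarrow> fst x i < nS"
    and sel0: "sel_valid nS P \<alpha> y st \<eta> efe erd N (fst x) (fst (snd x)) (snd (snd x)) D E"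
    using step by (auto simp: good_step_def)
  have "(L * real nS + 1) * e = (1 - \<gamma>) * \<eta> * (M0 * e)"
    using gamma eta by (simp add: M0_def)
  also have "\<dots> \<le> (1 - \<gamma>) * \<eta> * mD N D"
    using m gamma eta by (intro mult_left_mono) auto
  finally have 1: "(L * real nS + 1) * e \<le> (1 - \<gamma>) * \<eta> * mD N D" .
  have "dev N S' D \<le> \<gamma> * (\<eta> * mD N D) + L * real nS * e"
    using good_step_dev[OF step] mult_left_mono[OF sel_valid_dev[OF S sel0] gamma(1)] by linarith
  then have "0 \<le> slack nS P \<alpha> y st \<eta> efe N S' D"
    using 1 efe by (simp add: slack_eq algebra_simps)
  then show ?thesis
    using sel sel_valid_subsets(1)[OF sel0] by (auto simp: sel_valid_def split: if_splits)
qed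

text \<open>If D is heavy it is retained, and the absorbed arms of E are disjoint from it, so the
  masses add. If D is light, its whole mass is within the granted loss
  \<open>M0 * e\<close>.\<close>

lemma good_step_mass:
  assumes step: "good_step N e efe erd x (S', D, E)"
    and sel: "sel_valid nS P \<alpha> y st \<eta> efe erd N S' D E D' E'"
  shows "mD N D + mD N (E \<inter> D') - M0 * e \<le> mD N D'"
proof -
  have sub: "D \<subseteq> {..<N}" "E \<subseteq> {..<N}" "E \<inter> D = {}"
    using step sel_valid_subsets[of efe erd N "fst x" "fst (snd x)" "snd (snd x)" D E] by (auto simp: good_step_def)
  have D': "D' \<subseteq> {..<N}" using sel_valid_subsets[OF sel] by simp
  have pos: "0 \<le> M0 * e" using M0_pos e_pos by simp
  show ?thesis
  proof (cases "M0 * e \<le> mD N D")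
    case True
    then have "D \<subseteq> D'" by (rule good_step_monotone[OF step sel])
    then have "mD N (D \<union> (E \<inter> D')) \<le> mD N D'" using D' by (intro mD_mono) auto
    moreover have "mD N (D \<union> (E \<inter> D')) = mD N D + mD N (E \<inter> D')" using sub by (intro mD_Un) auto
    ultimately show ?thesis using pos by linarith
  next
    case False
    have "mD N (E \<inter> D') \<le> mD N D'" using D' by (intro mD_mono) auto
    then show ?thesis using False by linarith
  qed
qed

text \<open>If the uncovered part of E held at least a fraction \<open>\<rho> * \<mu> s\<close> in
  every state of the support, a patch composed almost like \<open>\<mu>\<close> could be cut from
  it. Its deviation is small against \<open>\<eta>\<close> times its mass, so adding it would keep D
  feasible and contradict maximality. Hence some state of the support is nearly exhausted, and D
  holds almost all arms of E in that state, a mass of about \<open>a * \<mu> s\<close>.\<close>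

lemma maximal_absorbs:
  assumes S: "\<And>i. i < N \<Longrightarrow> S i < nS"
    and sel: "sel_valid nS P \<alpha> y st \<eta> efe erd N S Dop Dpp D E'"
    and E: "E \<subseteq> {..<N}" and a: "0 \<le> a"
    and near: "\<And>j. j < nS \<Longrightarrow> \<bar>Xs N S E j - a * \<mu> j\<bar> \<le> \<kappa>"
  shows "mu_min * a - \<kappa> - Rc * e \<le> mD N (E \<inter> D)"
proof -
  define \<rho> where "\<rho> = Rc * e"
  have rho: "0 < \<rho>" using Rc_pos e_pos by (simp add: \<rho>_def)
  have D: "D \<subseteq> {..<N}" using sel_valid_subsets[OF sel] by simp
  define R where "R = E - D"
  have R: "R \<subseteq> {..<N}" "R \<inter> D = {}" using E by (auto simp: R_def)
  have "\<exists>s<nS. 0 < \<mu> s \<and> Xs N S R s \<le> \<rho> * \<mu> s"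
  proof (rule ccontr)
    assume "\<not> ?thesis"
    then have big: "\<rho> * \<mu> s \<le> Xs N S R s" if "s < nS" for s
      using that mu_nonneg[of s] Xs_nonneg[of N S R s] by (cases "\<mu> s = 0") force+
    \<comment> \<open>Rounding down to whole arms costs at most one arm per state, hence at most e
      in each coordinate.\<close>
    define k where "k s = nat \<lfloor>real N * \<rho> * \<mu> s\<rfloor>" for s
    have k: "real (k s) \<le> real N * (\<rho> * \<mu> s)" "real N * (\<rho> * \<mu> s) - 1 \<le> real (k s)" if "s < nS" for s
    proof -
      have "0 \<le> real N * \<rho> * \<mu> s" using rho mu_nonneg[OF that] by simp
      then show "real (k s) \<le> real N * (\<rho> * \<mu> s)" "real N * (\<rho> * \<mu> s) - 1 \<le> real (k s)"
        unfolding k_def mult.assoc[symmetric] by linarith+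
    qed
    have "\<exists>Z. Z \<subseteq> {i \<in> R. S i = s} \<and> card Z = k s" if s: "s < nS" for s
    proof -
      have "real (k s) \<le> real N * Xs N S R s"
        using k(1)[OF s] mult_left_mono[OF big[OF s], of "real N"] by simp
      then have "k s \<le> card {i \<in> R. S i = s}" using N by (simp add: Xs_def)
      then show ?thesis by (meson obtain_subset_with_card_n)
    qed
    then obtain Zs where Zs: "\<And>s. s < nS \<Longrightarrow> Zs s \<subseteq> {i \<in> R. S i = s} \<and> card (Zs s) = k s" by metis
    define Z where "Z = (\<Union>s<nS. Zs s)"
    have Z: "Z \<subseteq> R" using Zs by (auto simp: Z_def)
    then have ZN: "Z \<subseteq> {..<N}" and ZD: "D \<inter> Z = {}" using R by auto
    have XZ: "Xs N S Z s = real (k s) / real N" if s: "s < nS" for s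
    proof -
      have "{i \<in> Z. S i = s} = Zs s" using Zs s by (auto simp: Z_def)
      then show ?thesis using Zs[OF s] by (simp add: Xs_def)
    qed
    have XZe: "\<bar>Xs N S Z s - \<rho> * \<mu> s\<bar> \<le> e" if s: "s < nS" for s
    proof -
      have "\<bar>real (k s) - real N * (\<rho> * \<mu> s)\<bar> \<le> 1" using k[OF s] by linarith
      then have "\<bar>real (k s) - real N * (\<rho> * \<mu> s)\<bar> / real N \<le> 1 / real N"
        using N by (intro divide_right_mono) auto
      also have "\<bar>real (k s) - real N * (\<rho> * \<mu> s)\<bar> / real N = \<bar>Xs N S Z s - \<rho> * \<mu> s\<bar>"
      proof -
        have "(real (k s) - real N * (\<rho> * \<mu> s)) / real N = Xs N S Z s - \<rho> * \<mu> s"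
          unfolding XZ[OF s] using N by (simp add: diff_divide_distrib)
        then show ?thesis by (metis abs_divide abs_of_nat)
      qed
      finally show ?thesis using e by linarith
    qed
    have mZ: "\<bar>mD N Z - \<rho>\<bar> \<le> real nS * e"
    proof -
      have "mD N Z - \<rho> = (\<Sum>s<nS. Xs N S Z s - \<rho> * \<mu> s)"
        by (simp add: sum_subtractf sum_Xs[OF ZN S] sum_distrib_left[symmetric] sum_mu)
      also have "\<bar>\<dots>\<bar> \<le> (\<Sum>s<nS. e)"
        by (intro order_trans[OF sum_abs] sum_mono XZe) auto
      finally show ?thesis by simp
    qed
    have "dev N S Z \<le> L * (\<Sum>s<nS. \<bar>Xs N S Z s - mD N Z * \<mu> s\<bar>)"
      unfolding dev_def by (rule norm_le)
    also have "\<dots> \<le> L * (\<Sum>s<nS. e + (real nS * e) * \<mu> s)"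
    proof (intro mult_left_mono sum_mono)
      fix s assume "s \<in> {..<nS}"
      then have s: "s < nS" by simp
      have "\<bar>(mD N Z - \<rho>) * \<mu> s\<bar> \<le> (real nS * e) * \<mu> s"
        unfolding abs_mult using mZ mu_nonneg[OF s] by (simp add: mult_right_mono)
      moreover have "Xs N S Z s - mD N Z * \<mu> s = (Xs N S Z s - \<rho> * \<mu> s) - (mD N Z - \<rho>) * \<mu> s"
        by (simp add: algebra_simps)
      ultimately show "\<bar>Xs N S Z s - mD N Z * \<mu> s\<bar> \<le> e + (real nS * e) * \<mu> s"
        using XZe[OF s] by linarith
    qed (use L in simp)
    also have "\<dots> = 2 * L * real nS * e"
      by (simp add: sum.distrib sum_distrib_left[symmetric] sum_mu)
    finally have devZ: "dev N S Z \<le> 2 * L * real nS * e" .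
    have mZ2: "2 * e + (2 * L * real nS + 2) * e / \<eta> \<le> mD N Z"
      using mZ by (simp add: \<rho>_def Rc_def algebra_simps abs_le_iff)
    have "0 \<le> (2 * L * real nS + 2) * e / \<eta>" using L e_pos eta by simp
    then have mZ3: "e < mD N Z" using mZ2 e_pos by linarith
    \<comment> \<open>Were D all arms, nothing would be left for Z. This rules out the branch of the
      selection that says nothing about maximality.\<close>
    then have "Z \<noteq> {}" using e_pos by (auto simp: mD_def)
    then have "D \<noteq> {..<N}" using ZD ZN by blast
    then have max: "eps_max_feasible nS P \<alpha> y st \<eta> efe erd N S D"
      using sel by (auto simp: sel_valid_def split: if_splits)
    have "\<eta> * (2 * e + (2 * L * real nS + 2) * e / \<eta>) \<le> \<eta> * mD N Z"
      using mZ2 eta by (intro mult_left_mono) auto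
    moreover have "\<eta> * (2 * e + (2 * L * real nS + 2) * e / \<eta>) = 2 * e * \<eta> + (2 * L * real nS + 2) * e"
      using eta unfolding distrib_left times_divide_eq_right by simp
    ultimately have "2 * e * \<eta> + (2 * L * real nS + 2) * e \<le> \<eta> * mD N Z" by linarith
    moreover have "0 \<le> 2 * e * \<eta>" using e_pos eta by simp
    moreover have "dev N S (D \<union> Z) \<le> dev N S D + dev N S Z" by (rule dev_Un[OF D ZN ZD])
    moreover have "dev N S D \<le> \<eta> * mD N D" by (rule sel_valid_dev[OF S sel])
    moreover have mDZ: "mD N (D \<union> Z) = mD N D + mD N Z" by (rule mD_Un[OF D ZN ZD])
    ultimately have "slack nS P \<alpha> y st \<eta> efe N S (D \<union> Z) \<ge> erd"
      using devZ efe erd by (simp add: slack_eq algebra_simps)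
    then have "mD N (D \<union> Z) \<le> mD N D + erd"
      using max D ZN unfolding eps_max_feasible_def by (meson Un_least sup_ge1)
    then show False using mDZ mZ3 erd by simp
  qed
  then obtain s where s: "s < nS" "0 < \<mu> s" "Xs N S R s \<le> \<rho> * \<mu> s" by blast
  have "\<rho> * \<mu> s \<le> \<rho>" using rho mu_le_1[OF s(1)] by simp
  moreover have "mu_min * a \<le> a * \<mu> s" using mu_min(3)[OF s(1,2)] a by (simp add: mult.commute mult_left_mono)
  moreover have "a * \<mu> s - \<kappa> \<le> Xs N S E s" using near[OF s(1)] by (simp add: abs_le_iff)
  moreover have "Xs N S E s = Xs N S (E \<inter> D) s + Xs N S R s" unfolding R_def by (rule Xs_split[OF E])
  moreover have "Xs N S (E \<inter> D) s \<le> mD N (E \<inter> D)" using E by (intro Xs_le_mD) auto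
  ultimately show ?thesis using s(3) by (simp add: \<rho>_def)
qed

text \<open>Selection keeps E minus D', so arms leave the UOC set only by being absorbed. The arms
  that enter are controlled by the size rule: the size grows by at most \<open>beta\<close> times
  the mass lost by the OLC set, plus one rounding. Leaving and entering each contribute the absorbed
  mass, hence the factor 2.\<close>

lemma uoc_set_drift:
  assumes step: "good_step N e efe erd x (S', D, E)"
    and sel: "sel_valid nS P \<alpha> y st \<eta> efe erd N S' D E D' E'"
  shows "(\<Sum>j<nS. \<bar>Xs N S' E' j - Xs N S' E j\<bar>) \<le> 2 * mD N (E \<inter> D') + (M0 + 1) * e"
proof -
  have S': "\<And>i. i < N \<Longrightarrow> S' i < nS"
    and sel0: "sel_valid nS P \<alpha> y st \<eta> efe erd N (fst x) (fst (snd x)) (snd (snd x)) D E"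
    using step by (auto simp: good_step_def)
  have sub: "E \<subseteq> {..<N}" "E' \<subseteq> {..<N}" "E - D' \<subseteq> E'"
    using sel_valid_subsets[OF sel] sel_valid_subsets[OF sel0] by auto
  have "mD N (E - E') \<le> mD N (E \<inter> D')" using sub by (intro mD_mono) auto
  moreover have "mD N E' = mD N (E' \<inter> E) + mD N (E' - E)" "mD N E = mD N (E \<inter> E') + mD N (E - E')"
    using sub by (auto intro: mD_split)
  moreover have "mD N E' - mD N E \<le> beta * (mD N D - mD N D') + e"
    using sel_valid_card[OF sel] sel_valid_card[OF sel0] by (simp add: algebra_simps)
  moreover have "beta * (mD N D - mD N D') \<le> M0 * e"
  proof -
    have "mD N D - mD N D' \<le> M0 * e"
      using good_step_mass[OF step sel] mD_nonneg[of N "E \<inter> D'"] by linarith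
    then have "beta * (mD N D - mD N D') \<le> beta * (M0 * e)" using beta by (intro mult_left_mono) auto
    also have "\<dots> \<le> 1 * (M0 * e)" using beta M0_pos e_pos by (intro mult_right_mono) auto
    finally show ?thesis by simp
  qed
  moreover have "(\<Sum>j<nS. \<bar>Xs N S' E' j - Xs N S' E j\<bar>) \<le> mD N (E' - E) + mD N (E - E')"
    by (rule sum_abs_Xs_diff_le[OF sub(2,1)]) (rule S')
  ultimately show ?thesis by (simp add: Int_commute algebra_simps)
qed

text \<open>Passing between all arms and D costs at most \<open>2 * L\<close> times the uncovered
  mass. It is done once in the old state and once in the new one, which gives the factor 4.\<close>

lemma total_dev_step:
  assumes step: "good_step N e efe erd x (S', D, E)"
  shows "dev N S' {..<N} \<le> \<gamma> * dev N (fst x) {..<N} + L * real nS * e + 4 * L * (1 - mD N D)"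
proof -
  have S: "\<And>i. i < N \<Longrightarrow> fst x i < nS" and S': "\<And>i. i < N \<Longrightarrow> S' i < nS"
    and sel: "sel_valid nS P \<alpha> y st \<eta> efe erd N (fst x) (fst (snd x)) (snd (snd x)) D E"
    using step by (auto simp: good_step_def)
  have D: "D \<subseteq> {..<N}" using sel_valid_subsets[OF sel] by simp
  let ?R = "{..<N} - D"
  have R: "?R \<subseteq> {..<N}" "D \<inter> ?R = {}" "D \<union> ?R = {..<N}" using D by auto
  have mR: "mD N ?R = 1 - mD N D" using mD_Un[OF D R(1,2)] R(3) mD_all[OF N] by simp
  have "dev N S' {..<N} \<le> dev N S' D + dev N S' ?R" using dev_Un[OF D R(1,2), of S'] R(3) by simp
  moreover have "dev N S' ?R \<le> 2 * L * (1 - mD N D)" using dev_le_mass[OF R(1), of S'] S' mR by simp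
  moreover have "dev N S' D \<le> \<gamma> * dev N (fst x) D + L * real nS * e" by (rule good_step_dev[OF step])
  moreover have "\<gamma> * dev N (fst x) D \<le> \<gamma> * (dev N (fst x) {..<N} + 2 * L * (1 - mD N D))"
  proof (rule mult_left_mono[OF _ gamma(1)])
    let ?S = "fst x"
    have X: "Xs N ?S {..<N} s = Xs N ?S D s + Xs N ?S ?R s" for s
      using Xs_Un[OF D R(1,2), of ?S s] unfolding R(3) .
    have "dev N ?S D = normU nS P \<alpha> y st (\<lambda>s. (Xs N ?S {..<N} s - mD N {..<N} * \<mu> s)
        + - (Xs N ?S ?R s - mD N ?R * \<mu> s))"
      unfolding dev_def by (intro norm_cong) (simp add: X mR mD_all[OF N] algebra_simps)
    also have "\<dots> \<le> dev N ?S {..<N} + normU nS P \<alpha> y st (\<lambda>s. - (Xs N ?S ?R s - mD N ?R * \<mu> s))"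
      unfolding dev_def by (rule norm_triangle)
    also have "normU nS P \<alpha> y st (\<lambda>s. - (Xs N ?S ?R s - mD N ?R * \<mu> s)) = dev N ?S ?R"
      by (simp add: dev_def normU_def algebra_simps)
    also have "dev N ?S ?R \<le> 2 * L * (1 - mD N D)" using dev_le_mass[OF R(1), of ?S] S mR by simp
    finally show "dev N ?S D \<le> dev N ?S {..<N} + 2 * L * (1 - mD N D)" by simp
  qed
  moreover have "\<gamma> * (2 * L * (1 - mD N D)) \<le> 1 * (2 * L * (1 - mD N D))"
    using gamma L mD_le_1[OF D] by (intro mult_right_mono) auto
  ultimately show ?thesis by (simp add: algebra_simps)
qed

text \<open>The mass absorbed by the OLC set over a window of \<open>K\<close> steps: either the UOC set is
  hardly touched, so that it mixes and the next maximal set must swallow a fixed fraction of it,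
  or a comparable amount has been swallowed already.\<close>

lemma window_growth:
  assumes mix: "\<And>v. (\<Sum>j<nS. \<bar>vmul nS (Q ^\<^sub>m Suc k) v j - (\<Sum>i<nS. v i) * \<mu> j\<bar>) \<le> \<delta> * (\<Sum>i<nS. \<bar>v i\<bar>)"
    and d: "0 \<le> \<delta>"
    and steps: "\<And>i. i \<le> Suc k \<Longrightarrow> good_step N e efe erd (x i) (x (Suc i))"
  shows "1 - mD N (fst (snd (x (Suc (Suc k)))))
    \<le> (1 - mu_min * beta / 3) * (1 - mD N (fst (snd (x 1)))) + \<delta> + real (Suc k) * (real nS + 2 + 2 * M0 + Rc) * e"
proof -
  define S D E where "S i = fst (x i)" and "D i = fst (snd (x (Suc i)))" and "E i = snd (snd (x (Suc i)))" for i
  define q where "q i = mD N (E i \<inter> D (Suc i))" for i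
  have x_Suc: "x (Suc i) = (S (Suc i), D i, E i)" for i by (simp add: S_def D_def E_def)
  have step: "good_step N e efe erd (x i) (S (Suc i), D i, E i)" if "i \<le> Suc k" for i
    using steps[OF that] by (simp add: x_Suc)
  have S: "i \<le> Suc k \<Longrightarrow> l < N \<Longrightarrow> S i l < nS" for i l
    using steps by (simp add: good_step_def S_def)
  have sel: "sel_valid nS P \<alpha> y st \<eta> efe erd N (S (Suc i)) (D i) (E i) (D (Suc i)) (E (Suc i))"
    if "Suc i \<le> Suc k" for i
    using steps[OF that] by (simp add: good_step_def S_def D_def E_def)
  have sel0: "sel_valid nS P \<alpha> y st \<eta> efe erd N (S 0) (fst (snd (x 0))) (snd (snd (x 0))) (D 0) (E 0)"
    using steps[of 0] by (simp add: good_step_def S_def D_def E_def)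
  have E: "E i \<subseteq> {..<N}" if "i \<le> Suc k" for i
    using sel_valid_subsets(2)[OF sel0] sel_valid_subsets(2)[OF sel] that by (cases i) auto
  have q: "0 \<le> q i" for i by (simp add: q_def mD_nonneg)
  define Y where "Y = Xs N (S 0) (E 0)"
  have Y: "(\<Sum>j<nS. Y j) = mD N (E 0)" "(\<Sum>j<nS. \<bar>Y j\<bar>) = mD N (E 0)"
    using sum_Xs[OF E[of 0], of "S 0" nS] S[of 0] by (auto simp: Y_def Xs_nonneg)
  \<comment> \<open>Accumulated sampling noise plus the accumulated drift of
    \<open>uoc_set_drift\<close>, in which absorbed mass counts twice.\<close>
  define b where "b i = real (Suc i) * (real nS + M0 + 1) * e + 2 * (\<Sum>l<i. q l)" for i
  have uoc: "(\<Sum>j<nS. \<bar>Xs N (S (Suc i)) (E i) j - vmul nS Q (Xs N (S i) (E i)) j\<bar>) \<le> real nS * e"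
    if "i \<le> Suc k" for i
  proof -
    have "\<bar>Xs N (S (Suc i)) (E i) j - vmul nS Q (Xs N (S i) (E i)) j\<bar> \<le> e" if "j < nS" for j
      using step[OF \<open>i \<le> Suc k\<close>] that by (simp add: good_step_def S_def)
    then have "(\<Sum>j<nS. \<bar>Xs N (S (Suc i)) (E i) j - vmul nS Q (Xs N (S i) (E i)) j\<bar>) \<le> (\<Sum>j<nS. e)"
      by (intro sum_mono) simp
    then show ?thesis by simp
  qed
  \<comment> \<open>The UOC set changes at every step, yet its counts are compared with the iterates
    of \<open>Q\<close> from the fixed start Y. As \<open>Q\<close> does not expand the l1 norm,
    earlier errors add up without being amplified.\<close>
  have track: "(\<Sum>j<nS. \<bar>Xs N (S (Suc i)) (E i) j - vmul nS (Q ^\<^sub>m Suc i) Y j\<bar>) \<le> b i" if "i \<le> k" for i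
    using that
  proof (induction i)
    case 0
    have "(\<Sum>j<nS. \<bar>Xs N (S (Suc 0)) (E 0) j - vmul nS (Q ^\<^sub>m Suc 0) Y j\<bar>)
        = (\<Sum>j<nS. \<bar>Xs N (S (Suc 0)) (E 0) j - vmul nS Q Y j\<bar>)"
      using Q_carrier by simp
    also have "\<dots> \<le> real nS * e" using uoc[of 0] by (simp add: Y_def)
    also have "\<dots> \<le> b 0" using M0_pos e_pos by (simp add: b_def algebra_simps)
    finally show ?case .
  next
    case (Suc i)
    let ?A = "Xs N (S (Suc (Suc i))) (E (Suc i))" and ?B = "Xs N (S (Suc i)) (E (Suc i))"
      and ?C = "Xs N (S (Suc i)) (E i)" and ?F = "vmul nS (Q ^\<^sub>m Suc i) Y"
    have "(\<Sum>j<nS. \<bar>?A j - vmul nS (Q ^\<^sub>m Suc (Suc i)) Y j\<bar>)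
       \<le> (\<Sum>j<nS. \<bar>?A j - vmul nS Q ?B j\<bar> + (\<bar>vmul nS Q (\<lambda>l. ?B l - ?C l) j\<bar> + \<bar>vmul nS Q (\<lambda>l. ?C l - ?F l) j\<bar>))"
    proof (rule sum_mono)
      fix j assume "j \<in> {..<nS}"
      then have j: "j < nS" by simp
      show "\<bar>?A j - vmul nS (Q ^\<^sub>m Suc (Suc i)) Y j\<bar>
        \<le> \<bar>?A j - vmul nS Q ?B j\<bar> + (\<bar>vmul nS Q (\<lambda>l. ?B l - ?C l) j\<bar> + \<bar>vmul nS Q (\<lambda>l. ?C l - ?F l) j\<bar>)"
        unfolding vmul_pow_Suc[OF Q_carrier j, of "Suc i"] vmul_diff by linarith
    qed
    also have "\<dots> = (\<Sum>j<nS. \<bar>?A j - vmul nS Q ?B j\<bar>) + ((\<Sum>j<nS. \<bar>vmul nS Q (\<lambda>l. ?B l - ?C l) j\<bar>)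
        + (\<Sum>j<nS. \<bar>vmul nS Q (\<lambda>l. ?C l - ?F l) j\<bar>))"
      by (simp add: sum.distrib)
    also have "(\<Sum>j<nS. \<bar>?A j - vmul nS Q ?B j\<bar>) \<le> real nS * e" using uoc[of "Suc i"] Suc.prems by simp
    also have "(\<Sum>j<nS. \<bar>vmul nS Q (\<lambda>l. ?B l - ?C l) j\<bar>) \<le> 2 * q i + (M0 + 1) * e"
      unfolding q_def using Suc.prems
      by (intro order_trans[OF vmul_Q_nonexpansive] uoc_set_drift[OF step sel]) auto
    also have "(\<Sum>j<nS. \<bar>vmul nS Q (\<lambda>l. ?C l - ?F l) j\<bar>) \<le> b i"
      using Suc by (intro order_trans[OF vmul_Q_nonexpansive]) auto
    also have "real nS * e + ((2 * q i + (M0 + 1) * e) + b i) = b (Suc i)"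
      by (simp add: b_def algebra_simps)
    finally show ?case by simp
  qed
  define \<kappa> where "\<kappa> = b k + \<delta>"
  have near: "\<bar>Xs N (S (Suc k)) (E k) j - mD N (E 0) * \<mu> j\<bar> \<le> \<kappa>" if j: "j < nS" for j
  proof -
    have "\<bar>Xs N (S (Suc k)) (E k) j - vmul nS (Q ^\<^sub>m Suc k) Y j\<bar> \<le> b k"
      by (rule order_trans[OF _ track[of k]]) (use j in \<open>auto intro: member_le_sum\<close>)
    moreover have "\<bar>vmul nS (Q ^\<^sub>m Suc k) Y j - mD N (E 0) * \<mu> j\<bar> \<le> \<delta> * mD N (E 0)"
      using mix[of Y] member_le_sum[of j "{..<nS}" "\<lambda>j. \<bar>vmul nS (Q ^\<^sub>m Suc k) Y j - mD N (E 0) * \<mu> j\<bar>"] j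
      by (simp add: Y)
    moreover have "\<delta> * mD N (E 0) \<le> \<delta>" using d mD_le_1[OF E[of 0]] by (simp add: mult_left_le)
    ultimately show ?thesis unfolding \<kappa>_def by linarith
  qed
  have "mu_min * mD N (E 0) - \<kappa> - Rc * e \<le> q k"
    unfolding q_def using S[of "Suc k"] E[of k] near mD_nonneg
    by (intro maximal_absorbs[OF _ sel[of k]]) auto
  moreover have "mu_min * (beta * (1 - mD N (D 0)) - e) \<le> mu_min * mD N (E 0)"
    using sel_valid_card(2)[OF sel0] mu_min by (intro mult_left_mono) auto
  moreover have "mu_min * e \<le> e" using mu_min e_pos by simp
  \<comment> \<open>Absorbed mass enters twice through the tracking error and once as what the last
    maximal set swallows; hence the 3 in the growth rate.\<close>
  moreover have "2 * (\<Sum>l<k. q l) + q k \<le> 3 * (\<Sum>l<Suc k. q l)"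
    using q[of k] sum_nonneg[of "{..<k}" q] q by simp
  ultimately have "mu_min * beta * (1 - mD N (D 0)) - e - Rc * e - real (Suc k) * (real nS + M0 + 1) * e - \<delta>
      \<le> 3 * (\<Sum>l<Suc k. q l)"
    by (simp add: \<kappa>_def b_def algebra_simps)
  \<comment> \<open>Summing \<open>good_step_mass\<close>: what is absorbed is gained by the OLC
    set, up to \<open>M0 * e\<close> per step.\<close>
  moreover have "mD N (D 0) + (\<Sum>l<i. q l) - real i * (M0 * e) \<le> mD N (D i)" if "i \<le> Suc k" for i
    using that
  proof (induction i)
    case (Suc i)
    then show ?case using good_step_mass[OF step sel, of i] by (simp add: q_def algebra_simps)
  qed simp
  from this[of "Suc k"] have "mD N (D 0) + (\<Sum>l<Suc k. q l) - real (Suc k) * (M0 * e) \<le> mD N (D (Suc k))"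
    by simp
  moreover have "0 \<le> real k * (Rc * e)" "0 \<le> real k * e" "0 \<le> Rc * e" "0 \<le> real (Suc k) * (real nS + M0 + 1) * e"
    using Rc_pos e_pos M0_pos by simp_all
  moreover have "1 - mD N (D (Suc k)) \<le> (1 - mu_min * beta / 3) * (1 - mD N (D 0)) + \<delta> + real (Suc k) * (real nS + 2 + 2 * M0 + Rc) * e"
    if "w - e - R - W - \<delta> \<le> 3 * Z" "mD N (D 0) + Z - real (Suc k) * (M0 * e) \<le> mD N (D (Suc k))"
      "w = mu_min * beta * (1 - mD N (D 0))" "W = real (Suc k) * (real nS + M0 + 1) * e" "0 \<le> W"
      "R = Rc * e" "0 \<le> R" "0 \<le> real k * R" "0 \<le> real k * e" "0 \<le> real (Suc k) * (M0 * e)" for w R W Z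
  proof -
    have "real (Suc k) * (real nS + 2 + 2 * M0 + Rc) * e
      = W + real (Suc k) * (M0 * e) + real (Suc k) * e + real (Suc k) * R"
      using that by (simp add: algebra_simps)
    moreover have "(1 - mu_min * beta / 3) * (1 - mD N (D 0)) = 1 - mD N (D 0) - w / 3"
      using that by (simp add: algebra_simps)
    moreover have "e + R \<le> real (Suc k) * e + real (Suc k) * R" using that by (simp add: algebra_simps)
    moreover have "0 < e" by (rule e_pos)
    ultimately show ?thesis using that d by linarith
  qed
  moreover have "0 \<le> real (Suc k) * (M0 * e)" using M0_pos e_pos by simp
  ultimately have "1 - mD N (D (Suc k)) \<le> (1 - mu_min * beta / 3) * (1 - mD N (D 0)) + \<delta>
      + real (Suc k) * (real nS + 2 + 2 * M0 + Rc) * e"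
    by blast
  then show ?thesis by (simp add: D_def)
qed

end

end

context lyapunov_bandit
begin

text \<open>The number of steps is \<open>J * K + T\<close>: J windows of length K make the
  uncovered mass small, then T further steps contract the deviation of the whole population. These
  lengths are fixed first, and \<open>e\<close> is then taken small enough for the errors
  accumulated over them.\<close>

lemma attraction:
  obtains e \<tau> where "0 < e"
    "\<And>N efe erd x. \<lbrakk>0 < N; 1 / real N \<le> e; 0 \<le> efe; efe \<le> e; 0 \<le> erd; erd \<le> e;
        \<forall>k<\<tau>. good_step N e efe erd (x k) (x (Suc k))\<rbrakk>
      \<Longrightarrow> 0 \<le> slack nS P \<alpha> y st \<eta> efe N (fst (x \<tau>)) {..<N}"
proof -
  obtain C \<theta> where mixing: "0 < C" "0 < \<theta>" "\<theta> < 1"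
    "\<And>v k. (\<Sum>j<nS. \<bar>vmul nS (Q ^\<^sub>m k) v j - (\<Sum>i<nS. v i) * \<mu> j\<bar>) \<le> C * \<theta> ^ k * (\<Sum>i<nS. \<bar>v i\<bar>)"
    using Q_mixing by blast
  define c0 where "c0 = mu_min * beta / 3"
  have c0: "0 < c0" "c0 < 1"
  proof -
    have "mu_min * beta \<le> 1 * 1" using mu_min beta by (intro mult_mono) auto
    then show "0 < c0" "c0 < 1" using mu_min beta by (auto simp: c0_def)
  qed
  \<comment> \<open>With uncovered mass at most \<open>\<epsilon>\<close>, each step adds at most
    \<open>(1 - \<gamma>) * \<eta> / 8\<close> to the deviation of all arms. Together with the noise
    bound \<open>e3\<close> of the same size, the recursion settles at
    \<open>\<eta> / 4\<close>.\<close>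
  define \<epsilon> where "\<epsilon> = (1 - \<gamma>) * \<eta> / (32 * L)"
  have eps: "0 < \<epsilon>" using gamma eta L by (simp add: \<epsilon>_def)
  define C' where "C' = real nS + 2 + 2 * M0 + Rc"
  have C': "0 < C'" using M0_pos Rc_pos by (simp add: C'_def)
  have "(\<lambda>k. C * \<theta> ^ k) \<longlonglongrightarrow> C * 0"
    using mixing by (intro tendsto_mult tendsto_const LIMSEQ_power_zero) auto
  then have "eventually (\<lambda>k. C * \<theta> ^ k < c0 * \<epsilon> / 4) sequentially"
    using c0 eps by (intro order_tendstoD(2)[of _ "0::real"]) auto
  then obtain k0 where k0: "\<And>k. k \<ge> k0 \<Longrightarrow> C * \<theta> ^ k < c0 * \<epsilon> / 4"
    unfolding eventually_sequentially by blast
  define K where "K = Suc k0"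
  define \<delta> where "\<delta> = C * \<theta> ^ K"
  have delta: "0 \<le> \<delta>" "\<delta> \<le> c0 * \<epsilon> / 4"
    using mixing k0[of K] by (auto simp: \<delta>_def K_def)
  obtain J where J: "(1 - c0) ^ J < \<epsilon> / 4"
    using real_arch_pow_inv[of "\<epsilon> / 4" "1 - c0"] eps c0 by auto
  obtain T0 where T0: "\<gamma> ^ T0 < \<eta> / (8 * L)"
    using real_arch_pow_inv[of "\<eta> / (8 * L)" \<gamma>] eta L gamma by auto
  \<comment> \<open>At least one step must follow the windows: a window of length K uses K + 1
    transitions, because the sets selected in a state are stored only in the next one.\<close>
  define T where "T = Suc T0"
  have T: "\<gamma> ^ T \<le> \<eta> / (8 * L)"
    using power_decreasing[of T0 T \<gamma>] gamma T0 by (simp add: T_def)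
  \<comment> \<open>The four bounds cover, in turn, the errors of a window, the mass lost during the
    last T steps, the noise in the deviation of all arms, and \<open>efe\<close> in the final
    slack.\<close>
  define e where "e = min (min (c0 * \<epsilon> / (4 * real K * C')) (\<epsilon> / (4 * real T * M0)))
      (min ((1 - \<gamma>) * \<eta> / (8 * L * real nS)) (\<eta> / 2))"
  have "0 < real K" "0 < real T" by (auto simp: K_def T_def)
  then have e: "0 < e" "e \<le> c0 * \<epsilon> / (4 * real K * C')" "e \<le> \<epsilon> / (4 * real T * M0)"
      "e \<le> (1 - \<gamma>) * \<eta> / (8 * L * real nS)" "e \<le> \<eta> / 2"
    using c0 eps C' M0_pos gamma eta L nS by (simp_all add: e_def)
  have e1: "real K * C' * e \<le> c0 * \<epsilon> / 4" using e(2) C' \<open>0 < real K\<close> by (simp add: field_simps)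
  have e2: "real T * (M0 * e) \<le> \<epsilon> / 4" using e(3) M0_pos \<open>0 < real T\<close> by (simp add: field_simps)
  have e3: "L * real nS * e \<le> (1 - \<gamma>) * \<eta> / 8" using e(4) L nS by (simp add: field_simps)
  show ?thesis
  proof (rule that[OF e(1)])
    fix N efe erd x
    assume hyps: "0 < N" "1 / real N \<le> e" "0 \<le> efe" "efe \<le> e" "0 \<le> erd" "erd \<le> e"
      and good: "\<forall>k<J * K + T. good_step N e efe erd (x k) (x (Suc k))"
    note steps = good[rule_format]
    define a where "a i = 1 - mD N (fst (snd (x (Suc i))))" for i
    have sub: "fst (snd (x (Suc i))) \<subseteq> {..<N}" if "i < J * K + T" for i
      using steps[OF that] sel_valid_subsets(1) unfolding good_step_def by blast
    have a: "0 \<le> a i" "a i \<le> 1" if "i < J * K + T" for i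
      using mD_le_1[OF sub[OF that]] mD_nonneg by (auto simp: a_def)
    have "a (Suc j * K) \<le> (1 - c0) * a (j * K) + (\<delta> + real K * C' * e)" if "j < J" for j
    proof -
      have le: "j * K + K \<le> J * K" using that by (metis Suc_leI add.commute mult_Suc mult_le_mono1)
      have "good_step N e efe erd (x (j * K + i)) (x (j * K + Suc i))" if "i \<le> Suc k0" for i
        using steps[of "j * K + i"] le that by (simp add: K_def T_def)
      note window = this
      have "1 - mD N (fst (snd (x (j * K + Suc (Suc k0)))))
        \<le> (1 - mu_min * beta / 3) * (1 - mD N (fst (snd (x (j * K + 1))))) + \<delta> + real (Suc k0) * (real nS + 2 + 2 * M0 + Rc) * e"
        by (rule window_growth[OF hyps, of k0 \<delta> "\<lambda>i. x (j * K + i)"])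
          (use mixing(4)[of K] delta(1) window in \<open>simp_all only: \<delta>_def K_def\<close>)
      then show ?thesis by (simp add: a_def c0_def C'_def K_def add.commute add.left_commute)
    qed
    then have "a (J * K) \<le> (1 - c0) ^ J * a (0 * K) + (\<delta> + real K * C' * e) / (1 - (1 - c0))"
      using c0 delta C' e by (intro linear_recursion_bound[of J "\<lambda>j. a (j * K)"]) auto
    \<comment> \<open>One quarter of \<open>\<epsilon>\<close> is what remains of the initial
      uncovered mass and one half is the fixed point of the recursion; the last quarter is reserved
      for mass lost during the T final steps.\<close>
    also have "\<dots> \<le> \<epsilon> / 4 * 1 + (c0 * \<epsilon> / 4 + c0 * \<epsilon> / 4) / c0"
    proof (intro add_mono mult_mono)
      show "(\<delta> + real K * C' * e) / (1 - (1 - c0)) \<le> (c0 * \<epsilon> / 4 + c0 * \<epsilon> / 4) / c0"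
        unfolding diff_diff_eq2 add_diff_cancel_left' using delta e1 c0
        by (intro divide_right_mono add_mono) auto
    qed (use J a[of 0] eps c0 in \<open>auto simp: T_def\<close>)
    also have "\<dots> = 3 * \<epsilon> / 4" using c0 by (simp add: field_simps)
    finally have aJ: "a (J * K) \<le> 3 * \<epsilon> / 4" .
    have aJi: "a (J * K + i) \<le> 3 * \<epsilon> / 4 + real i * (M0 * e)" if "i < T" for i
      using that
    proof (induction i)
      case 0
      then show ?case using aJ by simp
    next
      case (Suc i)
      let ?k = "J * K + i"
      obtain S' D E where x1: "x (Suc ?k) = (S', D, E)" by (metis prod_cases3)
      obtain S'' D' E' where x2: "x (Suc (Suc ?k)) = (S'', D', E')" by (metis prod_cases3)
      have "good_step N e efe erd (x ?k) (S', D, E)" using steps[of ?k] Suc.prems x1 by simp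
      moreover have "sel_valid nS P \<alpha> y st \<eta> efe erd N S' D E D' E'"
        using steps[of "Suc ?k"] Suc.prems x1 x2 by (simp add: good_step_def)
      ultimately have "mD N D + mD N (E \<inter> D') - M0 * e \<le> mD N D'"
        by (rule good_step_mass[OF hyps])
      then have "a (Suc ?k) \<le> a ?k + M0 * e"
        using x1 x2 mD_nonneg[of N "E \<inter> D'"] by (simp add: a_def)
      then show ?case using Suc by (simp add: algebra_simps)
    qed
    have aT: "a (J * K + i) \<le> \<epsilon>" if "i < T" for i
    proof -
      have "real i * (M0 * e) \<le> real T * (M0 * e)" using that M0_pos e by (intro mult_right_mono) auto
      then show ?thesis using aJi[OF that] e2 by linarith
    qed
    define H where "H i = dev N (fst (x (J * K + i))) {..<N}" for i
    have "H (Suc i) \<le> \<gamma> * H i + (1 - \<gamma>) * \<eta> / 4" if "i < T" for i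
    proof -
      let ?k = "J * K + i"
      obtain S' D E where x1: "x (Suc ?k) = (S', D, E)" by (metis prod_cases3)
      have "good_step N e efe erd (x ?k) (S', D, E)" using steps[of ?k] that x1 by simp
      then have "H (Suc i) \<le> \<gamma> * H i + L * real nS * e + 4 * L * a ?k"
        using total_dev_step[OF hyps] x1 by (simp add: H_def a_def)
      moreover have "4 * L * a ?k \<le> 4 * L * \<epsilon>" using aT[OF that] L by (intro mult_left_mono) auto
      moreover have "4 * L * \<epsilon> = (1 - \<gamma>) * \<eta> / 8" using L by (simp add: \<epsilon>_def)
      ultimately show ?thesis using e3 by linarith
    qed
    then have "H T \<le> \<gamma> ^ T * H 0 + (1 - \<gamma>) * \<eta> / 4 / (1 - \<gamma>)"
      using gamma eta by (intro linear_recursion_bound) auto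
    moreover have "\<gamma> ^ T * H 0 \<le> \<eta> / (8 * L) * (2 * L)"
    proof (rule mult_mono)
      have "fst (x (J * K)) i < nS" if "i < N" for i
        using steps[of "J * K"] that by (simp add: good_step_def T_def)
      then show "H 0 \<le> 2 * L"
        using dev_le_mass[OF subset_refl, of N "fst (x (J * K))"] mD_all[OF hyps(1)] by (simp add: H_def)
      show "0 \<le> H 0" unfolding H_def by (rule dev_nonneg)
    qed (use T eta L in auto)
    moreover have "(1 - \<gamma>) * \<eta> / 4 / (1 - \<gamma>) = \<eta> / 4" using gamma by (simp add: field_simps)
    moreover have "\<eta> / (8 * L) * (2 * L) = \<eta> / 4" using L by simp
    ultimately have "H T \<le> \<eta> / 2" by linarith
    then show "0 \<le> slack nS P \<alpha> y st \<eta> efe N (fst (x (J * K + T))) {..<N}"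
      using hyps e(5) mD_all[OF hyps(1)] by (simp add: slack_eq H_def)
  qed
qed

end

section \<open>Finite Markov chains and concentration\<close>

lemma expectation_bind_pmf_bounded:
  fixes h :: "'b \<Rightarrow> real"
  assumes "\<And>x. \<bar>h x\<bar> \<le> B"
  shows "measure_pmf.expectation (bind_pmf p f) h = measure_pmf.expectation p (\<lambda>x. measure_pmf.expectation (f x) h)"
  unfolding measure_pmf_bind
  by (rule integral_bind[where K="count_space UNIV" and B=B and B'=1])
    (use assms in \<open>auto simp: measure_pmf.finite_measure_axioms measure_pmf.emeasure_space_1
      space_subprob_algebra measure_pmf.subprob_space_axioms intro!: AE_I2\<close>)

lemma expectation_mono_bounded:
  fixes f g :: "'a \<Rightarrow> real"
  assumes "\<And>x. x \<in> set_pmf p \<Longrightarrow> f x \<le> g x" "\<And>x. x \<in> set_pmf p \<Longrightarrow> \<bar>f x\<bar> \<le> B" "\<And>x. x \<in> set_pmf p \<Longrightarrow> \<bar>g x\<bar> \<le> B'"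
  shows "measure_pmf.expectation p f \<le> measure_pmf.expectation p g"
  using assms by (intro integral_mono_AE measure_pmf.integrable_const_bound[where B=B]
      measure_pmf.integrable_const_bound[where B=B']) (auto simp: AE_measure_pmf_iff)

lemma abs_expectation_le:
  fixes f :: "'a \<Rightarrow> real"
  assumes "\<And>x. x \<in> set_pmf p \<Longrightarrow> \<bar>f x\<bar> \<le> B"
  shows "\<bar>measure_pmf.expectation p f\<bar> \<le> B"
proof -
  have i: "integrable (measure_pmf p) f"
    using assms by (intro measure_pmf.integrable_const_bound[where B=B]) (auto simp: AE_measure_pmf_iff)
  have "\<bar>measure_pmf.expectation p f\<bar> \<le> measure_pmf.expectation p (\<lambda>x. \<bar>f x\<bar>)"
    by (rule integral_abs_bound)
  also have "\<dots> \<le> B"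
    using assms i by (intro measure_pmf.integral_le_const) (auto simp: AE_measure_pmf_iff)
  finally show ?thesis .
qed

lemma prob_bind_le:
  assumes "\<And>x. x \<in> set_pmf p \<Longrightarrow> x \<in> G \<Longrightarrow> measure_pmf.prob (f x) A \<le> b" "0 \<le> b"
  shows "measure_pmf.prob (bind_pmf p f) A \<le> measure_pmf.prob p (- G) + b"
proof -
  have "measure_pmf.prob (bind_pmf p f) A = measure_pmf.expectation (bind_pmf p f) (indicat_real A)"
    by simp
  also have "\<dots> = measure_pmf.expectation p (\<lambda>x. measure_pmf.prob (f x) A)"
    by (subst expectation_bind_pmf_bounded[where B=1]) (auto simp: indicator_def)
  also have "\<dots> \<le> measure_pmf.expectation p (\<lambda>x. indicat_real (- G) x + b)"
    using assms by (intro expectation_mono_bounded[where B=1 and B'="1 + b"])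
      (auto simp: indicator_def add_increasing measure_pmf.prob_le_1 add_increasing2 intro: order_trans[OF measure_pmf.prob_le_1])
  also have "\<dots> = measure_pmf.prob p (- G) + b"
    by (subst Bochner_Integration.integral_add)
      (auto intro!: measure_pmf.integrable_const_bound[where B=1] simp: indicator_def)
  finally show ?thesis .
qed

text \<open>The iterate in \<open>state_dist\<close>, for an arbitrary kernel and start, so that the
  chain can be restarted at a later time.\<close>

definition chain :: "('a \<Rightarrow> 'a pmf) \<Rightarrow> nat \<Rightarrow> 'a \<Rightarrow> 'a pmf" where
  "chain K t x = ((\<lambda>d. bind_pmf d K) ^^ t) (return_pmf x)"

lemma chain_0: "chain K 0 x = return_pmf x"
  by (simp add: chain_def)

lemma chain_Suc: "chain K (Suc t) x = bind_pmf (chain K t x) K"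
  by (simp add: chain_def)

lemma chain_add: "chain K (t + s) x = bind_pmf (chain K t x) (chain K s)"
proof (induction s)
  case 0
  have "chain K 0 = return_pmf" by (rule ext) (rule chain_0)
  then show ?case by (simp add: bind_return_pmf')
next
  case (Suc s)
  have "chain K (Suc s) = (\<lambda>w. bind_pmf (chain K s w) K)" by (rule ext) (rule chain_Suc)
  then show ?case by (simp add: chain_Suc Suc bind_assoc_pmf)
qed

lemma set_chain_subset:
  assumes "\<And>x. x \<in> X \<Longrightarrow> set_pmf (K x) \<subseteq> X" "x \<in> X"
  shows "set_pmf (chain K t x) \<subseteq> X"
proof (induction t)
  case (Suc t)
  then show ?case using assms(1) by (fastforce simp: chain_Suc)
qed (simp add: chain_0 assms(2))

lemma finite_bounded_subsequence:
  fixes f :: "'a \<Rightarrow> nat \<Rightarrow> real"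
  assumes "finite X" "\<And>x n. x \<in> X \<Longrightarrow> \<bar>f x n\<bar> \<le> B"
  shows "\<exists>r. strict_mono r \<and> (\<forall>x\<in>X. convergent (f x \<circ> r))"
  using assms
proof (induction X rule: finite_induct)
  case empty
  show ?case by (rule exI[of _ id]) (auto simp: strict_mono_def)
next
  case (insert a X)
  then have "\<exists>r. strict_mono r \<and> (\<forall>x\<in>X. convergent (f x \<circ> r))" by blast
  then obtain r where r: "strict_mono r" "\<forall>x\<in>X. convergent (f x \<circ> r)" by blast
  have "Bseq (f a \<circ> r)" using insert.prems[of a] by (intro BseqI'[of _ B]) auto
  then obtain s where s: "strict_mono s" "convergent ((f a \<circ> r) \<circ> s)"
    using bounded_imp_convergent_subsequence[of "f a \<circ> r"] by (auto simp: Bseq_eq_bounded convergent_def)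
  have "convergent (f x \<circ> (r \<circ> s))" if "x \<in> insert a X" for x
    using that r s convergent_subseq_convergent[OF _ s(1), of "f x \<circ> r"] by (auto simp: o_assoc)
  then show ?case using strict_mono_o[OF r(1) s(1)] by blast
qed

text \<open>Comparing \<open>A\<^sub>T f\<close> with \<open>A\<^sub>T (A\<^sub>n f)\<close> (which are close for \<open>T\<close> large) reduces convergence of the
  averages to the existence of one subsequential limit, which is automatically invariant.\<close>

lemma finite_chain_cesaro_convergent:
  fixes K :: "'a \<Rightarrow> 'a pmf" and f :: "'a \<Rightarrow> real"
  assumes fin: "finite X" and closed: "\<And>x. x \<in> X \<Longrightarrow> set_pmf (K x) \<subseteq> X" and x0: "x0 \<in> X"
  shows "convergent (\<lambda>T. (\<Sum>t<T. measure_pmf.expectation (chain K t x0) f) / real T)"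
proof -
  define B where "B = (\<Sum>x\<in>X. \<bar>f x\<bar>)"
  have fB: "\<bar>f x\<bar> \<le> B" if "x \<in> X" for x
    using member_le_sum[of x X "\<lambda>x. \<bar>f x\<bar>"] fin that by (simp add: B_def)
  have B0: "0 \<le> B" by (simp add: B_def sum_nonneg)
  define E where "E t h x = measure_pmf.expectation (chain K t x) h" for t x and h :: "'a \<Rightarrow> real"
  define A where "A n h x = (\<Sum>t<n. E t h x) / real n" for n h x
  have supp: "set_pmf (chain K t x) \<subseteq> X" if "x \<in> X" for t x
    by (rule set_chain_subset[OF closed that])
  have int: "integrable (measure_pmf (chain K t x)) h" if "x \<in> X" for t x and h :: "'a \<Rightarrow> real"
    using supp[OF that] fin by (intro integrable_measure_pmf_finite) (auto intro: finite_subset)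
  have E_cong: "E t h x = E t h' x" if "x \<in> X" "\<And>z. z \<in> X \<Longrightarrow> h z = h' z" for t h h' x
    unfolding E_def using that supp[OF that(1)] by (intro integral_cong_AE) (auto simp: AE_measure_pmf_iff)
  have E_bd: "\<bar>E t h x\<bar> \<le> b" if "x \<in> X" "\<And>z. z \<in> X \<Longrightarrow> \<bar>h z\<bar> \<le> b" for t h x b
    unfolding E_def using that supp[OF that(1)] by (intro abs_expectation_le) auto
  have E_eq: "E t h x = (\<Sum>z\<in>X. pmf (chain K t x) z * h z)" if "x \<in> X" for t h x
    unfolding E_def using supp[OF that] fin by (subst integral_measure_pmf[of X]) auto
  have E_add: "E (t + s) h x = E t (E s h) x" if x: "x \<in> X" for t s h x
  proof -
    have "E (t + s) h x = (\<Sum>z\<in>X. pmf (chain K t x) z *\<^sub>R E s h z)"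
      unfolding E_def chain_add using supp x fin
      by (intro pmf_expectation_bind) (auto intro: finite_subset)
    then show ?thesis using E_eq[OF x] by simp
  qed
  have E_A: "E t (A n h) x = (\<Sum>s<n. E (t + s) h x) / real n" if x: "x \<in> X" for t n h x
  proof -
    have "E t (A n h) x = (\<Sum>z\<in>X. \<Sum>s<n. pmf (chain K t x) z * E s h z / real n)"
      by (simp add: E_eq[OF x] A_def sum_divide_distrib sum_distrib_left)
    also have "\<dots> = (\<Sum>s<n. \<Sum>z\<in>X. pmf (chain K t x) z * E s h z / real n)" by (rule sum.swap)
    also have "\<dots> = (\<Sum>s<n. E t (E s h) x / real n)"
      by (simp add: E_eq[OF x, of t "E _ h"] sum_divide_distrib)
    finally show ?thesis by (simp add: E_add[OF x] sum_divide_distrib)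
  qed
  have Ef: "\<bar>E t f x\<bar> \<le> B" if "x \<in> X" for t x using that by (intro E_bd fB)
  \<comment> \<open>Shifting time by s changes only s terms at either end of the sum.\<close>
  have shift: "\<bar>(\<Sum>t<T. E (t + s) f x) - (\<Sum>t<T. E t f x)\<bar> \<le> 2 * B * real s" if x: "x \<in> X" for T s x
  proof (induction s)
    case (Suc s)
    have "(\<Sum>t<T. E (t + Suc s) f x) = (\<Sum>t<T. E (t + s) f x) + E (T + s) f x - E s f x"
      using sum.lessThan_Suc_shift[of "\<lambda>t. E (t + s) f x" T] by simp
    then show ?case using Suc Ef[OF x, of "T + s"] Ef[OF x, of s] by (simp add: algebra_simps)
  qed simp
  have A_A: "\<bar>A T f x - A T (A n f) x\<bar> \<le> 2 * B * real n / real T" if x: "x \<in> X" and n: "n > 0" for T n x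
  proof (cases "T = 0")
    case False
    have "real n * real T * (A T (A n f) x - A T f x) = (\<Sum>t<T. \<Sum>s<n. E (t + s) f x) - real n * (\<Sum>t<T. E t f x)"
      using n False by (simp add: A_def[of T] E_A[OF x] sum_divide_distrib[symmetric] right_diff_distrib)
    also have "(\<Sum>t<T. \<Sum>s<n. E (t + s) f x) = (\<Sum>s<n. \<Sum>t<T. E (t + s) f x)" by (rule sum.swap)
    also have "\<dots> - real n * (\<Sum>t<T. E t f x) = (\<Sum>s<n. (\<Sum>t<T. E (t + s) f x) - (\<Sum>t<T. E t f x))"
      by (simp add: sum_subtractf)
    also have "\<bar>\<dots>\<bar> \<le> (\<Sum>s<n. 2 * B * real n)"
    proof (intro order_trans[OF sum_abs] sum_mono)
      fix s assume "s \<in> {..<n}"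
      then have "2 * B * real s \<le> 2 * B * real n" using B0 by (intro mult_left_mono) auto
      then show "\<bar>(\<Sum>t<T. E (t + s) f x) - (\<Sum>t<T. E t f x)\<bar> \<le> 2 * B * real n"
        using shift[OF x, of s T] by linarith
    qed
    finally have "real n * (real T * \<bar>A T (A n f) x - A T f x\<bar>) \<le> real n * (2 * B * real n)"
      by (simp add: abs_mult mult.assoc)
    then have "real T * \<bar>A T (A n f) x - A T f x\<bar> \<le> 2 * B * real n" using n by simp
    then show ?thesis using False by (simp add: field_simps abs_minus_commute)
  qed (simp add: A_def)
  have A_bd: "\<bar>A n f x\<bar> \<le> B" if x: "x \<in> X" for n x
  proof (cases "n = 0")
    case False
    have "\<bar>\<Sum>t<n. E t f x\<bar> \<le> (\<Sum>t<n. B)" by (intro order_trans[OF sum_abs] sum_mono Ef x)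
    then show ?thesis using False by (simp add: A_def field_simps)
  qed (simp add: A_def B0)
  obtain r where r: "strict_mono r" "\<forall>x\<in>X. convergent ((\<lambda>n. A n f x) \<circ> r)"
    using finite_bounded_subsequence[OF fin, of "\<lambda>x n. A n f x" B] A_bd by blast
  then obtain g where g: "\<And>x. x \<in> X \<Longrightarrow> (\<lambda>k. A (r k) f x) \<longlonglongrightarrow> g x"
    unfolding convergent_def o_def by metis
  \<comment> \<open>Applying one step to an average over n times changes it by an amount of order
    1/n, so the subsequential limit g is exactly invariant.\<close>
  have inv1: "E 1 g x = g x" if x: "x \<in> X" for x
  proof -
    have "(\<lambda>k. E 1 (A (r k) f) x) \<longlonglongrightarrow> E 1 g x"
      unfolding E_eq[OF x] using g by (intro tendsto_intros) auto
    moreover have "(\<lambda>k. E 1 (A (r k) f) x - A (r k) f x) \<longlonglongrightarrow> 0"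
    proof (rule Lim_null_comparison)
      show "(\<lambda>k. 2 * B / real (r k)) \<longlonglongrightarrow> 0"
        using filterlim_subseq[OF r(1)]
        by (intro real_tendsto_divide_at_top[OF tendsto_const] filterlim_compose[OF filterlim_real_sequentially])
      show "\<forall>\<^sub>F k in sequentially. norm (E 1 (A (r k) f) x - A (r k) f x) \<le> 2 * B / real (r k)"
      proof (rule always_eventually, intro allI)
        fix k
        have "E 1 (A (r k) f) x - A (r k) f x = ((\<Sum>s<r k. E (s + 1) f x) - (\<Sum>t<r k. E t f x)) / real (r k)"
          unfolding E_A[OF x] by (simp add: A_def diff_divide_distrib)
        then show "norm (E 1 (A (r k) f) x - A (r k) f x) \<le> 2 * B / real (r k)"
          using shift[OF x, of 1 "r k"] by (simp add: abs_divide divide_right_mono)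
      qed
    qed
    ultimately have "(\<lambda>k. E 1 (A (r k) f) x - (E 1 (A (r k) f) x - A (r k) f x)) \<longlonglongrightarrow> E 1 g x - 0"
      by (intro tendsto_diff)
    then have "(\<lambda>k. A (r k) f x) \<longlonglongrightarrow> E 1 g x" by simp
    then show ?thesis using g[OF x] LIMSEQ_unique by blast
  qed
  have inv: "E t g x = g x" if x: "x \<in> X" for t x
    using x
  proof (induction t arbitrary: x)
    case 0
    then show ?case by (simp add: E_def chain_0)
  next
    case (Suc t)
    have "E (Suc t) g x = E t (E 1 g) x" using E_add[OF Suc.prems, of t 1] by simp
    also have "\<dots> = E t g x" by (rule E_cong[OF Suc.prems]) (rule inv1)
    finally show ?case using Suc by simp
  qed
  \<comment> \<open>Fix n on the subsequence so that \<open>A n f\<close> is uniformly close to g.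
    For large T the average of f is close to that of \<open>A n f\<close>, hence to that of g, which
    equals g by invariance; so the whole sequence converges.\<close>
  have "(\<lambda>T. A T f x0) \<longlonglongrightarrow> g x0"
  proof (rule LIMSEQ_I)
    fix \<epsilon> :: real assume eps: "0 < \<epsilon>"
    have "\<forall>\<^sub>F k in sequentially. \<forall>x\<in>X. \<bar>A (r k) f x - g x\<bar> < \<epsilon> / 2"
    proof (rule eventually_ball_finite[OF fin], rule ballI)
      fix x assume x: "x \<in> X"
      show "\<forall>\<^sub>F k in sequentially. \<bar>A (r k) f x - g x\<bar> < \<epsilon> / 2"
        using tendstoD[OF g[OF x], of "\<epsilon> / 2"] eps by (simp add: dist_real_def)
    qed
    then obtain k where k: "k \<ge> 1" "\<And>x. x \<in> X \<Longrightarrow> \<bar>A (r k) f x - g x\<bar> < \<epsilon> / 2"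
      unfolding eventually_sequentially by (metis nle_le)
    define n where "n = r k"
    have n: "n > 0" using seq_suble[OF r(1), of k] k(1) by (simp add: n_def)
    obtain T0 where T0: "real T0 > 2 * B * real n / (\<epsilon> / 2)" using reals_Archimedean2 by blast
    show "\<exists>T0. \<forall>T\<ge>T0. norm (A T f x0 - g x0) < \<epsilon>"
    proof (intro exI allI impI)
      fix T assume T: "Suc T0 \<le> T"
      have "2 * B * real n < (\<epsilon> / 2) * real T0" using T0 eps by (simp add: field_simps)
      also have "\<dots> \<le> (\<epsilon> / 2) * real T" using T eps by (intro mult_left_mono) auto
      finally have "2 * B * real n / real T < \<epsilon> / 2" using T by (simp add: field_simps)
      then have 1: "\<bar>A T f x0 - A T (A n f) x0\<bar> < \<epsilon> / 2" using A_A[OF x0 n, of T] by linarith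
      have "A T (A n f) x0 - g x0 = (\<Sum>t<T. E t (A n f) x0 - g x0) / real T"
        using T by (simp add: A_def[of T] sum_subtractf diff_divide_distrib)
      moreover have "\<bar>E t (A n f) x0 - g x0\<bar> \<le> \<epsilon> / 2" for t
      proof -
        have "E t (A n f) x0 - g x0 = E t (\<lambda>z. A n f z - g z) x0"
          using inv[OF x0, of t] by (simp add: E_eq[OF x0] right_diff_distrib sum_subtractf)
        also have "\<bar>\<dots>\<bar> \<le> \<epsilon> / 2" using k(2) by (intro E_bd[OF x0]) (auto simp: n_def intro: less_imp_le)
        finally show ?thesis .
      qed
      then have "\<bar>\<Sum>t<T. E t (A n f) x0 - g x0\<bar> \<le> (\<Sum>t<T. \<epsilon> / 2)"
        by (intro order_trans[OF sum_abs] sum_mono)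
      ultimately have "\<bar>A T (A n f) x0 - g x0\<bar> \<le> \<epsilon> / 2"
        using T by (simp add: abs_divide divide_le_eq mult.commute)
      with 1 show "norm (A T f x0 - g x0) < \<epsilon>" unfolding real_norm_def by linarith
    qed
  qed
  then show ?thesis unfolding A_def E_def convergent_def by blast
qed

text \<open>A union bound over the steps, phrased through the marginal at time k: an end state
  counts as bad if no good path leads to it, which avoids a measure on trajectories. The path in the
  event may start anywhere, which fits a conclusion valid from every start.\<close>

lemma chain_good_path_prob:
  assumes closed: "\<And>x. x \<in> X \<Longrightarrow> set_pmf (K x) \<subseteq> X" and x: "x \<in> X" and p: "0 \<le> p"
    and step: "\<And>x. x \<in> X \<Longrightarrow> measure_pmf.prob (K x) {x'. \<not> G x x'} \<le> p"
  shows "measure_pmf.prob (chain K k x) {z. \<not> (\<exists>xs. xs k = z \<and> (\<forall>i<k. G (xs i) (xs (Suc i))))} \<le> real k * p"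
proof (induction k)
  case 0
  have "\<exists>xs. xs 0 = z" for z :: 'a by (rule exI[of _ "\<lambda>_. z"]) simp
  then have "{z :: 'a. \<not> (\<exists>xs. xs 0 = z \<and> (\<forall>i<0. G (xs i) (xs (Suc i))))} = {}" by auto
  then show ?case by (simp only: measure_empty)
next
  case (Suc k)
  let ?R = "\<lambda>k z. \<exists>xs. xs k = z \<and> (\<forall>i<k. G (xs i) (xs (Suc i)))"
  have "measure_pmf.prob (chain K (Suc k) x) {z. \<not> ?R (Suc k) z}
      \<le> measure_pmf.prob (chain K k x) (- {z. ?R k z}) + p"
    unfolding chain_Suc
  proof (rule prob_bind_le[OF _ p])
    fix w assume w: "w \<in> set_pmf (chain K k x)" "w \<in> {z. ?R k z}"
    then obtain xs where xs: "xs k = w" "\<forall>i<k. G (xs i) (xs (Suc i))" by auto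
    have "{z. \<not> ?R (Suc k) z} \<subseteq> {z. \<not> G w z}"
    proof (intro subsetI CollectI notI, elim CollectE notE)
      fix z assume "G w z"
      with xs have "(xs(Suc k := z)) (Suc k) = z \<and> (\<forall>i<Suc k. G ((xs(Suc k := z)) i) ((xs(Suc k := z)) (Suc i)))"
        by (auto simp: less_Suc_eq)
      then show "?R (Suc k) z" by blast
    qed
    then have "measure_pmf.prob (K w) {z. \<not> ?R (Suc k) z} \<le> measure_pmf.prob (K w) {z. \<not> G w z}"
      by (intro measure_pmf.finite_measure_mono) auto
    also have "\<dots> \<le> p"
      using w(1) set_chain_subset[of X K x k, OF closed x] by (intro step) blast
    finally show "measure_pmf.prob (K w) {z. \<not> ?R (Suc k) z} \<le> p" .
  qed
  also have "- {z. ?R k z} = {z. \<not> ?R k z}" by auto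
  finally show ?case using Suc by (simp add: algebra_simps)
qed

text \<open>Hoeffding's inequality for the independent indicators of the arms in D. The size of D
  occurs in the denominator of the exponent, so replacing it by \<open>N\<close> weakens the bound,
  and the empty set is treated apart.\<close>

lemma Pi_pmf_count_concentration:
  assumes D: "D \<subseteq> {..<N}" and N: "0 < N" and eps: "0 < \<epsilon>"
  shows "measure_pmf.prob (Pi_pmf {..<N} d q)
     {\<omega>. \<bar>real (card {i \<in> D. \<omega> i = j}) - (\<Sum>i\<in>D. pmf (q i) j)\<bar> \<ge> \<epsilon> * real N} \<le> 2 * exp (- 2 * \<epsilon>\<^sup>2 * real N)"
proof (cases "D = {}")
  case True
  have "0 < \<epsilon> * real N" using eps N by simp
  then have "\<not> \<epsilon> * real N \<le> 0" by linarith
  with True show ?thesis by simp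
next
  case False
  have fin: "finite D" using D finite_subset by blast
  let ?M = "measure_pmf (Pi_pmf {..<N} d q)"
  let ?X = "\<lambda>i \<omega>. if \<omega> i = j then 1 else 0 :: real"
  interpret Hoeffding_ineq ?M D ?X "\<lambda>_. 0" "\<lambda>_. 1" "\<Sum>i\<in>D. measure_pmf.expectation (Pi_pmf {..<N} d q) (?X i)"
  proof unfold_locales
    have "prob_space.indep_vars ?M (\<lambda>_. borel) ?X {..<N}"
      by (intro prob_space.indep_vars_compose2[OF _ indep_vars_Pi_pmf])
        (auto simp: measure_pmf.prob_space_axioms)
    then show "prob_space.indep_vars ?M (\<lambda>_. borel) ?X D"
      using D by (rule prob_space.indep_vars_subset[OF measure_pmf.prob_space_axioms])
  qed (auto simp: fin)
  have "measure_pmf.expectation (Pi_pmf {..<N} d q) (?X i) = pmf (q i) j" if "i \<in> D" for i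
  proof -
    have "measure_pmf.expectation (Pi_pmf {..<N} d q) (?X i)
        = measure_pmf.expectation (map_pmf (\<lambda>\<omega>. \<omega> i) (Pi_pmf {..<N} d q)) (\<lambda>b. if b = j then 1 else 0)"
      by simp
    also have "map_pmf (\<lambda>\<omega>. \<omega> i) (Pi_pmf {..<N} d q) = q i" using D that by (subst Pi_pmf_component) auto
    also have "measure_pmf.expectation (q i) (\<lambda>b. if b = j then 1 else 0) = pmf (q i) j"
      by (subst integral_measure_pmf[of "{j}"]) (auto split: if_splits)
    finally show ?thesis .
  qed
  then have mean: "(\<Sum>i\<in>D. measure_pmf.expectation (Pi_pmf {..<N} d q) (?X i)) = (\<Sum>i\<in>D. pmf (q i) j)" by simp
  have count: "(\<Sum>i\<in>D. ?X i \<omega>) = real (card {i \<in> D. \<omega> i = j})" for \<omega>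
  proof -
    have "(\<Sum>i\<in>D. ?X i \<omega>) = (\<Sum>i\<in>{i \<in> D. \<omega> i = j}. 1)"
      using fin by (intro sum.mono_neutral_cong_right) auto
    then show ?thesis by simp
  qed
  have cD: "0 < card D" "card D \<le> N" using False fin card_mono[OF _ D] by (auto simp: card_gt_0_iff)
  have "measure_pmf.prob (Pi_pmf {..<N} d q)
     {\<omega>. \<bar>real (card {i \<in> D. \<omega> i = j}) - (\<Sum>i\<in>D. pmf (q i) j)\<bar> \<ge> \<epsilon> * real N}
     \<le> 2 * exp (- 2 * (\<epsilon> * real N)\<^sup>2 / real (card D))"
    using Hoeffding_ineq_abs_ge[of "\<epsilon> * real N"] eps N cD by (simp add: mean count)
  also have "\<dots> \<le> 2 * exp (- 2 * \<epsilon>\<^sup>2 * real N)"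
  proof -
    have "\<epsilon>\<^sup>2 * real N \<le> (\<epsilon> * real N)\<^sup>2 / real (card D)"
      using cD eps by (simp add: field_simps power2_eq_square mult_left_mono)
    then show ?thesis by simp
  qed
  finally show ?thesis .
qed

section \<open>Action counts\<close>

lemma rround_bound:
  assumes "0 \<le> x" "k \<in> set_pmf (rround x)" shows "\<bar>real k - x\<bar> \<le> 1"
proof -
  have "k = nat \<lceil>x\<rceil> \<or> k = nat \<lfloor>x\<rfloor>" using assms(2) by (auto simp: rround_def split: if_splits)
  then show ?thesis using assms(1) by linarith
qed

lemma expectation_rround:
  assumes "0 \<le> x" shows "measure_pmf.expectation (rround x) real = x"
proof -
  define p where "p = x - of_int \<lfloor>x\<rfloor>"
  have p: "0 \<le> p" "p \<le> 1" unfolding p_def by linarith+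
  have "measure_pmf.expectation (rround x) real = p * real (nat \<lceil>x\<rceil>) + (1 - p) * real (nat \<lfloor>x\<rfloor>)"
    unfolding rround_def p_def[symmetric] using p by simp
  also have "real (nat \<lfloor>x\<rfloor>) = of_int \<lfloor>x\<rfloor>" using assms by simp
  also have "p * real (nat \<lceil>x\<rceil>) + (1 - p) * of_int \<lfloor>x\<rfloor> = x"
  proof (cases "x = of_int \<lfloor>x\<rfloor>")
    case True
    then show ?thesis by (simp add: p_def)
  next
    case False
    then have "\<lceil>x\<rceil> = \<lfloor>x\<rfloor> + 1" by linarith
    then have "real (nat \<lceil>x\<rceil>) = of_int \<lfloor>x\<rfloor> + 1" using assms by simp
    then show ?thesis by (simp add: p_def algebra_simps)
  qed
  finally show ?thesis .
qed

definition cnt :: "(nat \<Rightarrow> nat) \<Rightarrow> nat set \<Rightarrow> nat \<Rightarrow> real" where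
  "cnt S D s = real (card {i \<in> D. S i = s})"

definition act_cnt :: "(nat \<Rightarrow> nat) \<Rightarrow> nat set \<Rightarrow> (nat \<Rightarrow> bool) \<Rightarrow> nat \<Rightarrow> real" where
  "act_cnt S D A s = real (card {i \<in> D. S i = s \<and> A i})"

lemma sum_by_state_action:
  fixes g :: "nat \<Rightarrow> bool \<Rightarrow> real"
  assumes fin: "finite D" and S: "\<And>i. i \<in> D \<Longrightarrow> S i < n"
  shows "(\<Sum>i\<in>D. g (S i) (A i))
    = (\<Sum>s<n. act_cnt S D A s * g s True + (cnt S D s - act_cnt S D A s) * g s False)"
proof -
  have "(\<Sum>i\<in>D. g (S i) (A i)) = (\<Sum>s<n. \<Sum>i\<in>{i \<in> D. S i = s}. g (S i) (A i))"
    using S fin by (intro sum.group[symmetric]) auto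
  also have "\<dots> = (\<Sum>s<n. act_cnt S D A s * g s True + (cnt S D s - act_cnt S D A s) * g s False)"
  proof (rule sum.cong[OF refl])
    fix s
    let ?T = "{i \<in> D. S i = s \<and> A i}" and ?F = "{i \<in> D. S i = s \<and> \<not> A i}"
    have split: "{i \<in> D. S i = s} = ?T \<union> ?F" "?T \<inter> ?F = {}" by auto
    have fins: "finite ?T" "finite ?F" using fin by auto
    have c: "cnt S D s = act_cnt S D A s + real (card ?F)"
      unfolding cnt_def act_cnt_def split(1) using card_Un_disjoint[OF fins split(2)] by simp
    have "(\<Sum>i\<in>{i \<in> D. S i = s}. g (S i) (A i)) = (\<Sum>i\<in>?T. g (S i) (A i)) + (\<Sum>i\<in>?F. g (S i) (A i))"
      unfolding split(1) by (rule sum.union_disjoint[OF fins split(2)])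
    also have "(\<Sum>i\<in>?T. g (S i) (A i)) = (\<Sum>i\<in>?T. g s True)" by (rule sum.cong) auto
    also have "(\<Sum>i\<in>?F. g (S i) (A i)) = (\<Sum>i\<in>?F. g s False)" by (rule sum.cong) auto
    finally show "(\<Sum>i\<in>{i \<in> D. S i = s}. g (S i) (A i))
        = act_cnt S D A s * g s True + (cnt S D s - act_cnt S D A s) * g s False"
      using c by (simp add: act_cnt_def)
  qed
  finally show ?thesis .
qed

lemma sum_cnt:
  assumes "finite D" "\<And>i. i \<in> D \<Longrightarrow> S i < n" shows "(\<Sum>s<n. cnt S D s) = real (card D)"
  using sum_by_state_action[of D S n "\<lambda>_ _. 1" "\<lambda>_. True", OF assms] by simp

lemma sum_act_cnt:
  assumes "finite D" "\<And>i. i \<in> D \<Longrightarrow> S i < n" shows "(\<Sum>s<n. act_cnt S D A s) = real (card {i \<in> D. A i})"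
proof -
  have "(\<Sum>i\<in>D. if A i then 1 else 0 :: real) = real (card {i \<in> D. A i})"
    using assms(1) by (simp add: sum.If_cases Int_def)
  then show ?thesis using sum_by_state_action[of D S n "\<lambda>_ a. if a then 1 else 0" A, OF assms] by simp
qed

lemma act_cnt_le: "finite D \<Longrightarrow> act_cnt S D A s \<le> real (card D)"
  by (auto simp: act_cnt_def intro!: card_mono)

lemma act_cnt_nonneg: "0 \<le> act_cnt S D A s"
  by (simp add: act_cnt_def)

context restless_bandit
begin

text \<open>Expected number of activated arms per state under OLC: the \<open>pibar\<close> share,
  with the whole discrepancy to the budget placed on \<open>st\<close>.\<close>

definition olc_mean :: "(nat \<Rightarrow> real) \<Rightarrow> real \<Rightarrow> nat \<Rightarrow> real" where
  "olc_mean z n s = c s * z s + (if s = st then \<alpha> * n - (\<Sum>s'<nS. c s' * z s') else 0)"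

lemma sum_olc_mean: "(\<Sum>s<nS. olc_mean z n s) = \<alpha> * n"
  using st by (simp add: olc_mean_def sum.distrib)

lemma olc_mean_st: "olc_mean z n st = \<alpha> * n - (\<Sum>s\<in>{..<nS} - {st}. olc_mean z n s)"
  using sum_olc_mean[of z n] st by (subst (asm) sum.remove[of _ st]) auto

text \<open>Here g is any payoff of state and action; it is used for transition probabilities and
  for reward plus expected potential. The \<open>pibar\<close> average is separated from the price
  of the budget correction in \<open>st\<close>.\<close>

lemma olc_effect:
  "(\<Sum>s<nS. olc_mean z n s * g s True + (z s - olc_mean z n s) * g s False)
    = (\<Sum>s<nS. z s * ((1 - c s) * g s False + c s * g s True))
      + (\<alpha> * n - (\<Sum>s<nS. c s * z s)) * (g st True - g st False)"
proof -
  have "(\<Sum>s<nS. olc_mean z n s * g s True + (z s - olc_mean z n s) * g s False)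
    = (\<Sum>s<nS. z s * ((1 - c s) * g s False + c s * g s True)
        + (if s = st then (\<alpha> * n - (\<Sum>s<nS. c s * z s)) * (g s True - g s False) else 0))"
    by (intro sum.cong refl) (simp add: olc_mean_def algebra_simps)
  then show ?thesis using st by (simp add: sum.distrib)
qed

lemma act_cnt_special:
  assumes av: "act_valid nS \<alpha> y N S Do Dp q" and A: "A \<in> set_pmf q"
  shows "s \<in> S_plus nS y \<Longrightarrow> act_cnt S Do A s = cnt S Do s"
    and "s \<in> S_minus nS y \<Longrightarrow> act_cnt S Do A s = 0"
proof -
  have 1: "A i" if "i \<in> Do" "S i \<in> S_plus nS y" for i using av A that by (auto simp: act_valid_def)
  have 2: "\<not> A i" if "i \<in> Do" "S i \<in> S_minus nS y" for i using av A that by (auto simp: act_valid_def)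
  show "act_cnt S Do A s = cnt S Do s" if "s \<in> S_plus nS y"
  proof -
    have "{i \<in> Do. S i = s \<and> A i} = {i \<in> Do. S i = s}" using 1 that by auto
    then show ?thesis by (simp add: act_cnt_def cnt_def)
  qed
  show "act_cnt S Do A s = 0" if "s \<in> S_minus nS y"
  proof -
    have "{i \<in> Do. S i = s \<and> A i} = {}" using 2 that by auto
    then show ?thesis unfolding act_cnt_def by (simp only: card.empty of_nat_0)
  qed
qed

text \<open>Away from \<open>st\<close> a count is deterministic or rounded once, so it is off by at
  most 1. The count in \<open>st\<close> is the budget minus the other counts, so its error is at
  most one rounding of the budget plus \<open>nS - 1\<close> others.\<close>

lemma olc_act_cnt_bound:
  assumes av: "act_valid nS \<alpha> y N S Do Dp q" and A: "A \<in> set_pmf q"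
    and fin: "finite Do" and S: "\<And>i. i \<in> Do \<Longrightarrow> S i < nS" and s: "s < nS"
  shows "\<bar>act_cnt S Do A s - olc_mean (cnt S Do) (real (card Do)) s\<bar> \<le> real nS"
proof -
  let ?m = "olc_mean (cnt S Do) (real (card Do))"
  have other: "\<bar>act_cnt S Do A s - ?m s\<bar> \<le> 1" if "s < nS" "s \<noteq> st" for s
    using that(1)
  proof (cases rule: state_cases)
    case empty
    have "card {i \<in> Do. S i = s \<and> A i} \<in> set_pmf (map_pmf (\<lambda>A. card {i \<in> Do. S i = s \<and> A i}) q)"
      using A by simp
    also have "map_pmf (\<lambda>A. card {i \<in> Do. S i = s \<and> A i}) q = rround (cnt S Do s / 2)"
      using av empty by (simp add: act_valid_def cnt_def)
    finally have "\<bar>act_cnt S Do A s - cnt S Do s / 2\<bar> \<le> 1"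
      unfolding act_cnt_def by (intro rround_bound) (simp_all add: cnt_def)
    moreover have "?m s = cnt S Do s / 2" unfolding olc_mean_def empty(3) using that by simp
    ultimately show ?thesis by simp
  qed (use that act_cnt_special[OF av A] in \<open>auto simp: olc_mean_def\<close>)
  have n1: "1 \<le> real nS" using nS by linarith
  show ?thesis
  proof (cases "s = st")
    case False
    then show ?thesis using other[OF s] n1 by linarith
  next
    case True
    have "card {i \<in> Do. A i} \<in> set_pmf (map_pmf (\<lambda>A. card {i \<in> Do. A i}) q)" using A by simp
    also have "map_pmf (\<lambda>A. card {i \<in> Do. A i}) q = rround (\<alpha> * real (card Do))"
      using av by (simp add: act_valid_def)
    finally have B: "\<bar>real (card {i \<in> Do. A i}) - \<alpha> * real (card Do)\<bar> \<le> 1"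
      using alpha by (intro rround_bound) auto
    have "act_cnt S Do A st = real (card {i \<in> Do. A i}) - (\<Sum>s\<in>{..<nS} - {st}. act_cnt S Do A s)"
    proof -
      have "(\<Sum>s<nS. act_cnt S Do A s) = real (card {i \<in> Do. A i})" by (rule sum_act_cnt[OF fin]) (rule S)
      then show ?thesis using st by (subst (asm) sum.remove[of _ st]) auto
    qed
    then have "act_cnt S Do A st - ?m st = (real (card {i \<in> Do. A i}) - \<alpha> * real (card Do))
        - (\<Sum>s\<in>{..<nS} - {st}. act_cnt S Do A s - ?m s)"
      by (subst olc_mean_st) (simp add: sum_subtractf)
    moreover have "\<bar>\<Sum>s\<in>{..<nS} - {st}. act_cnt S Do A s - ?m s\<bar> \<le> (\<Sum>s\<in>{..<nS} - {st}. 1)"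
      by (intro order_trans[OF sum_abs] sum_mono other) auto
    moreover have "(\<Sum>s\<in>{..<nS} - {st}. 1 :: real) = real nS - 1" using st by (simp add: of_nat_diff Suc_leI)
    ultimately show ?thesis unfolding True using B by linarith
  qed
qed

lemma uoc_act_cnt_bound:
  assumes av: "act_valid nS \<alpha> y N S Do Dp q" and A: "A \<in> set_pmf q" and s: "s < nS"
  shows "\<bar>act_cnt S Dp A s - c s * cnt S Dp s\<bar> \<le> 1"
proof -
  have "card {i \<in> Dp. S i = s \<and> A i} \<in> set_pmf (map_pmf (\<lambda>A. card {i \<in> Dp. S i = s \<and> A i}) q)"
    using A by simp
  also have "map_pmf (\<lambda>A. card {i \<in> Dp. S i = s \<and> A i}) q = rround (c s * cnt S Dp s)"
    using av s by (simp add: act_valid_def cnt_def)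
  finally show ?thesis
    using rround_bound[of "c s * cnt S Dp s"] c_bounds[OF s] by (simp add: act_cnt_def cnt_def)
qed

lemma expectation_map_real:
  "measure_pmf.expectation q (\<lambda>A. real (f A)) = measure_pmf.expectation (map_pmf f q) real"
  by simp

text \<open>\<open>act_valid\<close> prescribes the law of each rounding but not their joint law.
  Linearity of expectation suffices, because the count in \<open>st\<close> is the budget minus the
  other counts.\<close>

lemma expectation_olc_act_cnt:
  assumes av: "act_valid nS \<alpha> y N S Do Dp q"
    and fin: "finite Do" and S: "\<And>i. i \<in> Do \<Longrightarrow> S i < nS" and s: "s < nS"
  shows "measure_pmf.expectation q (\<lambda>A. act_cnt S Do A s) = olc_mean (cnt S Do) (real (card Do)) s"
proof -
  let ?m = "olc_mean (cnt S Do) (real (card Do))"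
  have other: "measure_pmf.expectation q (\<lambda>A. act_cnt S Do A s) = ?m s" if "s < nS" "s \<noteq> st" for s
    using that(1)
  proof (cases rule: state_cases)
    case plus
    have "measure_pmf.expectation q (\<lambda>A. act_cnt S Do A s) = measure_pmf.expectation q (\<lambda>A. cnt S Do s)"
      using act_cnt_special(1)[OF av] plus by (intro integral_cong_AE) (auto simp: AE_measure_pmf_iff)
    then show ?thesis using plus that by (simp add: olc_mean_def)
  next
    case minus
    have "measure_pmf.expectation q (\<lambda>A. act_cnt S Do A s) = measure_pmf.expectation q (\<lambda>A. 0)"
      using act_cnt_special(2)[OF av] minus by (intro integral_cong_AE) (auto simp: AE_measure_pmf_iff)
    then show ?thesis using minus that by (simp add: olc_mean_def)
  next
    case empty
    have "map_pmf (\<lambda>A. card {i \<in> Do. S i = s \<and> A i}) q = rround (cnt S Do s / 2)"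
      using av empty by (simp add: act_valid_def cnt_def)
    then have "measure_pmf.expectation q (\<lambda>A. act_cnt S Do A s) = cnt S Do s / 2"
      unfolding act_cnt_def by (subst expectation_map_real) (simp add: expectation_rround cnt_def del: integral_map_pmf)
    moreover have "?m s = cnt S Do s / 2" unfolding olc_mean_def empty(3) using that by simp
    ultimately show ?thesis by simp
  qed (use that in auto)
  show ?thesis
  proof (cases "s = st")
    case False
    then show ?thesis using other[OF s] by simp
  next
    case True
    have int: "integrable (measure_pmf q) (\<lambda>A. act_cnt S Do A s)" for s
      using act_cnt_le[OF fin] act_cnt_nonneg
      by (intro measure_pmf.integrable_const_bound[where B="real (card Do)"]) auto
    have "act_cnt S Do A st = real (card {i \<in> Do. A i}) - (\<Sum>s\<in>{..<nS} - {st}. act_cnt S Do A s)" for A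
    proof -
      have "(\<Sum>s<nS. act_cnt S Do A s) = real (card {i \<in> Do. A i})" by (rule sum_act_cnt[OF fin]) (rule S)
      then show ?thesis using st by (subst (asm) sum.remove[of _ st]) auto
    qed
    then have "measure_pmf.expectation q (\<lambda>A. act_cnt S Do A st)
      = measure_pmf.expectation q (\<lambda>A. real (card {i \<in> Do. A i}) - (\<Sum>s\<in>{..<nS} - {st}. act_cnt S Do A s))"
      by simp
    also have "\<dots> = measure_pmf.expectation q (\<lambda>A. real (card {i \<in> Do. A i}))
        - (\<Sum>s\<in>{..<nS} - {st}. measure_pmf.expectation q (\<lambda>A. act_cnt S Do A s))"
    proof (subst Bochner_Integration.integral_diff)
      show "integrable (measure_pmf q) (\<lambda>A. real (card {i \<in> Do. A i}))"
        using fin by (intro measure_pmf.integrable_const_bound[where B="real (card Do)"]) (auto intro!: card_mono)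
    qed (auto simp: int)
    also have "measure_pmf.expectation q (\<lambda>A. real (card {i \<in> Do. A i})) = \<alpha> * real (card Do)"
    proof -
      have "map_pmf (\<lambda>A. card {i \<in> Do. A i}) q = rround (\<alpha> * real (card Do))"
        using av by (simp add: act_valid_def)
      then show ?thesis
        using alpha by (subst expectation_map_real) (simp add: expectation_rround del: integral_map_pmf)
    qed
    also have "(\<Sum>s\<in>{..<nS} - {st}. measure_pmf.expectation q (\<lambda>A. act_cnt S Do A s)) = (\<Sum>s\<in>{..<nS} - {st}. ?m s)"
      by (intro sum.cong refl other) auto
    also have "\<alpha> * real (card Do) - \<dots> = ?m st" by (simp add: olc_mean_st[symmetric])
    finally show ?thesis using True by simp
  qed
qed

text \<open>The bound holds for every realised action profile and not just on average, so only the
  transitions are left to the concentration inequality. Each of the \<open>nS\<close> counts is off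
  by at most \<open>nS\<close>, whence the square.\<close>

lemma olc_next_state_mean:
  assumes av: "act_valid nS \<alpha> y N S Do Dp q" and A: "A \<in> set_pmf q"
    and fin: "finite Do" and S: "\<And>i. i \<in> Do \<Longrightarrow> S i < nS" and j: "j < nS"
  shows "\<bar>(\<Sum>i\<in>Do. pmf (P (S i) (A i)) j) - (real (card Do) * \<mu> j + vmul nS \<Phi> (cnt S Do) j)\<bar> \<le> (real nS)\<^sup>2"
proof -
  let ?m = "olc_mean (cnt S Do) (real (card Do))" and ?z = "cnt S Do"
  have "real (card Do) * \<mu> j + vmul nS \<Phi> ?z j = (\<Sum>s<nS. ?m s * pmf (P s True) j + (?z s - ?m s) * pmf (P s False) j)"
    unfolding olc_effect[of ?z _ "\<lambda>s a. pmf (P s a) j"] vmul_Phi[OF j]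
    using j sum_cnt[of Do S nS, OF fin] S by (simp add: vmul_def Q_index algebra_simps)
  moreover have "(\<Sum>i\<in>Do. pmf (P (S i) (A i)) j)
      = (\<Sum>s<nS. act_cnt S Do A s * pmf (P s True) j + (?z s - act_cnt S Do A s) * pmf (P s False) j)"
    by (rule sum_by_state_action[OF fin S])
  ultimately have "(\<Sum>i\<in>Do. pmf (P (S i) (A i)) j) - (real (card Do) * \<mu> j + vmul nS \<Phi> ?z j)
      = (\<Sum>s<nS. (act_cnt S Do A s - ?m s) * (pmf (P s True) j - pmf (P s False) j))"
    by (simp add: sum_subtractf[symmetric] algebra_simps)
  also have "\<bar>\<dots>\<bar> \<le> (\<Sum>s<nS. real nS * 1)"
    unfolding abs_mult
  proof (intro order_trans[OF sum_abs] sum_mono)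
    fix s assume "s \<in> {..<nS}"
    then have "\<bar>act_cnt S Do A s - ?m s\<bar> \<le> real nS" using olc_act_cnt_bound[OF av A fin S] by simp
    moreover have "\<bar>pmf (P s True) j - pmf (P s False) j\<bar> \<le> 1"
      using pmf_le_1[of "P s True" j] pmf_le_1[of "P s False" j] pmf_nonneg[of "P s True" j] pmf_nonneg[of "P s False" j]
      by linarith
    ultimately show "\<bar>(act_cnt S Do A s - ?m s) * (pmf (P s True) j - pmf (P s False) j)\<bar> \<le> real nS * 1"
      unfolding abs_mult by (intro mult_mono) auto
  qed
  finally show ?thesis by (simp add: power2_eq_square)
qed

lemma uoc_next_state_mean:
  assumes av: "act_valid nS \<alpha> y N S Do Dp q" and A: "A \<in> set_pmf q"
    and fin: "finite Dp" and S: "\<And>i. i \<in> Dp \<Longrightarrow> S i < nS" and j: "j < nS"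
  shows "\<bar>(\<Sum>i\<in>Dp. pmf (P (S i) (A i)) j) - vmul nS Q (cnt S Dp) j\<bar> \<le> (real nS)\<^sup>2"
proof -
  let ?z = "cnt S Dp"
  have "vmul nS Q ?z j = (\<Sum>s<nS. c s * ?z s * pmf (P s True) j + (?z s - c s * ?z s) * pmf (P s False) j)"
    using j by (simp add: vmul_def Q_index algebra_simps)
  moreover have "(\<Sum>i\<in>Dp. pmf (P (S i) (A i)) j)
      = (\<Sum>s<nS. act_cnt S Dp A s * pmf (P s True) j + (?z s - act_cnt S Dp A s) * pmf (P s False) j)"
    by (rule sum_by_state_action[OF fin S])
  ultimately have "(\<Sum>i\<in>Dp. pmf (P (S i) (A i)) j) - vmul nS Q ?z j
      = (\<Sum>s<nS. (act_cnt S Dp A s - c s * ?z s) * (pmf (P s True) j - pmf (P s False) j))"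
    by (simp add: sum_subtractf[symmetric] algebra_simps)
  also have "\<bar>\<dots>\<bar> \<le> (\<Sum>s<nS. 1 * 1)"
  proof (intro order_trans[OF sum_abs] sum_mono)
    fix s assume "s \<in> {..<nS}"
    then have "\<bar>act_cnt S Dp A s - c s * ?z s\<bar> \<le> 1" using uoc_act_cnt_bound[OF av A] by simp
    moreover have "\<bar>pmf (P s True) j - pmf (P s False) j\<bar> \<le> 1"
      using pmf_le_1[of "P s True" j] pmf_le_1[of "P s False" j] pmf_nonneg[of "P s True" j] pmf_nonneg[of "P s False" j]
      by linarith
    ultimately show "\<bar>(act_cnt S Dp A s - c s * ?z s) * (pmf (P s True) j - pmf (P s False) j)\<bar> \<le> 1 * 1"
      unfolding abs_mult by (intro mult_mono) auto
  qed
  also have "\<dots> \<le> (real nS)\<^sup>2"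
  proof -
    have "real nS * 1 \<le> real nS * real nS" using nS by (intro mult_left_mono) auto
    then show ?thesis by (simp add: power2_eq_square)
  qed
  finally show ?thesis .
qed

end

section \<open>Optimality gap of the two-set policy\<close>

lemma expectation_sum_Pi_pmf:
  fixes f :: "'a \<Rightarrow> real" and N :: nat
  assumes "\<And>s. \<bar>f s\<bar> \<le> B"
  shows "measure_pmf.expectation (Pi_pmf {..<N} d q) (\<lambda>S. \<Sum>i<N. f (S i))
    = (\<Sum>i<N. measure_pmf.expectation (q i) f)"
proof -
  have "measure_pmf.expectation (Pi_pmf {..<N} d q) (\<lambda>S. \<Sum>i<N. f (S i))
      = (\<Sum>i<N. measure_pmf.expectation (Pi_pmf {..<N} d q) (\<lambda>S. f (S i)))"
    using assms by (intro Bochner_Integration.integral_sum measure_pmf.integrable_const_bound[where B=B]) auto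
  also have "\<dots> = (\<Sum>i<N. measure_pmf.expectation (q i) f)"
  proof (rule sum.cong[OF refl])
    fix i assume "i \<in> {..<N}"
    then have "map_pmf (\<lambda>S. S i) (Pi_pmf {..<N} d q) = q i" by (subst Pi_pmf_component) auto
    then show "measure_pmf.expectation (Pi_pmf {..<N} d q) (\<lambda>S. f (S i)) = measure_pmf.expectation (q i) f"
      by (metis integral_map_pmf)
  qed
  finally show ?thesis .
qed

lemma (in restless_bandit) R_rel_eq: "R_rel nS P r \<alpha> = (\<Sum>s<nS. \<Sum>a\<in>UNIV. r s a * y s a)"
proof -
  have "R_rel nS P r \<alpha> = lp_obj nS r y"
    unfolding R_rel_def using opt by (intro cSup_eq_maximum) (auto simp: lp_optimal_def)
  then show ?thesis by (simp add: lp_obj_def)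
qed

definition bad_states :: "nat \<Rightarrow> (nat \<Rightarrow> bool \<Rightarrow> nat pmf) \<Rightarrow> real \<Rightarrow> (nat \<Rightarrow> bool \<Rightarrow> real) \<Rightarrow> nat
    \<Rightarrow> real \<Rightarrow> real \<Rightarrow> nat \<Rightarrow> cstate set" where
  "bad_states nS P \<alpha> y st \<eta> efe N = {x. slack nS P \<alpha> y st \<eta> efe N (fst x) {..<N} < 0}"

locale two_set_chain = restless_bandit +
  fixes \<eta> efe erd :: real and N :: nat
    and dsel :: "cstate \<Rightarrow> (nat set \<times> nat set) pmf"
    and act :: "(nat \<Rightarrow> nat) \<Rightarrow> nat set \<Rightarrow> nat set \<Rightarrow> (nat \<Rightarrow> bool) pmf"
    and S0 :: "nat \<Rightarrow> nat"
  assumes N: "0 < N"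
    and policy: "two_set_policy nS P \<alpha> y st \<eta> efe erd N dsel act"
    and S0: "\<And>i. i < N \<Longrightarrow> S0 i < nS"
begin

abbreviation "K \<equiv> step_pmf N P dsel act"
abbreviation "X \<equiv> reachable N P dsel act S0"

lemma reachable_closed: "x \<in> X \<Longrightarrow> set_pmf (K x) \<subseteq> X"
  by (auto intro: reachable.step)

lemma init_reachable: "(S0, {}, {}) \<in> X"
  by (rule reachable.init)

lemma set_K:
  assumes "x' \<in> set_pmf (K x)"
  obtains Do Dp A S' where "(Do, Dp) \<in> set_pmf (dsel x)" "A \<in> set_pmf (act (fst x) Do Dp)"
    "S' \<in> PiE_dflt {..<N} 0 (\<lambda>i. set_pmf (P (fst x i) (A i)))" "x' = (S', Do, Dp)"
  using assms by (auto simp: step_pmf_def set_Pi_pmf o_def split: prod.splits)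

lemma reachable_states: "x \<in> X \<Longrightarrow> i < N \<Longrightarrow> fst x i < nS"
proof (induction arbitrary: i rule: reachable.induct)
  case init
  then show ?case using S0 by simp
next
  case (step x x')
  from step.hyps(2) show ?case
  proof (rule set_K)
    fix Do Dp A S'
    assume "S' \<in> PiE_dflt {..<N} 0 (\<lambda>i. set_pmf (P (fst x i) (A i)))" "x' = (S', Do, Dp)"
    then have "fst x' i \<in> set_pmf (P (fst x i) (A i))" using step.prems by (auto simp: PiE_dflt_def)
    then show ?thesis using P_states[OF step.IH[OF step.prems]] by auto
  qed
qed

lemma policy_valid:
  assumes "x \<in> X" "(Do, Dp) \<in> set_pmf (dsel x)"
  shows "sel_valid nS P \<alpha> y st \<eta> efe erd N (fst x) (fst (snd x)) (snd (snd x)) Do Dp"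
    and "act_valid nS \<alpha> y N (fst x) Do Dp (act (fst x) Do Dp)"
  using policy S0 assms unfolding two_set_policy_def by (cases x; fastforce)+

lemma finite_reachable: "finite X"
proof (rule finite_subset)
  \<comment> \<open>The initial state vector is arbitrary outside the arms, whereas every later one
    has the default value 0 there, so the starting point is added separately.\<close>
  show "X \<subseteq> insert (S0, {}, {}) (PiE_dflt {..<N} 0 (\<lambda>_. {..<nS}) \<times> Pow {..<N} \<times> Pow {..<N})"
  proof
    fix x' assume "x' \<in> X"
    then show "x' \<in> insert (S0, {}, {}) (PiE_dflt {..<N} 0 (\<lambda>_. {..<nS}) \<times> Pow {..<N} \<times> Pow {..<N})"
    proof cases
      case (step x)
      from step(2) show ?thesis
      proof (rule set_K)
        fix Do Dp A S'
        assume *: "(Do, Dp) \<in> set_pmf (dsel x)" "S' \<in> PiE_dflt {..<N} 0 (\<lambda>i. set_pmf (P (fst x i) (A i)))"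
          "x' = (S', Do, Dp)"
        have "Do \<subseteq> {..<N}" "Dp \<subseteq> {..<N}"
          using policy_valid(1)[OF step(1) *(1)] unfolding sel_valid_def eps_max_feasible_def
          by (auto split: if_splits)
        moreover have "S' \<in> PiE_dflt {..<N} 0 (\<lambda>_. {..<nS})"
          using *(2) P_states reachable_states[OF step(1)] by (fastforce simp: PiE_dflt_def)
        ultimately show ?thesis using *(3) by auto
      qed
    qed simp
  qed
qed (auto intro!: finite_insert[THEN iffD2] finite_cartesian_product finite_PiE_dflt)

text \<open>\<open>avg_reward\<close> is a \<open>lim\<close> and carries information only once
  convergence is known. The chain may be periodic or have several recurrent classes, so convergence
  comes from the Cesaro averages of a finite chain.\<close>

lemma avg_reward_eq_lim:
  "(\<lambda>T. (\<Sum>t<T. measure_pmf.expectation (chain K t (S0, {}, {})) (stage_reward N r dsel act)) / real T)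
     \<longlonglongrightarrow> avg_reward N P r dsel act S0"
proof -
  have "state_dist N P dsel act S0 t = chain K t (S0, {}, {})" for t
    by (simp add: state_dist_def chain_def)
  then show ?thesis
    using finite_chain_cesaro_convergent[OF finite_reachable reachable_closed init_reachable]
    unfolding avg_reward_def by (simp add: convergent_LIMSEQ_iff)
qed

definition r_max :: real where "r_max = (\<Sum>s<nS. \<Sum>a\<in>UNIV. \<bar>r s a\<bar>)"

lemma r_max: "s < nS \<Longrightarrow> \<bar>r s a\<bar> \<le> r_max"
proof -
  assume s: "s < nS"
  have "\<bar>r s a\<bar> \<le> (\<Sum>a\<in>UNIV. \<bar>r s a\<bar>)" by (rule member_le_sum) auto
  also have "\<dots> \<le> r_max" unfolding r_max_def
    using s by (intro member_le_sum[of s "{..<nS}" "\<lambda>s. \<Sum>a\<in>UNIV. \<bar>r s a\<bar>"]) (auto intro: sum_nonneg)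
  finally show ?thesis .
qed

lemma abs_arm_average_le:
  assumes "\<And>i. i < N \<Longrightarrow> \<bar>f i\<bar> \<le> B" shows "\<bar>(\<Sum>i<N. f i) / real N\<bar> \<le> B"
proof -
  have "\<bar>\<Sum>i<N. f i\<bar> \<le> (\<Sum>i<N. B)" using assms by (intro order_trans[OF sum_abs] sum_mono) auto
  then show ?thesis using N by (simp add: abs_divide divide_le_eq mult.commute)
qed

lemma stage_reward_bound: "x \<in> X \<Longrightarrow> \<bar>stage_reward N r dsel act x\<bar> \<le> r_max"
  unfolding stage_reward_def using reachable_states
  by (intro abs_expectation_le abs_arm_average_le r_max) auto

text \<open>Contribution of one arm in state i to the total expected reward when OLC acts on all
  arms: its own \<open>pibar\<close> reward, and the change it forces on the number of activations
  in \<open>st\<close>.\<close>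

definition rho :: "nat \<Rightarrow> real" where
  "rho i = (1 - c i) * r i False + c i * r i True + (\<alpha> - c i) * (r st True - r st False)"

text \<open>At \<open>\<mu>\<close> the shares already meet the budget, so the correction averages
  to 0 and the LP objective of \<open>y\<close> remains.\<close>

lemma sum_mu_rho: "(\<Sum>i<nS. \<mu> i * rho i) = R_rel nS P r \<alpha>"
proof -
  have "(\<Sum>i<nS. \<mu> i * rho i) = (\<Sum>i<nS. (\<mu> i * (1 - c i)) * r i False + (\<mu> i * c i) * r i True
      + (\<alpha> * \<mu> i - \<mu> i * c i) * (r st True - r st False))"
    by (intro sum.cong refl) (simp add: rho_def algebra_simps)
  also have "\<dots> = (\<Sum>i<nS. y i False * r i False + y i True * r i True)
      + (\<Sum>i<nS. \<alpha> * \<mu> i - \<mu> i * c i) * (r st True - r st False)"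
    by (simp add: sum.distrib sum_distrib_right mu_c mu_pibar[of _ False, unfolded pibar_False])
  also have "(\<Sum>i<nS. \<alpha> * \<mu> i - \<mu> i * c i) = 0"
    by (simp add: sum_subtractf sum_distrib_left[symmetric] sum_mu sum_mu_c)
  finally show ?thesis by (simp add: R_rel_eq UNIV_bool mult.commute add.commute)
qed

definition potential :: "(nat \<Rightarrow> real) \<Rightarrow> cstate \<Rightarrow> real" where
  "potential w x = (\<Sum>i<N. w (fst x i)) / real N"

lemma abs_potential_le: "(\<And>s. \<bar>w s\<bar> \<le> W) \<Longrightarrow> \<bar>potential w x\<bar> \<le> W"
  unfolding potential_def by (intro abs_arm_average_le)

text \<open>If the OLC set is everything, the reward and the expected next state are affine in the
  current state, and \<open>w\<close> solves the Poisson equation of this affine system.\<close>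

lemma poisson_on_good_states:
  assumes w: "\<And>i. i < nS \<Longrightarrow> w i = rho i + (\<Sum>j<nS. \<Phi> $$ (i, j) * w j)"
    and W: "\<And>s. \<bar>w s\<bar> \<le> W"
    and x: "x \<in> X" and good: "x \<notin> bad_states nS P \<alpha> y st \<eta> efe N"
  shows "stage_reward N r dsel act x + measure_pmf.expectation (K x) (potential w)
    = potential w x + R_rel nS P r \<alpha>"
proof -
  let ?S = "fst x"
  note S = reachable_states[OF x]
  \<comment> \<open>Reward now plus the expected potential of the arm afterwards; treated as one
    payoff, \<open>olc_effect\<close> evaluates both at once.\<close>
  define g where "g s a = r s a + (\<Sum>j<nS. pmf (P s a) j * w j)" for s a
  have W0: "0 \<le> W" using W[of 0] by simp
  have Pw: "\<bar>\<Sum>j<nS. pmf (P s a) j * w j\<bar> \<le> real nS * W" for s a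
  proof -
    have "\<bar>\<Sum>j<nS. pmf (P s a) j * w j\<bar> \<le> (\<Sum>j<nS. 1 * W)"
    proof (intro order_trans[OF sum_abs] sum_mono)
      fix j show "\<bar>pmf (P s a) j * w j\<bar> \<le> 1 * W"
        unfolding abs_mult using W W0 by (intro mult_mono) (auto simp: pmf_le_1)
    qed
    then show ?thesis by simp
  qed
  \<comment> \<open>Apply \<open>\<mu>\<close> to the equation for w: as \<open>\<mu>\<close>
    annihilates \<open>\<Phi>\<close>, only the mean of \<open>rho\<close> survives.\<close>
  have mw: "(\<Sum>j<nS. \<mu> j * w j) = R_rel nS P r \<alpha>"
  proof -
    have "(\<Sum>j<nS. \<mu> j * w j) = (\<Sum>i<nS. \<mu> i * rho i + \<mu> i * (\<Sum>j<nS. \<Phi> $$ (i, j) * w j))"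
      by (intro sum.cong refl) (subst w, auto simp: distrib_left)
    also have "\<dots> = R_rel nS P r \<alpha> + (\<Sum>i<nS. \<Sum>j<nS. \<mu> i * \<Phi> $$ (i, j) * w j)"
      by (simp add: sum.distrib sum_mu_rho sum_distrib_left mult.assoc)
    also have "(\<Sum>i<nS. \<Sum>j<nS. \<mu> i * \<Phi> $$ (i, j) * w j) = (\<Sum>j<nS. \<Sum>i<nS. \<mu> i * \<Phi> $$ (i, j) * w j)"
      by (rule sum.swap)
    also have "\<dots> = (\<Sum>j<nS. vmul nS \<Phi> \<mu> j * w j)"
      by (simp add: vmul_def sum_distrib_right)
    also have "\<dots> = 0" by (simp add: mu_Phi)
    finally show ?thesis by simp
  qed
  \<comment> \<open>The effective transition row of an arm is its row of \<open>\<Phi>\<close> plus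
    \<open>\<mu>\<close>; this extra \<open>\<mu>\<close> produces the constant
    \<open>R_rel\<close>.\<close>
  have gbar: "(1 - c i) * g i False + c i * g i True + (\<alpha> - c i) * (g st True - g st False)
      = w i + R_rel nS P r \<alpha>" if i: "i < nS" for i
  proof -
    have "(1 - c i) * g i False + c i * g i True + (\<alpha> - c i) * (g st True - g st False)
      = rho i + (\<Sum>j<nS. ((1 - c i) * pmf (P i False) j + c i * pmf (P i True) j
          + (\<alpha> - c i) * (pmf (P st True) j - pmf (P st False) j)) * w j)"
      by (simp add: g_def rho_def sum.distrib sum_subtractf sum_distrib_left algebra_simps)
    also have "\<dots> = rho i + (\<Sum>j<nS. (\<Phi> $$ (i, j) + \<mu> j) * w j)"
      using i by (intro arg_cong2[where f="(+)"] refl sum.cong) (auto simp: Phi_index Q_index algebra_simps)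
    also have "\<dots> = w i + (\<Sum>j<nS. \<mu> j * w j)"
      by (subst w[OF i]) (simp add: distrib_right sum.distrib)
    finally show ?thesis by (simp add: mw)
  qed
  have per_action: "measure_pmf.expectation (act ?S Do Dp) (\<lambda>A. (\<Sum>i<N. g (?S i) (A i)) / real N)
      = potential w x + R_rel nS P r \<alpha>" if D: "(Do, Dp) \<in> set_pmf (dsel x)" for Do Dp
  proof -
    have Do: "Do = {..<N}"
      using policy_valid(1)[OF x D] good by (auto simp: sel_valid_def bad_states_def split: if_splits)
    note av = policy_valid(2)[OF x D, unfolded Do]
    let ?q = "act ?S {..<N} Dp" and ?z = "cnt ?S {..<N}"
    let ?m = "olc_mean ?z (real (card {..<N}))"
    have int: "integrable (measure_pmf ?q) (\<lambda>A. act_cnt ?S {..<N} A s)" for s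
      using act_cnt_le[of "{..<N}"] act_cnt_nonneg
      by (intro measure_pmf.integrable_const_bound[where B="real (card {..<N})"]) auto
    have "measure_pmf.expectation ?q (\<lambda>A. \<Sum>i<N. g (?S i) (A i))
      = measure_pmf.expectation ?q (\<lambda>A. \<Sum>s<nS. act_cnt ?S {..<N} A s * g s True + (?z s - act_cnt ?S {..<N} A s) * g s False)"
      using S by (intro arg_cong[where f="measure_pmf.expectation ?q"] ext sum_by_state_action) auto
    also have "\<dots> = (\<Sum>s<nS. ?m s * g s True + (?z s - ?m s) * g s False)"
    proof -
      have E: "measure_pmf.expectation ?q (\<lambda>A. act_cnt ?S {..<N} A s) = ?m s" if "s < nS" for s
        using S that by (intro expectation_olc_act_cnt[OF av]) auto
      show ?thesis
        by (subst Bochner_Integration.integral_sum)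
          (auto intro!: sum.cong Bochner_Integration.integrable_add Bochner_Integration.integrable_diff
             integrable_mult_left int simp: E int)
    qed
    also have "\<dots> = (\<Sum>s<nS. ?z s * ((1 - c s) * g s False + c s * g s True))
      + (\<alpha> * real N - (\<Sum>s<nS. c s * ?z s)) * (g st True - g st False)"
      unfolding olc_effect by simp
    also have "real N = (\<Sum>s<nS. ?z s)"
      using S by (subst sum_cnt) auto
    also have "(\<Sum>s<nS. ?z s * ((1 - c s) * g s False + c s * g s True))
      + (\<alpha> * (\<Sum>s<nS. ?z s) - (\<Sum>s<nS. c s * ?z s)) * (g st True - g st False)
      = (\<Sum>s<nS. ?z s * ((1 - c s) * g s False + c s * g s True + (\<alpha> - c s) * (g st True - g st False)))"
      by (simp add: sum.distrib sum_subtractf sum_distrib_left sum_distrib_right algebra_simps)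
    also have "\<dots> = (\<Sum>s<nS. ?z s * (w s + R_rel nS P r \<alpha>))"
      by (intro sum.cong refl) (simp add: gbar)
    also have "\<dots> = (\<Sum>i<N. w (?S i) + R_rel nS P r \<alpha>)"
      using S by (subst sum_by_state_action[of "{..<N}" ?S nS "\<lambda>s _. w s + R_rel nS P r \<alpha>" "\<lambda>_. True"])
        (auto simp: algebra_simps)
    also have "\<dots> = real N * (potential w x + R_rel nS P r \<alpha>)"
      using N by (simp add: potential_def sum.distrib algebra_simps)
    finally show ?thesis using N Do by simp
  qed
  have Vb: "\<bar>potential w z\<bar> \<le> W" for z by (rule abs_potential_le[OF W])
  define H where "H A = (\<Sum>i<N. \<Sum>j<nS. pmf (P (?S i) (A i)) j * w j) / real N" for A
  have Kw: "measure_pmf.expectation (K x) (potential w) = measure_pmf.expectation (action_pmf dsel act x) H"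
  proof -
    have inner: "measure_pmf.expectation (Pi_pmf {..<N} 0 (\<lambda>i. P (?S i) (A i))) (\<lambda>S'. potential w (S', D)) = H A" for A D
    proof -
      have "measure_pmf.expectation (P (?S i) (A i)) w = (\<Sum>j<nS. pmf (P (?S i) (A i)) j * w j)" if "i < N" for i
        using P_states[OF S[OF that]] by (subst integral_measure_pmf[of "{..<nS}"]) auto
      then show ?thesis
        unfolding potential_def fst_conv H_def by (simp add: expectation_sum_Pi_pmf[of w W, OF W])
    qed
    have bd: "\<bar>H A\<bar> \<le> W" for A
      unfolding inner[of A "({}, {})", symmetric] by (rule abs_expectation_le) (rule Vb)
    show ?thesis
      unfolding step_pmf_def action_pmf_def
      by (simp add: expectation_bind_pmf_bounded[of _ W] Vb bd case_prod_beta inner)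
  qed
  have "stage_reward N r dsel act x + measure_pmf.expectation (K x) (potential w)
    = measure_pmf.expectation (action_pmf dsel act x) (\<lambda>A. (\<Sum>i<N. g (?S i) (A i)) / real N)"
    unfolding stage_reward_def Kw H_def
  proof (subst Bochner_Integration.integral_add[symmetric])
    show "integrable (measure_pmf (action_pmf dsel act x)) (\<lambda>A. (\<Sum>i<N. r (?S i) (A i)) / real N)"
      by (intro measure_pmf.integrable_const_bound[where B=r_max] AE_I2)
        (unfold real_norm_def, intro abs_arm_average_le r_max S, simp_all)
    show "integrable (measure_pmf (action_pmf dsel act x)) (\<lambda>A. (\<Sum>i<N. \<Sum>j<nS. pmf (P (?S i) (A i)) j * w j) / real N)"
    proof (intro measure_pmf.integrable_const_bound[where B="real nS * W"])
      show "AE A in measure_pmf (action_pmf dsel act x). norm ((\<Sum>i<N. \<Sum>j<nS. pmf (P (?S i) (A i)) j * w j) / real N) \<le> real nS * W"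
      proof (rule AE_I2)
        fix A
        show "norm ((\<Sum>i<N. \<Sum>j<nS. pmf (P (?S i) (A i)) j * w j) / real N) \<le> real nS * W"
          unfolding real_norm_def by (intro abs_arm_average_le Pw)
      qed
    qed simp
  qed (simp add: g_def sum.distrib add_divide_distrib)
  also have "\<dots> = measure_pmf.expectation (dsel x) (\<lambda>_. potential w x + R_rel nS P r \<alpha>)"
  proof -
    \<comment> \<open>Clipping at a bound that the average already obeys changes nothing, and makes
      boundedness evident for every action profile.\<close>
    define G where "G A = max (- (r_max + real nS * W)) (min (r_max + real nS * W) ((\<Sum>i<N. g (?S i) (A i)) / real N))" for A
    have eq: "(\<Sum>i<N. g (?S i) (A i)) / real N = G A" for A
    proof -
      have "\<bar>g (?S i) (A i)\<bar> \<le> r_max + real nS * W" if "i < N" for i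
      proof -
        show ?thesis using r_max[OF S[OF that], of "A i"] Pw[of "?S i" "A i"] unfolding g_def by linarith
      qed
      then have "\<bar>(\<Sum>i<N. g (?S i) (A i)) / real N\<bar> \<le> r_max + real nS * W" by (rule abs_arm_average_le)
      then show ?thesis unfolding G_def by linarith
    qed
    have bd: "\<bar>G A\<bar> \<le> r_max + real nS * W" for A
    proof -
      have "0 \<le> real nS * W" using W0 by simp
      then have "0 \<le> r_max + real nS * W" using r_max[OF nS, of True] by linarith
      moreover have "\<bar>max (- b) (min b q)\<bar> \<le> b" if "0 \<le> b" for b q :: real
        using that by (simp add: abs_le_iff min_def max_def)
      ultimately show ?thesis unfolding G_def by blast
    qed
    show ?thesis
      unfolding eq action_pmf_def
      unfolding expectation_bind_pmf_bounded[of G, OF bd]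
      by (rule integral_cong_AE) (auto simp: AE_measure_pmf_iff per_action[unfolded eq])
  qed
  also have "\<dots> = potential w x + R_rel nS P r \<alpha>" by simp
  finally show ?thesis .
qed

text \<open>On bad states the Poisson identity can fail by at most the factor in front of b, so one
  inequality with an indicator holds on all reachable states. Summed over time, the potential
  telescopes to a bounded term and the first \<open>\<tau>\<close> steps contribute a bounded
  amount; both vanish in the time average.\<close>

lemma gap_le_bad_probability:
  assumes w: "\<And>i. i < nS \<Longrightarrow> w i = rho i + (\<Sum>j<nS. \<Phi> $$ (i, j) * w j)"
    and W: "\<And>s. \<bar>w s\<bar> \<le> W"
    and b: "\<And>t. t \<ge> \<tau> \<Longrightarrow> measure_pmf.prob (chain K t (S0, {}, {})) (bad_states nS P \<alpha> y st \<eta> efe N) \<le> b"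
  shows "R_rel nS P r \<alpha> - avg_reward N P r dsel act S0 \<le> (r_max + 2 * W + \<bar>R_rel nS P r \<alpha>\<bar>) * b"
proof -
  let ?R = "R_rel nS P r \<alpha>" and ?bad = "bad_states nS P \<alpha> y st \<eta> efe N" and ?x0 = "(S0, {}, {}) :: cstate"
  let ?SR = "stage_reward N r dsel act"
  define K0 where "K0 = r_max + 2 * W + \<bar>?R\<bar>"
  have W0: "0 \<le> W" using W[of 0] by simp
  have K0: "0 \<le> K0" unfolding K0_def using W0 r_max[OF nS, of True] by linarith
  have Vb: "\<bar>potential w z\<bar> \<le> W" for z by (rule abs_potential_le[OF W])
  have EVb: "\<bar>measure_pmf.expectation p (potential w)\<bar> \<le> W" for p by (rule abs_expectation_le) (rule Vb)
  have one: "?R + potential w x \<le> ?SR x + measure_pmf.expectation (K x) (potential w) + K0 * indicat_real ?bad x"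
    if x: "x \<in> X" for x
  proof (cases "x \<in> ?bad")
    case True
    then have ind: "indicat_real ?bad x = 1" by simp
    show ?thesis
      unfolding ind mult_1_right K0_def using Vb[of x] EVb[of "K x"] stage_reward_bound[OF x] by linarith
  next
    case False
    then show ?thesis using poisson_on_good_states[OF w W x False] by simp
  qed
  define p where "p t = measure_pmf.prob (chain K t ?x0) ?bad" for t
  have supp: "set_pmf (chain K t ?x0) \<subseteq> X" for t
    by (rule set_chain_subset[OF reachable_closed init_reachable])
  have int: "integrable (measure_pmf (chain K t ?x0)) h" for t and h :: "cstate \<Rightarrow> real"
    using finite_subset[OF supp finite_reachable] by (rule integrable_measure_pmf_finite)
  have step: "?R + measure_pmf.expectation (chain K t ?x0) (potential w)
    \<le> measure_pmf.expectation (chain K t ?x0) ?SR + measure_pmf.expectation (chain K (Suc t) ?x0) (potential w) + K0 * p t" for t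
  proof -
    let ?E = "measure_pmf.expectation (chain K t ?x0)"
    have "?E (\<lambda>x. ?R + potential w x)
      \<le> ?E (\<lambda>x. ?SR x + measure_pmf.expectation (K x) (potential w) + K0 * indicat_real ?bad x)"
    proof (intro integral_mono_AE int AE_pmfI)
      fix x assume "x \<in> set_pmf (chain K t ?x0)"
      then have "x \<in> X" using supp by blast
      then show "?R + potential w x \<le> ?SR x + measure_pmf.expectation (K x) (potential w) + K0 * indicat_real ?bad x"
        by (rule one)
    qed
    moreover have "?E (\<lambda>x. ?R + potential w x) = ?R + ?E (potential w)"
      by (subst Bochner_Integration.integral_add[OF int int]) simp
    moreover have "?E (\<lambda>x. ?SR x + measure_pmf.expectation (K x) (potential w) + K0 * indicat_real ?bad x)
      = ?E ?SR + ?E (\<lambda>x. measure_pmf.expectation (K x) (potential w)) + K0 * p t"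
      unfolding p_def
      by (subst Bochner_Integration.integral_add[OF int int], subst Bochner_Integration.integral_add[OF int int]) simp
    moreover have "?E (\<lambda>x. measure_pmf.expectation (K x) (potential w))
      = measure_pmf.expectation (chain K (Suc t) ?x0) (potential w)"
      unfolding chain_Suc by (rule expectation_bind_pmf_bounded[OF Vb, symmetric])
    ultimately show ?thesis by simp
  qed
  define a where "a T = (\<Sum>t<T. measure_pmf.expectation (chain K t ?x0) ?SR)" for T
  have sum: "real T * ?R + potential w ?x0 - measure_pmf.expectation (chain K T ?x0) (potential w)
      \<le> a T + K0 * (\<Sum>t<T. p t)" for T
  proof (induction T)
    case 0
    show ?case by (simp add: chain_0 a_def)
  next
    case (Suc T)
    then show ?case using step[of T] by (simp add: a_def algebra_simps)
  qed
  have p1: "p t \<le> 1" for t by (simp add: p_def)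
  have b0: "0 \<le> b" using b[of \<tau>] measure_nonneg order_trans by blast
  have sp: "(\<Sum>t<T. p t) \<le> real \<tau> + real T * b" for T
  proof -
    have "(\<Sum>t<T. p t) \<le> (\<Sum>t<T. (if t < \<tau> then 1 else 0) + b)"
      using p1 b b0 by (intro sum_mono) (auto simp: p_def add_increasing2 not_less)
    also have "\<dots> = real (card ({..<T} \<inter> {t. t < \<tau>})) + real T * b"
      by (simp add: sum.distrib sum.If_cases)
    also have "card ({..<T} \<inter> {t. t < \<tau>}) \<le> card {..<\<tau>}" by (intro card_mono) auto
    finally show ?thesis by simp
  qed
  have lower: "?R - K0 * b - (2 * W + K0 * real \<tau>) / real T \<le> a T / real T" if "T \<ge> 1" for T
  proof -
    have "K0 * (\<Sum>t<T. p t) \<le> K0 * (real \<tau> + real T * b)" using K0 sp by (rule mult_left_mono[rotated])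
    then have "real T * (?R - K0 * b) - (2 * W + K0 * real \<tau>) \<le> a T"
      using sum[of T] Vb[of ?x0] EVb[of "chain K T ?x0"] by (simp add: abs_le_iff algebra_simps)
    then have "(real T * (?R - K0 * b) - (2 * W + K0 * real \<tau>)) / real T \<le> a T / real T"
      by (rule divide_right_mono) simp
    then show ?thesis using that by (simp add: diff_divide_distrib)
  qed
  have "(\<lambda>T. ?R - K0 * b - (2 * W + K0 * real \<tau>) / real T) \<longlonglongrightarrow> ?R - K0 * b - 0"
    by (intro tendsto_diff tendsto_const lim_const_over_n)
  moreover have "(\<lambda>T. a T / real T) \<longlonglongrightarrow> avg_reward N P r dsel act S0"
    using avg_reward_eq_lim unfolding a_def .
  ultimately have "?R - K0 * b - 0 \<le> avg_reward N P r dsel act S0"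
    by (rule LIMSEQ_le) (use lower in blast)
  then show ?thesis by (simp add: K0_def)
qed

end

section \<open>Exponential bounds on the probability of bad states\<close>

locale two_set_lyapunov_chain = two_set_chain nS P r \<alpha> y st \<eta> efe erd N dsel act S0 +
  lyapunov_bandit nS P r \<alpha> y st L \<gamma> \<eta>
  for nS P r \<alpha> y st \<eta> efe erd N dsel act S0 L \<gamma>
begin

text \<open>Given the sets and the actions, the arms move independently. Half of e covers the
  rounding of the actions and half the sampling noise; the factor 4 counts two sets and two tails,
  for each of the \<open>nS\<close> states.\<close>

lemma bad_step_probability:
  assumes x: "x \<in> X" and e: "0 < e" and Ne: "(real nS)\<^sup>2 / real N \<le> e / 2"
  shows "measure_pmf.prob (K x) {x'. \<not> good_step N e efe erd x x'} \<le> 4 * real nS * exp (- (e\<^sup>2 / 2) * real N)"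
proof -
  let ?S = "fst x" and ?p = "exp (- (e\<^sup>2 / 2) * real N)"
  note S = reachable_states[OF x]
  have main: "measure_pmf.prob (map_pmf (\<lambda>S'. (S', Do, Dp)) (Pi_pmf {..<N} 0 (\<lambda>i. P (?S i) (A i))))
      {x'. \<not> good_step N e efe erd x x'} \<le> 4 * real nS * ?p"
    if D: "(Do, Dp) \<in> set_pmf (dsel x)" and A: "A \<in> set_pmf (act ?S Do Dp)" for Do Dp A
  proof -
    note sel = policy_valid(1)[OF x D] and av = policy_valid(2)[OF x D]
    have sub: "Do \<subseteq> {..<N}" "Dp \<subseteq> {..<N}" using sel_valid_subsets[OF sel] by auto
    have fin: "finite Do" "finite Dp" using sub finite_subset by auto
    let ?M = "Pi_pmf {..<N} 0 (\<lambda>i. P (?S i) (A i))"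
    define dev_ev where "dev_ev D j = {S'. \<bar>real (card {i \<in> D. S' i = j}) - (\<Sum>i\<in>D. pmf (P (?S i) (A i)) j)\<bar> \<ge> (e / 2) * real N}"
      for D j
    have close: "\<bar>Xs N S' D j - b / real N\<bar> \<le> e"
      if "S' \<notin> dev_ev D j" "\<bar>(\<Sum>i\<in>D. pmf (P (?S i) (A i)) j) - b\<bar> \<le> (real nS)\<^sup>2" for S' D j b
    proof -
      have "(real nS)\<^sup>2 \<le> (e / 2) * real N" using Ne N by (simp add: field_simps)
      moreover have "\<bar>real (card {i \<in> D. S' i = j}) - (\<Sum>i\<in>D. pmf (P (?S i) (A i)) j)\<bar> < (e / 2) * real N"
        using that(1) by (simp add: dev_ev_def)
      moreover have "\<bar>a - b\<bar> \<le> \<bar>a - a'\<bar> + \<bar>a' - b\<bar>" for a a' :: real by linarith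
      ultimately have "\<bar>real (card {i \<in> D. S' i = j}) - b\<bar> \<le> (e / 2) * real N + (e / 2) * real N"
        using that(2) by (meson add_mono less_imp_le order_trans)
      then have "\<bar>real (card {i \<in> D. S' i = j}) - b\<bar> \<le> e * real N" by simp
      then have "\<bar>(real (card {i \<in> D. S' i = j}) - b) / real N\<bar> \<le> e"
        using N by (simp add: abs_divide divide_le_eq)
      then show ?thesis by (simp add: Xs_def diff_divide_distrib)
    qed
    have Xs_cnt: "Xs N ?S D = (\<lambda>s. (1 / real N) * cnt ?S D s)" for D by (auto simp: Xs_def cnt_def)
    have "good_step N e efe erd x (S', Do, Dp)"
      if S': "S' \<in> set_pmf ?M" and ndev: "\<forall>j<nS. S' \<notin> dev_ev Do j \<and> S' \<notin> dev_ev Dp j" for S'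
      unfolding good_step_def fst_conv snd_conv
    proof (intro conjI allI impI)
      fix i assume i: "i < N"
      show "?S i < nS" by (rule S[OF i])
      have "S' i \<in> set_pmf (P (?S i) (A i))" using S' i by (auto simp: set_Pi_pmf PiE_dflt_def)
      then show "S' i < nS" using P_states[OF S[OF i]] by auto
    next
      fix j assume j: "j < nS"
      have "\<bar>Xs N S' Do j - (real (card Do) * \<mu> j + vmul nS \<Phi> (cnt ?S Do) j) / real N\<bar> \<le> e"
        using ndev j sub S by (intro close olc_next_state_mean[OF av A fin(1)]) auto
      then show "\<bar>Xs N S' Do j - mD N Do * \<mu> j - vmul nS \<Phi> (Xs N ?S Do) j\<bar> \<le> e"
        unfolding Xs_cnt[of Do] vmul_cmult by (simp add: mD_def add_divide_distrib diff_diff_add)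
      have "\<bar>Xs N S' Dp j - vmul nS Q (cnt ?S Dp) j / real N\<bar> \<le> e"
        using ndev j sub S by (intro close uoc_next_state_mean[OF av A fin(2)]) auto
      then show "\<bar>Xs N S' Dp j - vmul nS Q (Xs N ?S Dp) j\<bar> \<le> e"
        unfolding Xs_cnt[of Dp] vmul_cmult by simp
    qed (rule sel)
    then have "((\<lambda>S'. (S', Do, Dp)) -` {x'. \<not> good_step N e efe erd x x'}) \<inter> set_pmf ?M
        \<subseteq> (\<Union>j<nS. dev_ev Do j \<union> dev_ev Dp j)" by auto
    then have "measure_pmf.prob ?M (((\<lambda>S'. (S', Do, Dp)) -` {x'. \<not> good_step N e efe erd x x'}) \<inter> set_pmf ?M)
        \<le> measure_pmf.prob ?M (\<Union>j<nS. dev_ev Do j \<union> dev_ev Dp j)"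
      by (intro measure_pmf.finite_measure_mono) auto
    also have "\<dots> \<le> (\<Sum>j<nS. measure_pmf.prob ?M (dev_ev Do j \<union> dev_ev Dp j))"
      by (intro measure_pmf.finite_measure_subadditive_finite) auto
    also have "\<dots> \<le> (\<Sum>j<nS. 2 * ?p + 2 * ?p)"
    proof (rule sum_mono)
      fix j
      have conc: "measure_pmf.prob ?M (dev_ev D j) \<le> 2 * ?p" if "D \<subseteq> {..<N}" for D
        unfolding dev_ev_def
        using Pi_pmf_count_concentration[OF that N, of "e / 2" 0 "\<lambda>i. P (?S i) (A i)" j] e
        by (simp add: power_divide)
      have "measure_pmf.prob ?M (dev_ev Do j \<union> dev_ev Dp j)
          \<le> measure_pmf.prob ?M (dev_ev Do j) + measure_pmf.prob ?M (dev_ev Dp j)"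
        by (intro measure_Un_le) auto
      then show "measure_pmf.prob ?M (dev_ev Do j \<union> dev_ev Dp j) \<le> 2 * ?p + 2 * ?p"
        using conc[OF sub(1)] conc[OF sub(2)] by linarith
    qed
    finally show ?thesis by (simp add: measure_Int_set_pmf)
  qed
  have nonneg: "0 \<le> 4 * real nS * ?p" by simp
  have "measure_pmf.prob (K x) {x'. \<not> good_step N e efe erd x x'}
      \<le> measure_pmf.prob (dsel x) (- UNIV) + 4 * real nS * ?p"
    unfolding step_pmf_def
  proof (rule prob_bind_le[OF _ nonneg])
    fix D assume D: "D \<in> set_pmf (dsel x)"
    obtain Do Dp where DD: "D = (Do, Dp)" by (cases D)
    have "measure_pmf.prob (bind_pmf (act ?S Do Dp) (\<lambda>A. map_pmf (\<lambda>S'. (S', Do, Dp)) (Pi_pmf {..<N} 0 (\<lambda>i. P (?S i) (A i)))))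
        {x'. \<not> good_step N e efe erd x x'} \<le> measure_pmf.prob (act ?S Do Dp) (- UNIV) + 4 * real nS * ?p"
      using D DD by (intro prob_bind_le[OF main nonneg]) auto
    then show "measure_pmf.prob (case D of (Do, Dp) \<Rightarrow> bind_pmf (act ?S Do Dp)
        (\<lambda>A. map_pmf (\<lambda>S'. (S', Do, Dp)) (Pi_pmf {..<N} 0 (\<lambda>i. P (?S i) (A i)))))
        {x'. \<not> good_step N e efe erd x x'} \<le> 4 * real nS * ?p"
      using DD by simp
  qed
  then show ?thesis by simp
qed

text \<open>The chain is restarted \<open>\<tau>\<close> steps before t. From whatever reachable
  state it is in then, \<open>\<tau>\<close> good steps lead out of the bad states, so a bad state
  at time t requires a bad step in between.\<close>

lemma bad_probability:
  assumes e: "0 < e" and Ne: "(real nS)\<^sup>2 / real N \<le> e / 2" and t: "t \<ge> \<tau>"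
    and attract: "\<And>xs. \<forall>k<\<tau>. good_step N e efe erd (xs k) (xs (Suc k))
      \<Longrightarrow> 0 \<le> slack nS P \<alpha> y st \<eta> efe N (fst (xs \<tau>)) {..<N}"
  shows "measure_pmf.prob (chain K t (S0, {}, {})) (bad_states nS P \<alpha> y st \<eta> efe N)
    \<le> real \<tau> * (4 * real nS * exp (- (e\<^sup>2 / 2) * real N))"
proof -
  let ?bad = "bad_states nS P \<alpha> y st \<eta> efe N" and ?p = "4 * real nS * exp (- (e\<^sup>2 / 2) * real N)"
  have "chain K t (S0, {}, {}) = bind_pmf (chain K (t - \<tau>) (S0, {}, {})) (chain K \<tau>)"
    using chain_add[of K "t - \<tau>" \<tau>] t by simp
  moreover have "measure_pmf.prob (bind_pmf (chain K (t - \<tau>) (S0, {}, {})) (chain K \<tau>)) ?bad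
      \<le> measure_pmf.prob (chain K (t - \<tau>) (S0, {}, {})) (- UNIV) + real \<tau> * ?p"
  proof (rule prob_bind_le)
    fix x assume "x \<in> set_pmf (chain K (t - \<tau>) (S0, {}, {}))"
    then have x: "x \<in> X" using set_chain_subset[of X K, OF reachable_closed init_reachable] by blast
    have "?bad \<subseteq> {z. \<not> (\<exists>xs. xs \<tau> = z \<and> (\<forall>i<\<tau>. good_step N e efe erd (xs i) (xs (Suc i))))}"
    proof (intro subsetI CollectI notI, elim exE conjE)
      fix z xs assume z: "z \<in> ?bad" "xs \<tau> = z" "\<forall>i<\<tau>. good_step N e efe erd (xs i) (xs (Suc i))"
      then have "0 \<le> slack nS P \<alpha> y st \<eta> efe N (fst (xs \<tau>)) {..<N}" by (intro attract) blast
      then show False using z by (simp add: bad_states_def)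
    qed
    then have "measure_pmf.prob (chain K \<tau> x) ?bad
      \<le> measure_pmf.prob (chain K \<tau> x) {z. \<not> (\<exists>xs. xs \<tau> = z \<and> (\<forall>i<\<tau>. good_step N e efe erd (xs i) (xs (Suc i))))}"
      by (intro measure_pmf.finite_measure_mono) auto
    also have "\<dots> \<le> real \<tau> * ?p"
      by (rule chain_good_path_prob[of X K x ?p, OF reachable_closed x _ bad_step_probability[OF _ e Ne]]) simp_all
    finally show "measure_pmf.prob (chain K \<tau> x) ?bad \<le> real \<tau> * ?p" .
  qed simp
  ultimately show ?thesis by simp
qed

end

theorem theorem1:
  fixes nS :: nat and P :: "nat \<Rightarrow> bool \<Rightarrow> nat pmf" and r :: "nat \<Rightarrow> bool \<Rightarrow> real"
    and \<alpha> :: real and ystar :: "nat \<Rightarrow> bool \<Rightarrow> real" and st :: nat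
    and \<eta> K1 :: real and efe erd :: "nat \<Rightarrow> real"
    and dsel :: "nat \<Rightarrow> cstate \<Rightarrow> (nat set \<times> nat set) pmf"
    and act :: "nat \<Rightarrow> (nat \<Rightarrow> nat) \<Rightarrow> nat set \<Rightarrow> nat set \<Rightarrow> (nat \<Rightarrow> bool) pmf"
  assumes states: "nS > 0" "\<forall>s<nS. \<forall>a. set_pmf (P s a) \<subseteq> {..<nS}"
    and alpha: "0 < \<alpha>" "\<alpha> < 1"
    and opt: "lp_optimal nS P r \<alpha> ystar"
    and A1: "assumption1 nS P ystar"
    and A2: "assumption2 nS ystar st"
    and A3: "assumption3 nS P \<alpha> ystar st"
    and eta: "\<eta> > 0"
    and eps: "\<forall>N. N > 0 \<longrightarrow> 0 \<le> efe N \<and> efe N \<le> K1 / real N \<and> 0 \<le> erd N \<and> erd N \<le> K1 / real N"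
    and fe: "\<forall>N. N > 0 \<longrightarrow> \<alpha> * real N \<in> \<int> \<longrightarrow> feasibility_ensuring nS P \<alpha> ystar st N \<eta> (efe N)"
    and pol: "\<forall>N. N > 0 \<longrightarrow> \<alpha> * real N \<in> \<int> \<longrightarrow>
                 two_set_policy nS P \<alpha> ystar st \<eta> (efe N) (erd N) N (dsel N) (act N)"
  shows "\<exists>C>0. \<exists>K>0. \<forall>N. N > 0 \<longrightarrow> \<alpha> * real N \<in> \<int> \<longrightarrow>
           (\<forall>S0. (\<forall>i<N. S0 i < nS) \<longrightarrow>
              R_rel nS P r \<alpha> - avg_reward N P r (dsel N) (act N) S0 \<le> K * exp (- C * real N))"
proof -
  interpret rb: restless_bandit nS P r \<alpha> ystar st
    using states alpha opt A1 A2 A3 by unfold_locales auto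
  obtain L \<gamma> where "lyapunov_bandit nS P r \<alpha> ystar st L \<gamma> \<eta>"
    using rb.ex_lyapunov_bandit[OF eta] by blast
  then interpret ly: lyapunov_bandit nS P r \<alpha> ystar st L \<gamma> \<eta> .
  obtain e \<tau> where e: "0 < e" and attract: "\<And>N efe erd x. \<lbrakk>0 < N; 1 / real N \<le> e; 0 \<le> efe; efe \<le> e; 0 \<le> erd; erd \<le> e;
        \<forall>k<\<tau>. ly.good_step N e efe erd (x k) (x (Suc k))\<rbrakk>
      \<Longrightarrow> 0 \<le> slack nS P \<alpha> ystar st \<eta> efe N (fst (x \<tau>)) {..<N}"
    using ly.attraction by blast
  \<comment> \<open>Defined before \<open>N\<close> is fixed, so that w, W and K0 are common to all
    \<open>N\<close>.\<close>
  define rho where "rho i = (1 - pibar ystar True i) * r i False + pibar ystar True i * r i True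
      + (\<alpha> - pibar ystar True i) * (r st True - r st False)" for i
  obtain w0 where w0: "\<And>i. i < nS \<Longrightarrow> w0 i = rho i + (\<Sum>j<nS. Phi nS P \<alpha> ystar st $$ (i, j) * w0 j)"
    using rb.ex_poisson_solution by blast
  \<comment> \<open>Zero off the state space, so that W bounds w at every natural number.\<close>
  define w where "w s = (if s < nS then w0 s else 0)" for s
  define W where "W = (\<Sum>s<nS. \<bar>w0 s\<bar>)"
  have W: "\<bar>w s\<bar> \<le> W" for s
    using member_le_sum[of s "{..<nS}" "\<lambda>s. \<bar>w0 s\<bar>"] by (auto simp: w_def W_def intro: sum_nonneg)
  define rmax where "rmax = (\<Sum>s<nS. \<Sum>a\<in>UNIV. \<bar>r s a\<bar>)"
  define K0 where "K0 = rmax + 2 * W + \<bar>R_rel nS P r \<alpha>\<bar>"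
  have K0: "0 \<le> K0" by (auto simp: K0_def rmax_def W_def intro!: add_nonneg_nonneg sum_nonneg)
  define C where "C = e\<^sup>2 / 2"
  have C: "0 < C" using e by (simp add: C_def)
  \<comment> \<open>From N0 on, e dominates 1/N and both policy parameters, and e/2 dominates the
    rounding error of the actions.\<close>
  obtain N0 where N0: "max (1 / e) (max (\<bar>K1\<bar> / e) ((real nS)\<^sup>2 / (e / 2))) \<le> real N0"
    using real_arch_simple by blast
  \<comment> \<open>Below N0 only the trivial bound K0 on the gap is available, and
    \<open>exp (C * real N0)\<close> offsets the decay there. The second summand serves
    \<open>N\<close> from N0 on, and 1 ensures positivity.\<close>
  define K where "K = K0 * exp (C * real N0) + K0 * (real \<tau> * (4 * real nS)) + 1"
  have K: "0 < K" using K0 by (simp add: K_def add_nonneg_pos)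
  have bound: "R_rel nS P r \<alpha> - avg_reward N P r (dsel N) (act N) S0 \<le> K * exp (- C * real N)"
    if N: "N > 0" and int: "\<alpha> * real N \<in> \<int>" and S0: "\<forall>i<N. S0 i < nS" for N S0
  proof -
    interpret ch: two_set_lyapunov_chain nS P r \<alpha> ystar st \<eta> "efe N" "erd N" N "dsel N" "act N" S0 L \<gamma>
      by unfold_locales (use N int S0 pol in auto)
    have w: "w i = ch.rho i + (\<Sum>j<nS. Phi nS P \<alpha> ystar st $$ (i, j) * w j)" if "i < nS" for i
      using w0[OF that] that by (simp add: w_def ch.rho_def rho_def)
    have gap: "R_rel nS P r \<alpha> - avg_reward N P r (dsel N) (act N) S0 \<le> K0 * b"
      if "\<And>t. t \<ge> \<tau> \<Longrightarrow> measure_pmf.prob (chain ch.K t (S0, {}, {})) (bad_states nS P \<alpha> ystar st \<eta> (efe N) N) \<le> b" for b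
      using ch.gap_le_bad_probability[OF w W that] by (simp add: K0_def rmax_def ch.r_max_def)
    show ?thesis
    proof (cases "N0 \<le> N")
      case True
      have large: "a \<le> real N * d" if "a / d \<le> real N0" "0 < d" for a d
        using that True by (simp add: field_simps) (meson order_trans mult_left_mono of_nat_le_iff less_imp_le mult.commute)
      have "1 \<le> real N * e" "\<bar>K1\<bar> \<le> real N * e" "(real nS)\<^sup>2 \<le> real N * (e / 2)"
        using N0 e by (auto intro!: large)
      then have Ne: "1 / real N \<le> e" "K1 / real N \<le> e" "(real nS)\<^sup>2 / real N \<le> e / 2"
        using N by (auto simp: divide_le_eq mult.commute)
      have "efe N \<le> e" "erd N \<le> e" "0 \<le> efe N" "0 \<le> erd N" using eps N Ne(2) by (meson order_trans)+
      then have "measure_pmf.prob (chain ch.K t (S0, {}, {})) (bad_states nS P \<alpha> ystar st \<eta> (efe N) N)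
          \<le> real \<tau> * (4 * real nS * exp (- (e\<^sup>2 / 2) * real N))" if "t \<ge> \<tau>" for t
        using N Ne that by (intro ch.bad_probability[OF e] attract) auto
      then have "R_rel nS P r \<alpha> - avg_reward N P r (dsel N) (act N) S0
          \<le> K0 * (real \<tau> * (4 * real nS * exp (- (e\<^sup>2 / 2) * real N)))" by (rule gap)
      also have "\<dots> = K0 * (real \<tau> * (4 * real nS)) * exp (- C * real N)" by (simp add: C_def)
      also have "\<dots> \<le> K * exp (- C * real N)" using K0 by (simp add: K_def)
      finally show ?thesis .
    next
      case False
      have "R_rel nS P r \<alpha> - avg_reward N P r (dsel N) (act N) S0 \<le> K0 * 1" by (rule gap) simp
      also have "\<dots> \<le> K0 * exp (C * real N0 + - C * real N)"
        using K0 C False by (intro mult_left_mono) (auto simp: mult_left_mono)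
      also have "\<dots> = K0 * exp (C * real N0) * exp (- C * real N)" by (simp add: exp_add[symmetric])
      also have "\<dots> \<le> K * exp (- C * real N)" using K0 by (simp add: K_def)
      finally show ?thesis .
    qed
  qed
  show ?thesis using C K bound by blast
qed

end
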